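(* Let $R=K[X_1,\dots,X_d]$ be a polynomial ring in $d$ variables over a field $K$, let $m_R=(X_1,\dots,X_d)$, let $I_1,\dots,I_r$ be monomial ideals of $R$ and let $J$ be any ideal of $R$. Then the symbolic multi-Rees algebra $S_J(I_1,\dots,I_r)$ is a Noetherian $\mathbb{N}^r$-graded $R$-algebra. If $J=m_R$, there exists a piecewise quasi-polynomial $F:\mathbb{N}^r\to\mathbb{N}$ such that $$l_R\left(H^0_{m_R}\left(\frac{R}{I_1^{n_1}\cdots I_r^{n_r}}\right)\right)=F(n_1,\dots,n_r)$$ for all $n_1,\dots,n_r\gg 0$. Moreover, this length function is bounded above, for all $n_1,\dots,n_r\gg0$, by a numerical polynomial in $n_1,\dots,n_r$ of total degree at most $d$.
   Context: For ideals $I_1,\dots,I_r,J$ of a ring $R$ and $\mathbf{n}=(n_1,\dots,n_r)\in\mathbb{N}^r$ write $\mathbf{I}^{\mathbf{n}}=I_1^{n_1}\cdots I_r^{n_r}$ and $\mathbf{t}^{\mathbf{n}}=t_1^{n_1}\cdots t_r^{n_r}$ with $t_i$ indeterminates. The symbolic multi-Rees algebra is $S_J(I_1,\dots,I_r)=\bigoplus_{\mathbf{n}\in\mathbb{N}^r}(\mathbf{I}^{\mathbf{n}}:_R J^\infty)\mathbf{t}^{\mathbf{n}}\subseteq R[t_1,\dots,t_r]$, where $I:_RJ^\infty=\bigcup_{k}(I:_RJ^k)$. $H^0_{m_R}(N)$ denotes the submodule of elements of $N$ annihilated by a power of $m_R$. A numerical polynomial is a polynomial in $\mathbb{Q}[n_1,\dots,n_r]$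 taking integer values at integer points. A map $\sigma:\mathbb{N}^r\to\mathbb{Q}$ is periodic if there is $\alpha\in\mathbb{N}$ with $\sigma(\mathbf{n}+\alpha\mathbf{e}_i)=\sigma(\mathbf{n})$ for all $\mathbf{n}$ and all $i$ ($\mathbf{e}_i$ the standard unit vectors). A quasi-polynomial is a function $f:\mathbb{N}^r\to\mathbb{Q}$ of the form $f(\mathbf{n})=\sum_{|\mathbf{i}|\le D}\sigma_{\mathbf{i}}(\mathbf{n})n_1^{i_1}\cdots n_r^{i_r}$ with all $\sigma_{\mathbf{i}}$ periodic. A piecewise quasi-polynomial is a function $F$ on $\mathbb{N}^r$ for which there is a finite partition $\mathbb{N}^r=\bigcup_{i=1}^t(P_i\cap\mathbb{N}^r)$ with $P_i$ polyhedra (not necessarily full-dimensional) and quasi-polynomials $f_i$ with $F=f_i$ on $P_i\cap\mathbb{N}^r$. *)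

theory Defs
  imports "HOL-Analysis.Analysis" "HOL-Library.Poly_Mapping" "HOL-Library.Extended_Nat"
begin

definition is_ideal :: "'a::comm_ring_1 set \<Rightarrow> bool" where
  "is_ideal I \<longleftrightarrow> 0 \<in> I \<and> (\<forall>x\<in>I. \<forall>y\<in>I. x + y \<in> I) \<and> (\<forall>x\<in>I. \<forall>a. a * x \<in> I)"

definition ideal_gen :: "'a::comm_ring_1 set \<Rightarrow> 'a set" where
  "ideal_gen S = \<Inter>{I. is_ideal I \<and> S \<subseteq> I}"

definition ideal_mult :: "'a::comm_ring_1 set \<Rightarrow> 'a set \<Rightarrow> 'a set" where
  "ideal_mult I J = ideal_gen {x * y | x y. x \<in> I \<and> y \<in> J}"

primrec ideal_pow :: "'a::comm_ring_1 set \<Rightarrow> nat \<Rightarrow> 'a set" where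
  "ideal_pow I 0 = UNIV"
| "ideal_pow I (Suc k) = ideal_mult I (ideal_pow I k)"

definition ideal_multipow :: "('r::finite \<Rightarrow> 'a::comm_ring_1 set) \<Rightarrow> ('r \<Rightarrow> nat) \<Rightarrow> 'a set" where
  "ideal_multipow I n = ideal_gen {(\<Prod>j\<in>UNIV. f j) | f. \<forall>j. f j \<in> ideal_pow (I j) (n j)}"

definition saturation :: "'a::comm_ring_1 set \<Rightarrow> 'a set \<Rightarrow> 'a set" where
  "saturation I J = {x. \<exists>k. \<forall>y\<in>ideal_pow J k. y * x \<in> I}"

type_synonym ('v, 'k) mpoly = "('v \<Rightarrow>\<^sub>0 nat) \<Rightarrow>\<^sub>0 'k"

definition monom :: "('v \<Rightarrow>\<^sub>0 nat) \<Rightarrow> ('v, 'k::field) mpoly" where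
  "monom a = Poly_Mapping.single a 1"

definition Var :: "'v \<Rightarrow> ('v, 'k::field) mpoly" where
  "Var v = monom (Poly_Mapping.single v 1)"

definition monomial_ideal :: "('v, 'k::field) mpoly set \<Rightarrow> bool" where
  "monomial_ideal I \<longleftrightarrow> (\<exists>M \<subseteq> range monom. I = ideal_gen M)"

definition max_ideal :: "('v, 'k::field) mpoly set" where
  "max_ideal = ideal_gen (range Var)"

text \<open>Elements of \<open>R[t_1,\<dots>,t_r]\<close> are finitely supported maps \<open>\<nat>^r \<rightarrow> R\<close>, \<open>n \<mapsto>\<close> coefficient of \<open>t^n\<close>.\<close>
definition symb_multi_rees ::
  "('a::comm_ring_1) set \<Rightarrow> ('r::finite \<Rightarrow> 'a set) \<Rightarrow> (('r \<Rightarrow>\<^sub>0 nat) \<Rightarrow>\<^sub>0 'a) set" where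
  "symb_multi_rees J I =
     {P. \<forall>n. Poly_Mapping.lookup P n \<in> saturation (ideal_multipow I (Poly_Mapping.lookup n)) J}"

definition is_subring :: "'a::comm_ring_1 set \<Rightarrow> bool" where
  "is_subring A \<longleftrightarrow> 1 \<in> A \<and> (\<forall>x\<in>A. \<forall>y\<in>A. x + y \<in> A \<and> x - y \<in> A \<and> x * y \<in> A)"

definition ideal_of :: "'a::comm_ring_1 set \<Rightarrow> 'a set \<Rightarrow> bool" where
  "ideal_of A I \<longleftrightarrow> I \<subseteq> A \<and> 0 \<in> I \<and> (\<forall>x\<in>I. \<forall>y\<in>I. x + y \<in> I) \<and> (\<forall>a\<in>A. \<forall>x\<in>I. a * x \<in> I)"

definition noetherian_subring :: "'a::comm_ring_1 set \<Rightarrow> bool" where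
  "noetherian_subring A \<longleftrightarrow>
     is_subring A \<and>
     (\<forall>L :: nat \<Rightarrow> 'a set. (\<forall>i. ideal_of A (L i)) \<and> (\<forall>i. L i \<subseteq> L (Suc i)) \<longrightarrow>
        (\<exists>N. \<forall>m\<ge>N. L m = L N))"

section \<open>Length of \<open>H^0_{m_R}(R/I) = (I :_R m_R^\<infinity>)/I\<close>\<close>

text \<open>Length of the \<open>R\<close>-module \<open>B/A\<close> for ideals \<open>A \<subseteq> B\<close>: supremum of lengths of
  strict chains of submodules, i.e. of ideals \<open>A = L_0 \<subset> \<dots> \<subset> L_n = B\<close>.\<close>
definition quot_length :: "'a::comm_ring_1 set \<Rightarrow> 'a set \<Rightarrow> enat" where
  "quot_length A B = Sup {enat n | n. \<exists>L :: nat \<Rightarrow> 'a set.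
      L 0 = A \<and> L n = B \<and> (\<forall>i\<le>n. is_ideal (L i)) \<and> (\<forall>i<n. L i \<subset> L (Suc i))}"

definition H0_length :: "('v, 'k::field) mpoly set \<Rightarrow> enat" where
  "H0_length I = quot_length I (saturation I max_ideal)"

definition periodic_fun :: "(('r::finite \<Rightarrow> nat) \<Rightarrow> rat) \<Rightarrow> bool" where
  "periodic_fun \<sigma> \<longleftrightarrow> (\<exists>\<alpha>::nat. \<alpha> > 0 \<and> (\<forall>n j. \<sigma> (n(j := n j + \<alpha>)) = \<sigma> n))"

definition quasi_poly :: "(('r::finite \<Rightarrow> nat) \<Rightarrow> rat) \<Rightarrow> bool" where
  "quasi_poly f \<longleftrightarrow> (\<exists>(D::nat) (\<sigma> :: ('r \<Rightarrow> nat) \<Rightarrow> ('r \<Rightarrow> nat) \<Rightarrow> rat).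
     (\<forall>i. periodic_fun (\<sigma> i)) \<and>
     (\<forall>n. f n = (\<Sum>i\<in>{i. sum i UNIV \<le> D}. \<sigma> i n * (\<Prod>j\<in>UNIV. of_nat (n j) ^ i j))))"

definition lattice_pt :: "('r::finite \<Rightarrow> nat) \<Rightarrow> real ^ 'r" where
  "lattice_pt n = (\<chi> j. real (n j))"

definition piecewise_quasi_poly :: "(('r::finite \<Rightarrow> nat) \<Rightarrow> rat) \<Rightarrow> bool" where
  "piecewise_quasi_poly F \<longleftrightarrow>
     (\<exists>(t::nat) (P :: nat \<Rightarrow> (real ^ 'r) set) (f :: nat \<Rightarrow> ('r \<Rightarrow> nat) \<Rightarrow> rat).
        (\<forall>i<t. polyhedron (P i) \<and> quasi_poly (f i)) \<and>
        (\<forall>n. \<exists>!i. i < t \<and> lattice_pt n \<in> P i) \<and>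
        (\<forall>i<t. \<forall>n. lattice_pt n \<in> P i \<longrightarrow> F n = f i n))"

definition poly_eval :: "nat \<Rightarrow> (('r::finite \<Rightarrow> nat) \<Rightarrow> rat) \<Rightarrow> ('r \<Rightarrow> int) \<Rightarrow> rat" where
  "poly_eval D c x = (\<Sum>i\<in>{i. sum i UNIV \<le> D}. c i * (\<Prod>j\<in>UNIV. of_int (x j) ^ i j))"

definition numerical_poly :: "nat \<Rightarrow> (('r::finite \<Rightarrow> nat) \<Rightarrow> rat) \<Rightarrow> bool" where
  "numerical_poly D c \<longleftrightarrow> (\<forall>x. poly_eval D c x \<in> \<int>)"

end

theory Submission
  imports Defs "HOL-Library.Multiset_Order"
begin

text \<open>
  The associated primes of a monomial ideal are generated by variables. Hence
  \<open>I^n : J^\<infinity>\<close> is spanned by the monomials \<open>X^a\<close> that lie in the contraction of the localisation of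
  \<open>I^n\<close> at \<open>(X_i : i \<in> A)\<close>, for every set \<open>A\<close> of variables whose prime does not contain \<open>J\<close>.
  For fixed \<open>A\<close> the pairs \<open>(a, n)\<close> form a finitely generated monoid, and by Dickson's lemma an
  intersection of finitely generated monoids is finitely generated. So the symbolic multi-Rees
  algebra is a finitely generated monoid algebra over \<open>K\<close>, and Hilbert's basis theorem applies.

  For \<open>J = m_R\<close> the length is the number of monomials in \<open>I^n : m_R^\<infinity>\<close> outside \<open>I^n\<close>.
  Dropping one variable \<open>X_i\<close> at a time shows that such a monomial has all exponents below \<open>c|n|\<close>,
  where \<open>c\<close> bounds the exponents of the generators; this gives the bound \<open>(c|n|)^d\<close>. Cutting both
  monoids by \<open>a_i \<le> c|n|\<close> makes all fibres over \<open>n\<close> finite, and the length becomes a difference of two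
  fibre counting functions of finitely generated monoids. Such a function is an alternating sum of
  shifted vector partition functions, which arise by iterated summation over intervals with affine
  bounds and are therefore piecewise quasi-polynomial.
\<close>

section \<open>Summation of piecewise quasi-polynomials\<close>

text \<open>Three obstacles shape the proof. Piecewise quasi-polynomials are awkward to add and
  multiply, since pieces must be refined and stay disjoint on lattice points; in
  \<open>quasi_alg\<close> these closures hold by construction, only summation up to a variable
  endpoint needs an argument, and polyhedra enter only in
  \<open>piecewise_quasi_poly_quasi_alg\<close>. Next, \<open>J\<close> need not be monomial. It
  acts on a monomial ideal only through the variable primes that do not contain it, because an
  element outside such a prime is a nonzerodivisor modulo the contracted ideal; this takes an
  additive order on exponents that compares the degree in \<open>A\<close> first. Finally, an
  element of a finitely generated monoid has many representations. The smallest ones are the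
  standard monomials of a toric ideal, and inclusion-exclusion over generators of its initial ideal
  leaves vector partition functions. For these, every generator must have positive degree, which the
  cut by \<open>c|n|\<close> also guarantees. All formulas are exact for every exponent vector, so
  "n >> 0" holds with threshold 0.\<close>

text \<open>Over affine functions \<open>L\<close>, this algebra consists of piecewise quasi-polynomials: rounded
  quotients produce the periodic coefficients, indicators the polyhedral pieces.\<close>
inductive_set quasi_alg :: "('x \<Rightarrow> int) set \<Rightarrow> ('x \<Rightarrow> rat) set" for L :: "('x \<Rightarrow> int) set" where
  div: "l \<in> L \<Longrightarrow> a > 0 \<Longrightarrow> (\<lambda>x. of_int (l x div a)) \<in> quasi_alg L"
| indicator: "l \<in> L \<Longrightarrow> (\<lambda>x. of_bool (l x \<ge> 0)) \<in> quasi_alg L"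
| const: "(\<lambda>x. c) \<in> quasi_alg L"
| add: "f \<in> quasi_alg L \<Longrightarrow> g \<in> quasi_alg L \<Longrightarrow> (\<lambda>x. f x + g x) \<in> quasi_alg L"
| mult: "f \<in> quasi_alg L \<Longrightarrow> g \<in> quasi_alg L \<Longrightarrow> (\<lambda>x. f x * g x) \<in> quasi_alg L"

text \<open>Keeping the class of affine functions abstract allows a summation variable to be
  adjoined as a second component, by \<open>extend_class\<close>, without enlarging the index type
  of the coefficient vectors.\<close>

definition affine_class :: "('x \<Rightarrow> int) set \<Rightarrow> bool" where
  "affine_class L \<longleftrightarrow> (\<forall>c. (\<lambda>x. c) \<in> L) \<and> (\<forall>l\<in>L. \<forall>l'\<in>L. (\<lambda>x. l x + l' x) \<in> L) \<and>
     (\<forall>l\<in>L. \<forall>c. (\<lambda>x. c * l x) \<in> L)"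

definition extend_class :: "('x \<Rightarrow> int) set \<Rightarrow> ('x \<times> int \<Rightarrow> int) set" where
  "extend_class L = {\<lambda>(x, k). l x + c * k | l c. l \<in> L}"

lemma extend_classI: "l \<in> L \<Longrightarrow> (\<lambda>(x, k). l x + c * k) \<in> extend_class L"
  unfolding extend_class_def by blast

lemma affine_classD:
  assumes "affine_class L"
  shows "(\<lambda>x. c) \<in> L" "l \<in> L \<Longrightarrow> l' \<in> L \<Longrightarrow> (\<lambda>x. l x + l' x) \<in> L" "l \<in> L \<Longrightarrow> (\<lambda>x. c * l x) \<in> L"
  using assms by (auto simp: affine_class_def)

lemma affine_class_diff:
  assumes "affine_class L" "l \<in> L" "l' \<in> L"
  shows "(\<lambda>x. l x - l' x) \<in> L"
  using affine_classD(2)[OF assms(1,2) affine_classD(3)[OF assms(1,3), of "-1"]] by simp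

lemma affine_class_shift:
  assumes "affine_class L" "l \<in> L"
  shows "(\<lambda>x. l x + c) \<in> L" "(\<lambda>x. l x - c) \<in> L"
  using affine_classD(2)[OF assms affine_classD(1)[OF assms(1)], of c]
    affine_class_diff[OF assms affine_classD(1)[OF assms(1)], of c] by auto

lemma quasi_alg_diff:
  assumes "f \<in> quasi_alg L" "g \<in> quasi_alg L"
  shows "(\<lambda>x. f x - g x) \<in> quasi_alg L"
  using quasi_alg.add[OF assms(1) quasi_alg.mult[OF quasi_alg.const[of "-1"] assms(2)]] by simp

lemma quasi_alg_sum:
  assumes "\<And>i. i \<in> A \<Longrightarrow> f i \<in> quasi_alg L"
  shows "(\<lambda>x. \<Sum>i\<in>A. f i x) \<in> quasi_alg L"
proof (cases "finite A")
  case True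
  then show ?thesis using assms
    by (induction A rule: finite_induct) (auto intro: quasi_alg.const quasi_alg.add)
qed (simp add: quasi_alg.const)

lemma quasi_alg_prod:
  assumes "\<And>i. i \<in> A \<Longrightarrow> f i \<in> quasi_alg L"
  shows "(\<lambda>x. \<Prod>i\<in>A. f i x) \<in> quasi_alg L"
proof (cases "finite A")
  case True
  then show ?thesis using assms
    by (induction A rule: finite_induct) (auto intro: quasi_alg.const quasi_alg.mult)
qed (simp add: quasi_alg.const)

lemma quasi_alg_power:
  assumes "f \<in> quasi_alg L"
  shows "(\<lambda>x. f x ^ e) \<in> quasi_alg L"
  by (induction e) (auto intro: quasi_alg.const quasi_alg.mult assms)

lemma quasi_alg_comp:
  assumes "f \<in> quasi_alg L" "\<And>l. l \<in> L \<Longrightarrow> (\<lambda>y. l (h y)) \<in> L'"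
  shows "(\<lambda>y. f (h y)) \<in> quasi_alg L'"
  using assms(1)
proof induction
  case (div l a)
  then show ?case using quasi_alg.div[OF assms(2)] by auto
next
  case (indicator l)
  then show ?case using quasi_alg.indicator[OF assms(2)] by auto
qed (auto intro: quasi_alg.intros)

lemma quasi_alg_if:
  assumes "(\<lambda>x. of_bool (P x)) \<in> quasi_alg L" "f \<in> quasi_alg L" "g \<in> quasi_alg L"
  shows "(\<lambda>x. if P x then f x else g x) \<in> quasi_alg L"
proof -
  have "(\<lambda>x. of_bool (P x) * f x + (1 - of_bool (P x)) * g x) \<in> quasi_alg L"
    by (intro quasi_alg.add quasi_alg.mult quasi_alg_diff quasi_alg.const assms)
  also have "(\<lambda>x. of_bool (P x) * f x + (1 - of_bool (P x)) * g x) = (\<lambda>x. if P x then f x else g x)"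
    by auto
  finally show ?thesis .
qed

lemma int_le_div_iff:
  fixes a m n :: int
  assumes "a > 0"
  shows "m \<le> n div a \<longleftrightarrow> m * a \<le> n"
proof
  assume "m \<le> n div a"
  then have "m * a \<le> n div a * a" using assms by simp
  also have "\<dots> \<le> n" using assms pos_mod_sign[of a n] div_mult_mod_eq[of n a] by linarith
  finally show "m * a \<le> n" .
next
  assume "m * a \<le> n"
  from zdiv_mono1[OF this assms] show "m \<le> n div a" using assms by simp
qed

text \<open>The floor of \<open>z / a\<close> jumps by one exactly at the multiples of
  \<open>a\<close>. This brings congruence conditions into an algebra whose generators are only
  rounded quotients and sign indicators.\<close>

lemma dvd_indicator_int:
  fixes z a :: int
  assumes "a > 0"
  shows "z div a - (z - 1) div a = of_bool (a dvd z)"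
proof (cases "a dvd z")
  case True
  then obtain k where k: "z = a * k" by auto
  have "(a * k - 1) div a = (- 1 + k * a) div a" by (simp add: algebra_simps)
  also have "\<dots> = k + (- 1) div a" using assms by (subst div_mult_self1) auto
  also have "(- 1 :: int) div a = - 1" using assms div_pos_neg_trivial[of 1 a]
    by (simp add: div_eq_minus1)
  finally show ?thesis using k assms by auto
next
  case False
  define r where "r = z mod a"
  have r: "1 \<le> r" "r < a" "z = a * (z div a) + r"
    using False assms pos_mod_bound[of a z] pos_mod_sign[of a z]
    by (auto simp: r_def dvd_eq_mod_eq_0 simp del: pos_mod_sign)
  have "(z - 1) div a = ((r - 1) + (z div a) * a) div a"
    by (subst r(3)) (simp add: algebra_simps)
  also have "\<dots> = z div a" using r assms by (subst div_mult_self1) auto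
  finally show ?thesis using False by simp
qed

lemma quasi_alg_dvd:
  assumes L: "affine_class L" and "l \<in> L" "a > 0"
  shows "(\<lambda>x. of_bool (a dvd l x)) \<in> quasi_alg L"
proof -
  have "(\<lambda>x. of_int (l x div a) - of_int ((l x - 1) div a)) \<in> quasi_alg L"
    by (intro quasi_alg_diff quasi_alg.div affine_class_shift assms)
  also have "(\<lambda>x. of_int (l x div a) - of_int ((l x - 1) div a)) = (\<lambda>x. of_bool (a dvd l x) :: rat)"
    using dvd_indicator_int[OF \<open>a > 0\<close>] by (metis of_int_diff of_int_of_bool)
  finally show ?thesis .
qed

text \<open>A comparison of two floors is not an affine condition. For a fixed remainder
  \<open>r\<close> of \<open>l1 x\<close> modulo \<open>a1\<close> the left quotient is exactly
  \<open>(l1 x - r) / a1\<close>, and then clearing denominators gives an affine inequality.\<close>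

lemma quasi_alg_div_le_div:
  assumes L: "affine_class L" and l: "l1 \<in> L" "l2 \<in> L" and a: "a1 > 0" "a2 > 0"
  shows "(\<lambda>x. of_bool (l1 x div a1 \<le> l2 x div a2)) \<in> quasi_alg L"
proof -
  let ?f = "\<lambda>r x. of_bool (a1 dvd l1 x - r) * of_bool (a1 * l2 x - a2 * (l1 x - r) \<ge> 0) :: rat"
  have "(\<lambda>x. \<Sum>r\<in>{0..<a1}. ?f r x) \<in> quasi_alg L"
    by (intro quasi_alg_sum quasi_alg.mult quasi_alg_dvd quasi_alg.indicator affine_class_shift
        affine_class_diff affine_classD(3) assms)
  also have "(\<lambda>x. \<Sum>r\<in>{0..<a1}. ?f r x) = (\<lambda>x. of_bool (l1 x div a1 \<le> l2 x div a2))"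
  proof
    fix x
    let ?r = "l1 x mod a1"
    have zero: "?f r x = 0" if "r \<in> {0..<a1} - {?r}" for r
    proof -
      have "\<not> a1 dvd l1 x - r"
      proof
        assume "a1 dvd l1 x - r"
        then have "l1 x mod a1 = r mod a1" by (simp add: mod_eq_dvd_iff)
        with that show False by auto
      qed
      then show ?thesis by simp
    qed
    have "(\<Sum>r\<in>{0..<a1}. ?f r x) = (\<Sum>r\<in>{?r}. ?f r x)"
      using a zero by (intro sum.mono_neutral_right) auto
    also have "\<dots> = of_bool (a1 * l2 x - a2 * (l1 x - ?r) \<ge> 0)"
      by (simp add: minus_mod_eq_mult_div)
    also have "a1 * l2 x - a2 * (l1 x - ?r) \<ge> 0 \<longleftrightarrow> l1 x div a1 \<le> l2 x div a2"
    proof -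
      have "a1 * l2 x - a2 * (l1 x - ?r) = a1 * (l2 x - a2 * (l1 x div a1))"
        by (simp add: minus_mod_eq_mult_div algebra_simps)
      then have "a1 * l2 x - a2 * (l1 x - ?r) \<ge> 0 \<longleftrightarrow> a2 * (l1 x div a1) \<le> l2 x"
        using a by (simp add: zero_le_mult_iff)
      also have "\<dots> \<longleftrightarrow> l1 x div a1 \<le> l2 x div a2"
        using a by (simp add: int_le_div_iff mult.commute)
      finally show ?thesis .
    qed
    finally show "(\<Sum>r\<in>{0..<a1}. ?f r x) = of_bool (l1 x div a1 \<le> l2 x div a2)" .
  qed
  finally show ?thesis .
qed

text \<open>On a fixed residue class of the summation variable \<open>q\<close> all rounded quotients become linear in \<open>q\<close>,
  so that every function of the algebra takes the following form there.\<close>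
inductive_set fibre_terms :: "('x \<Rightarrow> int) set \<Rightarrow> ('x \<times> int \<Rightarrow> rat) set" for L where
  base: "p \<in> quasi_alg L \<Longrightarrow> set ls \<subseteq> extend_class L \<Longrightarrow>
    (\<lambda>(x, q). p x * of_int q ^ e * (\<Prod>l\<leftarrow>ls. of_bool (l (x, q) \<ge> 0))) \<in> fibre_terms L"
| add: "f \<in> fibre_terms L \<Longrightarrow> g \<in> fibre_terms L \<Longrightarrow> (\<lambda>y. f y + g y) \<in> fibre_terms L"

lemma fibre_terms_mult:
  assumes "f \<in> fibre_terms L" "g \<in> fibre_terms L"
  shows "(\<lambda>y. f y * g y) \<in> fibre_terms L"
  using assms
proof (induction arbitrary: g)
  case (base p ls e)
  note b = base
  from \<open>g \<in> fibre_terms L\<close> show ?case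
  proof induction
    case (base p' ls' e')
    have "(\<lambda>(x, q). (p x * p' x) * of_int q ^ (e + e') * (\<Prod>l\<leftarrow>ls @ ls'. of_bool (l (x, q) \<ge> 0)))
        \<in> fibre_terms L"
      using b base by (intro fibre_terms.base quasi_alg.mult) auto
    also have "(\<lambda>(x, q). (p x * p' x) * of_int q ^ (e + e') * (\<Prod>l\<leftarrow>ls @ ls'. of_bool (l (x, q) \<ge> 0)))
      = (\<lambda>y. (case y of (x, q) \<Rightarrow> p x * of_int q ^ e * (\<Prod>l\<leftarrow>ls. of_bool (l (x, q) \<ge> 0))) *
             (case y of (x, q) \<Rightarrow> p' x * of_int q ^ e' * (\<Prod>l\<leftarrow>ls'. of_bool (l (x, q) \<ge> 0))))"
      by (auto simp: fun_eq_iff power_add)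
    finally show ?case .
  next
    case (add f g)
    then show ?case by (auto simp: distrib_left intro: fibre_terms.add)
  qed
next
  case (add f f')
  from add.IH[OF add.prems] show ?case by (auto simp: distrib_right intro: fibre_terms.add)
qed

lemma fibre_terms_base1:
  assumes "p \<in> quasi_alg L"
  shows "(\<lambda>y. p (fst y)) \<in> fibre_terms L"
  using fibre_terms.base[OF assms, of "[]" 0] by (simp add: case_prod_unfold)

text \<open>Once \<open>a\<close> divides the modulus, \<open>(l0 x + d * k) div a\<close> is linear
  in \<open>q\<close> on each residue class. Demanding the result for all positive multiples of
  \<open>M\<close> lets sums and products pass to the common modulus \<open>M1 * M2\<close>.\<close>

lemma fibre_terms_restrict:
  assumes L: "affine_class L" and "f \<in> quasi_alg (extend_class L)"
  shows "\<exists>M>0. \<forall>M'>0. M dvd M' \<longrightarrow> (\<forall>c. (\<lambda>(x, q). f (x, M' * q + c)) \<in> fibre_terms L)"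
  using assms(2)
proof induction
  case (div l a)
  from div(1) obtain l0 d where l: "l0 \<in> L" "l = (\<lambda>(x, k). l0 x + d * k)"
    by (auto simp: extend_class_def)
  show ?case
  proof (intro exI[of _ a] conjI allI impI)
    fix M' c :: int
    assume "M' > 0" "a dvd M'"
    then obtain m where m: "M' = a * m" by auto
    have 1: "(\<lambda>y. of_int ((l0 (fst y) + d * c) div a)) \<in> fibre_terms L"
      using l(1) div(2) by (intro fibre_terms_base1[of "\<lambda>x. of_int ((l0 x + d * c) div a)"]
          quasi_alg.div affine_class_shift L)
    have 2: "(\<lambda>(x, q). (of_int (d * m)) * of_int q ^ 1 * (\<Prod>l\<leftarrow>[]. of_bool (l (x, q) \<ge> (0::int)))) \<in> fibre_terms L"
      using fibre_terms.base[OF quasi_alg.const, of "[]" L "of_int (d * m)" 1] by simp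
    have "l (x, M' * q + c) div a = (l0 x + d * c) div a + d * m * q" for x q
    proof -
      have "l (x, M' * q + c) div a = (l0 x + d * c + d * m * q * a) div a"
        by (simp add: l m algebra_simps)
      then show ?thesis using div(2) by simp
    qed
    then have "(\<lambda>(x, q). of_int (l (x, M' * q + c) div a)) =
      (\<lambda>y. of_int ((l0 (fst y) + d * c) div a) +
         (case y of (x, q) \<Rightarrow> (of_int (d * m)) * of_int q ^ 1 * (\<Prod>l\<leftarrow>[]. of_bool (l (x, q) \<ge> (0::int)))) :: rat)"
      by (auto simp: fun_eq_iff)
    with fibre_terms.add[OF 1 2] show "(\<lambda>(x, q). of_int (l (x, M' * q + c) div a)) \<in> fibre_terms L"
      by simp
  qed (use div in auto)
next
  case (indicator l)
  from indicator obtain l0 d where l: "l0 \<in> L" "l = (\<lambda>(x, k). l0 x + d * k)"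
    by (auto simp: extend_class_def)
  show ?case
  proof (intro exI[of _ 1] conjI allI impI)
    fix M' c :: int
    let ?l = "\<lambda>(x, q). (l0 x + d * c) + (d * M') * q"
    have "?l \<in> extend_class L"
      by (intro extend_classI affine_class_shift L l)
    then have "(\<lambda>(x, q). 1 * of_int q ^ 0 * (\<Prod>l\<leftarrow>[?l]. of_bool (l (x, q) \<ge> 0))) \<in> fibre_terms L"
      by (intro fibre_terms.base quasi_alg.const) auto
    also have "(\<lambda>(x, q). 1 * of_int q ^ 0 * (\<Prod>l\<leftarrow>[?l]. of_bool (l (x, q) \<ge> 0))) =
      (\<lambda>(x, q). of_bool (l (x, M' * q + c) \<ge> 0) :: rat)"
      by (auto simp: fun_eq_iff l algebra_simps)
    finally show "(\<lambda>(x, q). of_bool (l (x, M' * q + c) \<ge> 0) :: rat) \<in> fibre_terms L" .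
  qed auto
next
  case (const c)
  show ?case using fibre_terms_base1[OF quasi_alg.const, of c L]
    by (intro exI[of _ 1]) (auto simp: case_prod_unfold)
next
  case (add f g)
  then obtain M1 M2 where M: "M1 > 0" "M2 > 0"
    "\<And>M' c. M' > 0 \<Longrightarrow> M1 dvd M' \<Longrightarrow> (\<lambda>(x, q). f (x, M' * q + c)) \<in> fibre_terms L"
    "\<And>M' c. M' > 0 \<Longrightarrow> M2 dvd M' \<Longrightarrow> (\<lambda>(x, q). g (x, M' * q + c)) \<in> fibre_terms L" by metis
  show ?case
  proof (intro exI[of _ "M1 * M2"] conjI allI impI)
    fix M' c :: int assume "M' > 0" "M1 * M2 dvd M'"
    then show "(\<lambda>(x, q). f (x, M' * q + c) + g (x, M' * q + c)) \<in> fibre_terms L"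
      using fibre_terms.add[OF M(3)[of M' c] M(4)[of M' c]]
      by (auto simp: case_prod_unfold dest: dvd_mult_left dvd_mult_right)
  qed (use M in auto)
next
  case (mult f g)
  then obtain M1 M2 where M: "M1 > 0" "M2 > 0"
    "\<And>M' c. M' > 0 \<Longrightarrow> M1 dvd M' \<Longrightarrow> (\<lambda>(x, q). f (x, M' * q + c)) \<in> fibre_terms L"
    "\<And>M' c. M' > 0 \<Longrightarrow> M2 dvd M' \<Longrightarrow> (\<lambda>(x, q). g (x, M' * q + c)) \<in> fibre_terms L" by metis
  show ?case
  proof (intro exI[of _ "M1 * M2"] conjI allI impI)
    fix M' c :: int assume "M' > 0" "M1 * M2 dvd M'"
    then show "(\<lambda>(x, q). f (x, M' * q + c) * g (x, M' * q + c)) \<in> fibre_terms L"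
      using fibre_terms_mult[OF M(3)[of M' c] M(4)[of M' c]]
      by (auto simp: case_prod_unfold dest: dvd_mult_left dvd_mult_right)
  qed (use M in auto)
qed

text \<open>Faulhaber: telescoping \<open>q^(e+1) - (q-1)^(e+1)\<close> expresses \<open>q^e\<close> through lower powers.\<close>
lemma antidifference_power:
  "\<exists>c :: nat \<Rightarrow> rat. \<forall>q::int.
     (\<Sum>i\<le>Suc e. c i * of_int q ^ i) - (\<Sum>i\<le>Suc e. c i * of_int (q - 1) ^ i) = of_int q ^ e"
proof (induction e rule: less_induct)
  case (less e)
  have "\<forall>j. \<exists>c :: nat \<Rightarrow> rat. j < e \<longrightarrow> (\<forall>q::int.
     (\<Sum>i\<le>Suc j. c i * of_int q ^ i) - (\<Sum>i\<le>Suc j. c i * of_int (q - 1) ^ i) = of_int q ^ j)"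
    using less by blast
  then obtain c :: "nat \<Rightarrow> nat \<Rightarrow> rat" where c: "\<And>j q. j < e \<Longrightarrow>
     (\<Sum>i\<le>Suc j. c j i * of_int q ^ i) - (\<Sum>i\<le>Suc j. c j i * of_int (q - 1) ^ i) = of_int q ^ j"
    by metis
  \<comment> \<open>\<open>b j\<close> is the coefficient of \<open>x ^ j\<close> in
    \<open>(x - 1) ^ Suc e\<close>. Since \<open>b e = - Suc e\<close>, the expansion can be solved
    for \<open>x ^ e\<close>; replacing each lower power by its known antidifference
    \<open>c j\<close> gives \<open>C\<close>.\<close>
  define b where "b j = of_nat (Suc e choose j) * (- 1 :: rat) ^ (Suc e - j)" for j
  define C where "C i = (of_bool (i = Suc e) + (\<Sum>j<e. b j * (if i \<le> Suc j then c j i else 0))) / of_nat (Suc e)" for i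
  have C: "(\<Sum>i\<le>Suc e. C i * x ^ i) =
      (x ^ Suc e + (\<Sum>j<e. b j * (\<Sum>i\<le>Suc j. c j i * x ^ i))) / of_nat (Suc e)" for x :: rat
  proof -
    have "(\<Sum>i\<le>Suc e. C i * x ^ i) = (\<Sum>i\<le>Suc e. of_bool (i = Suc e) * x ^ i +
        (\<Sum>j<e. b j * (if i \<le> Suc j then c j i else 0) * x ^ i)) / of_nat (Suc e)"
      unfolding C_def sum_divide_distrib by (intro sum.cong) (auto simp: distrib_right sum_distrib_right add_divide_distrib)
    also have "(\<Sum>i\<le>Suc e. of_bool (i = Suc e) * x ^ i +
        (\<Sum>j<e. b j * (if i \<le> Suc j then c j i else 0) * x ^ i)) =
        x ^ Suc e + (\<Sum>i\<le>Suc e. \<Sum>j<e. b j * (if i \<le> Suc j then c j i else 0) * x ^ i)"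
      by (simp add: sum.distrib)
    also have "(\<Sum>i\<le>Suc e. \<Sum>j<e. b j * (if i \<le> Suc j then c j i else 0) * x ^ i) =
        (\<Sum>j<e. \<Sum>i\<le>Suc e. b j * (if i \<le> Suc j then c j i else 0) * x ^ i)"
      by (rule sum.swap)
    also have "\<dots> = (\<Sum>j<e. b j * (\<Sum>i\<le>Suc j. c j i * x ^ i))"
    proof (rule sum.cong[OF refl])
      fix j assume "j \<in> {..<e}"
      then have "(\<Sum>i\<le>Suc e. b j * (if i \<le> Suc j then c j i else 0) * x ^ i) =
         (\<Sum>i\<le>Suc j. b j * (if i \<le> Suc j then c j i else 0) * x ^ i)"
        by (intro sum.mono_neutral_right) auto
      then show "(\<Sum>i\<le>Suc e. b j * (if i \<le> Suc j then c j i else 0) * x ^ i) =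
         b j * (\<Sum>i\<le>Suc j. c j i * x ^ i)"
        by (simp add: sum_distrib_left algebra_simps)
    qed
    finally show ?thesis .
  qed
  show ?case
  proof (intro exI[of _ C] allI)
    fix q :: int
    let ?x = "of_int q :: rat"
    have "(?x + (- 1)) ^ Suc e = (\<Sum>j\<le>Suc e. b j * ?x ^ j)"
      unfolding binomial_ring[of ?x "-1" "Suc e"] b_def by (simp add: algebra_simps)
    also have "\<dots> = (\<Sum>j<e. b j * ?x ^ j) + b e * ?x ^ e + ?x ^ Suc e"
      unfolding lessThan_Suc_atMost[symmetric] by (simp add: b_def)
    also have "b e = - of_nat (Suc e)" by (simp add: b_def)
    finally have *: "of_int (q - 1) ^ Suc e = (\<Sum>j<e. b j * ?x ^ j) - of_nat (Suc e) * ?x ^ e + ?x ^ Suc e"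
      by (simp add: algebra_simps)
    define A where "A j y = (\<Sum>i\<le>Suc j. c j i * y ^ i)" for j y
    have "(\<Sum>j<e. b j * A j ?x) - (\<Sum>j<e. b j * A j (of_int (q - 1))) =
       (\<Sum>j<e. b j * (A j ?x - A j (of_int (q - 1))))"
      by (simp only: sum_subtractf right_diff_distrib)
    also have "\<dots> = (\<Sum>j<e. b j * ?x ^ j)"
      using c[of _ q] by (intro sum.cong) (auto simp only: A_def lessThan_iff)
    finally have "(\<Sum>j<e. b j * A j ?x) - (\<Sum>j<e. b j * A j (of_int (q - 1))) = (\<Sum>j<e. b j * ?x ^ j)" .
    then have "?x ^ Suc e + (\<Sum>j<e. b j * A j ?x) -
        (of_int (q - 1) ^ Suc e + (\<Sum>j<e. b j * A j (of_int (q - 1)))) =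
        of_nat (Suc e) * ?x ^ e"
      using * by linarith
    then show "(\<Sum>i\<le>Suc e. C i * of_int q ^ i) - (\<Sum>i\<le>Suc e. C i * of_int (q - 1) ^ i) = of_int q ^ e"
      unfolding C diff_divide_distrib[symmetric] A_def by (simp del: of_nat_Suc sum.atMost_Suc power_Suc)
  qed
qed

lemma sum_int_telescope:
  fixes f :: "int \<Rightarrow> 'a::ab_group_add"
  assumes "l \<le> u + 1"
  shows "(\<Sum>q=l..u. f q - f (q - 1)) = f u - f (l - 1)"
proof -
  have "(\<Sum>q=l..l - 1 + int k. f q - f (q - 1)) = f (l - 1 + int k) - f (l - 1)" for k
  proof (induction k)
    case (Suc k)
    have "{l..l - 1 + int (Suc k)} = insert (l + int k) {l..l - 1 + int k}" by auto
    with Suc show ?case by (simp add: algebra_simps)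
  qed simp
  from this[of "nat (u - l + 1)"] assms show ?thesis by simp
qed

lemma quasi_alg_sum_power:
  assumes L: "affine_class L" and l: "l1 \<in> L" "l2 \<in> L" and a: "a1 > 0" "a2 > 0"
  shows "(\<lambda>x. \<Sum>q=l1 x div a1..l2 x div a2. of_int q ^ e) \<in> quasi_alg L"
proof -
  obtain c :: "nat \<Rightarrow> rat" where c: "\<And>q. (\<Sum>i\<le>Suc e. c i * of_int q ^ i) -
      (\<Sum>i\<le>Suc e. c i * of_int (q - 1) ^ i) = of_int q ^ e"
    using antidifference_power[of e] by auto
  define B where "B y = (\<Sum>i\<le>Suc e. c i * y ^ i)" for y
  have B: "(\<lambda>x. B (f x)) \<in> quasi_alg L" if "f \<in> quasi_alg L" for f
    unfolding B_def by (intro quasi_alg_sum quasi_alg.mult quasi_alg.const quasi_alg_power that)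
  \<comment> \<open>The telescoped value is correct for a nonempty interval but in general not for
    an empty one, where the sum is 0; hence the case distinction.\<close>
  have "(\<lambda>x. if l1 x div a1 \<le> l2 x div a2
      then B (of_int (l2 x div a2)) - B (of_int (l1 x div a1) - 1) else 0) \<in> quasi_alg L"
    by (intro quasi_alg_if quasi_alg_div_le_div quasi_alg_diff B quasi_alg.div quasi_alg.const assms)
  also have "(\<lambda>x. if l1 x div a1 \<le> l2 x div a2
      then B (of_int (l2 x div a2)) - B (of_int (l1 x div a1) - 1) else 0) =
      (\<lambda>x. \<Sum>q=l1 x div a1..l2 x div a2. of_int q ^ e)"
  proof
    fix x
    have "(\<Sum>q=u..v. of_int q ^ e) = B (of_int v) - B (of_int u - 1)" if "u \<le> v" for u v
      using sum_int_telescope[of u v "\<lambda>q. B (of_int q)"] that c by (simp add: B_def)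
    then show "(if l1 x div a1 \<le> l2 x div a2
      then B (of_int (l2 x div a2)) - B (of_int (l1 x div a1) - 1) else 0) =
      (\<Sum>q=l1 x div a1..l2 x div a2. of_int q ^ e)" by simp
  qed
  finally show ?thesis .
qed

text \<open>Each indicator is a condition on \<open>q\<close> that is independent of
  \<open>q\<close>, a lower bound, or an upper bound, according to the sign of \<open>d\<close>. It
  is absorbed into the limits of summation, which is why the induction keeps the limits arbitrary
  and allows quotients there.\<close>

lemma quasi_alg_sum_term:
  assumes L: "affine_class L" and "set ls \<subseteq> extend_class L"
    and "l1 \<in> L" "l2 \<in> L" "a1 > 0" "a2 > 0"
  shows "(\<lambda>x. \<Sum>q=l1 x div a1..l2 x div a2. of_int q ^ e * (\<Prod>l\<leftarrow>ls. of_bool (l (x, q) \<ge> 0)))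
    \<in> quasi_alg L"
  using assms(2-)
proof (induction ls arbitrary: l1 l2 a1 a2)
  case Nil
  then show ?case using quasi_alg_sum_power[OF L] by simp
next
  case (Cons l ls)
  let ?t = "\<lambda>x q. of_int q ^ e * (\<Prod>l\<leftarrow>ls. of_bool (l (x, q) \<ge> 0)) :: rat"
  obtain l0 d where l: "l0 \<in> L" "l = (\<lambda>(x, k). l0 x + d * k)"
    using Cons.prems by (auto simp: extend_class_def)
  have ls: "set ls \<subseteq> extend_class L" using Cons.prems by simp
  note IH = Cons.IH[OF ls]
  have eq: "(\<Sum>q=u..v. of_int q ^ e * (\<Prod>l\<leftarrow>l # ls. of_bool (l (x, q) \<ge> 0))) =
      (\<Sum>q\<in>{u..v} \<inter> {q. l0 x + d * q \<ge> 0}. ?t x q)" for u v x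
    by (subst sum.inter_restrict) (auto intro!: sum.cong simp: l)
  consider "d = 0" | "d > 0" | "d < 0" by linarith
  then show ?case
  proof cases
    case 1
    have "(\<lambda>x. if l0 x \<ge> 0 then \<Sum>q=l1 x div a1..l2 x div a2. ?t x q else 0) \<in> quasi_alg L"
      by (intro quasi_alg_if IH quasi_alg.indicator quasi_alg.const l Cons.prems)
    then show ?thesis unfolding eq using 1 by (auto elim!: back_subst[where P="\<lambda>f. f \<in> _"])
  next
    case 2
    \<comment> \<open>The ceiling of \<open>- l0 x / d\<close>, written as a floor so that it can
      serve as a new lower limit.\<close>
    let ?m = "\<lambda>x. (- l0 x + (d - 1)) div d"
    have m: "(\<lambda>x. - l0 x + (d - 1)) \<in> L"
      using affine_class_shift(1)[OF L affine_classD(3)[OF L l(1), of "-1"], of "d - 1"] by simp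
    have "l0 x + d * q \<ge> 0 \<longleftrightarrow> ?m x \<le> q" for x q
    proof -
      have "?m x \<le> q \<longleftrightarrow> \<not> q + 1 \<le> ?m x" by auto
      also have "\<dots> \<longleftrightarrow> \<not> (q + 1) * d \<le> - l0 x + (d - 1)" using 2 by (simp add: int_le_div_iff)
      also have "\<dots> \<longleftrightarrow> l0 x + d * q \<ge> 0" by (auto simp: algebra_simps)
      finally show ?thesis by simp
    qed
    then have eq2: "(\<Sum>q\<in>{u..v} \<inter> {q. l0 x + d * q \<ge> 0}. ?t x q) =
       (if u \<le> ?m x then \<Sum>q=?m x..v. ?t x q else \<Sum>q=u..v. ?t x q)" for u v x
      by (auto intro!: sum.cong)
    show ?thesis unfolding eq eq2 using 2
      by (intro quasi_alg_if quasi_alg_div_le_div IH L m Cons.prems)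
  next
    case 3
    have "l0 x + d * q \<ge> 0 \<longleftrightarrow> q \<le> l0 x div (- d)" for x q
      using 3 by (simp add: int_le_div_iff del: div_minus_right) (auto simp: algebra_simps)
    then have eq2: "(\<Sum>q\<in>{u..v} \<inter> {q. l0 x + d * q \<ge> 0}. ?t x q) =
       (if v \<le> l0 x div (- d) then \<Sum>q=u..v. ?t x q else \<Sum>q=u..l0 x div (- d). ?t x q)" for u v x
      by (auto intro!: sum.cong)
    have "- d > 0" using 3 by simp
    show ?thesis unfolding eq eq2
      by (intro quasi_alg_if quasi_alg_div_le_div IH L l Cons.prems \<open>- d > 0\<close>)
  qed
qed

lemma quasi_alg_sum_fibre_terms:
  assumes L: "affine_class L" and "f \<in> fibre_terms L" and "l1 \<in> L" "l2 \<in> L" "a1 > 0" "a2 > 0"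
  shows "(\<lambda>x. \<Sum>q=l1 x div a1..l2 x div a2. f (x, q)) \<in> quasi_alg L"
  using assms(2)
proof induction
  case (base p ls e)
  have "(\<lambda>x. p x * (\<Sum>q=l1 x div a1..l2 x div a2. of_int q ^ e * (\<Prod>l\<leftarrow>ls. of_bool (l (x, q) \<ge> 0))))
    \<in> quasi_alg L"
    by (intro quasi_alg.mult quasi_alg_sum_term assms base)
  then show ?case by (simp add: sum_distrib_left mult.assoc)
qed (simp add: sum.distrib quasi_alg.add)

text \<open>Substituting \<open>k = M * q + c\<close> with \<open>0 \<le> c < M\<close> splits the
  sum into finitely many sums over \<open>q\<close>, in each of which the summand is a fibre
  term.\<close>

theorem quasi_alg_sum_interval:
  assumes L: "affine_class L" and f: "f \<in> quasi_alg (extend_class L)" and u: "u \<in> L"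
  shows "(\<lambda>x. \<Sum>k=0..u x. f (x, k)) \<in> quasi_alg L"
proof -
  obtain M where "M > 0"
    and "\<forall>M'>0. M dvd M' \<longrightarrow> (\<forall>c. (\<lambda>(x, q). f (x, M' * q + c)) \<in> fibre_terms L)"
    using fibre_terms_restrict[OF L f] by (elim exE conjE) (rule that)
  then have M: "M > 0" "\<And>c. (\<lambda>(x, q). f (x, M * q + c)) \<in> fibre_terms L"
    by simp_all
  \<comment> \<open>The lower limit 0 is written \<open>0 div 1\<close> to have the quotient shape
    that \<open>quasi_alg_sum_fibre_terms\<close> expects.\<close>
  have "(\<lambda>x. \<Sum>q=0 div 1..(u x - c) div M. (\<lambda>(x, q). f (x, M * q + c)) (x, q)) \<in> quasi_alg L" for c
    by (rule quasi_alg_sum_fibre_terms[OF L M(2) affine_classD(1)[OF L]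
        affine_class_shift(2)[OF L u] zero_less_one M(1)])
  then have "(\<lambda>x. \<Sum>c=0..<M. \<Sum>q=0 div 1..(u x - c) div M. (\<lambda>(x, q). f (x, M * q + c)) (x, q)) \<in> quasi_alg L"
    by (rule quasi_alg_sum)
  also have "(\<lambda>x. \<Sum>c=0..<M. \<Sum>q=0 div 1..(u x - c) div M. (\<lambda>(x, q). f (x, M * q + c)) (x, q)) =
    (\<lambda>x. \<Sum>k=0..u x. f (x, k))"
  proof
    fix x
    have "(\<Sum>c=0..<M. \<Sum>q=0 div 1..(u x - c) div M. (\<lambda>(x, q). f (x, M * q + c)) (x, q)) =
      (\<Sum>(c, q)\<in>(SIGMA c:{0..<M}. {0..(u x - c) div M}). f (x, M * q + c))"
      by (simp add: sum.Sigma)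
    also have "\<dots> = (\<Sum>k=0..u x. f (x, k))"
    proof (rule sum.reindex_bij_witness[of _ "\<lambda>k. (k mod M, k div M)" "\<lambda>(c, q). M * q + c"], goal_cases)
      case (1 a)
      then show ?case using M(1) by auto
    next
      case (2 a)
      then show ?case using M(1) by (auto simp: int_le_div_iff algebra_simps)
    next
      case (3 b)
      then show ?case by simp
    next
      case (4 b)
      then show ?case using M(1)
        by (auto simp: int_le_div_iff pos_imp_zdiv_nonneg_iff minus_mod_eq_div_mult[symmetric])
    next
      case (5 a)
      then show ?case by auto
    qed
    finally show "(\<Sum>c=0..<M. \<Sum>q=0 div 1..(u x - c) div M. (\<lambda>(x, q). f (x, M * q + c)) (x, q)) =
      (\<Sum>k=0..u x. f (x, k))" .
  qed
  finally show ?thesis .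
qed

section \<open>Affine functions with integer coefficients and the ring of quasi-polynomials\<close>

definition affine_eval :: "('r::finite \<Rightarrow> int) \<times> int \<Rightarrow> ('r \<Rightarrow> int) \<Rightarrow> int" where
  "affine_eval p z = (\<Sum>j\<in>UNIV. fst p j * z j) + snd p"

lemma affine_class_affine_eval: "affine_class (range (affine_eval :: ('r::finite \<Rightarrow> int) \<times> int \<Rightarrow> _))"
  unfolding affine_class_def
proof (intro conjI allI ballI)
  fix c
  show "(\<lambda>x. c) \<in> range (affine_eval :: ('r \<Rightarrow> int) \<times> int \<Rightarrow> _)"
    by (intro image_eqI[of _ _ "(\<lambda>_. 0, c)"]) (auto simp: affine_eval_def fun_eq_iff)
next
  fix l l' assume "l \<in> range (affine_eval :: ('r \<Rightarrow> int) \<times> int \<Rightarrow> _)" "l' \<in> range (affine_eval :: ('r \<Rightarrow> int) \<times> int \<Rightarrow> _)"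
  then obtain p q where "l = affine_eval p" "l' = affine_eval q" by auto
  then show "(\<lambda>x. l x + l' x) \<in> range (affine_eval :: ('r \<Rightarrow> int) \<times> int \<Rightarrow> _)"
    by (intro image_eqI[of _ _ "(\<lambda>j. fst p j + fst q j, snd p + snd q)"])
      (auto simp: affine_eval_def fun_eq_iff sum.distrib distrib_right)
next
  fix l c assume "l \<in> range (affine_eval :: ('r \<Rightarrow> int) \<times> int \<Rightarrow> _)"
  then obtain p where "l = affine_eval p" by auto
  then show "(\<lambda>x. c * l x) \<in> range (affine_eval :: ('r \<Rightarrow> int) \<times> int \<Rightarrow> _)"
    by (intro image_eqI[of _ _ "(\<lambda>j. c * fst p j, c * snd p)"])
      (auto simp: affine_eval_def fun_eq_iff sum_distrib_left distrib_left mult.assoc)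
qed

lemma finite_degree_le: "finite {i :: 'r::finite \<Rightarrow> nat. sum i UNIV \<le> D}"
proof (rule finite_subset)
  show "{i :: 'r \<Rightarrow> nat. sum i UNIV \<le> D} \<subseteq> PiE UNIV (\<lambda>_. {..D})"
  proof
    fix i :: "'r \<Rightarrow> nat" assume "i \<in> {i. sum i UNIV \<le> D}"
    then have "i j \<le> D" for j using member_le_sum[of j UNIV i] by (simp add: order_trans)
    then show "i \<in> PiE UNIV (\<lambda>_. {..D})" by auto
  qed
qed (intro finite_PiE, auto)

lemma periodic_fun_const: "periodic_fun (\<lambda>n. c)"
  unfolding periodic_fun_def by (intro exI[of _ 1]) auto

lemma periodic_fun_combine:
  assumes "periodic_fun s" "periodic_fun t"
  shows "periodic_fun (\<lambda>n. h (s n) (t n))"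
proof -
  have iter: "s (n(j := n j + k * a)) = s n" if "\<And>n j. s (n(j := n j + a)) = s n"
    for s :: "('a \<Rightarrow> nat) \<Rightarrow> rat" and n j k a
  proof (induction k)
    case (Suc k)
    have "s (n(j := n j + Suc k * a)) = s ((n(j := n j + k * a))(j := (n(j := n j + k * a)) j + a))"
      by (simp add: algebra_simps)
    also have "\<dots> = s n" unfolding that by (rule Suc)
    finally show ?case .
  qed simp
  obtain a b where "a > 0" "b > 0" and p: "\<And>n j. s (n(j := n j + a)) = s n" "\<And>n j. t (n(j := n j + b)) = t n"
    using assms unfolding periodic_fun_def by blast
  then show ?thesis unfolding periodic_fun_def
    using iter[of s a _ _ b] iter[of t b _ _ a]
    by (intro exI[of _ "a * b"]) (auto simp: mult.commute)
qed

lemma quasi_poly_term: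
  assumes "periodic_fun p"
  shows "quasi_poly (\<lambda>n. p n * (\<Prod>j\<in>UNIV. of_nat (n j) ^ i j))"
  unfolding quasi_poly_def
proof (intro exI[of _ "sum i UNIV"] exI[of _ "\<lambda>k. if k = i then p else (\<lambda>_. 0)"] conjI allI)
  fix n :: "'a \<Rightarrow> nat"
  let ?s = "\<lambda>k. if k = i then p else (\<lambda>_. 0)"
  have "(\<Sum>k\<in>{k. sum k UNIV \<le> sum i UNIV}. ?s k n * (\<Prod>j\<in>UNIV. of_nat (n j) ^ k j)) =
     (\<Sum>k\<in>{i}. ?s k n * (\<Prod>j\<in>UNIV. of_nat (n j) ^ k j))"
    by (intro sum.mono_neutral_right finite_degree_le) auto
  then show "p n * (\<Prod>j\<in>UNIV. of_nat (n j) ^ i j) =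
     (\<Sum>k\<in>{k. sum k UNIV \<le> sum i UNIV}. ?s k n * (\<Prod>j\<in>UNIV. of_nat (n j) ^ k j))" by simp
qed (use assms periodic_fun_const in auto)

lemma quasi_poly_add:
  assumes "quasi_poly f" "quasi_poly g"
  shows "quasi_poly (\<lambda>n. f n + g n)"
proof -
  obtain D s where s: "\<And>i. periodic_fun (s i)"
    "\<And>n. f n = (\<Sum>i\<in>{i. sum i UNIV \<le> D}. s i n * (\<Prod>j\<in>UNIV. of_nat (n j) ^ i j))"
    using assms(1) unfolding quasi_poly_def by blast
  obtain E t where t: "\<And>i. periodic_fun (t i)"
    "\<And>n. g n = (\<Sum>i\<in>{i. sum i UNIV \<le> E}. t i n * (\<Prod>j\<in>UNIV. of_nat (n j) ^ i j))"
    using assms(2) unfolding quasi_poly_def by blast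
  define s' where "s' i = (if sum i UNIV \<le> D then s i else (\<lambda>_. 0))" for i
  define t' where "t' i = (if sum i UNIV \<le> E then t i else (\<lambda>_. 0))" for i
  have f: "f n = (\<Sum>i\<in>{i. sum i UNIV \<le> D + E}. s' i n * (\<Prod>j\<in>UNIV. of_nat (n j) ^ i j))" for n
    unfolding s(2) by (intro sum.mono_neutral_cong_left finite_degree_le) (auto simp: s'_def)
  have g: "g n = (\<Sum>i\<in>{i. sum i UNIV \<le> D + E}. t' i n * (\<Prod>j\<in>UNIV. of_nat (n j) ^ i j))" for n
    unfolding t(2) by (intro sum.mono_neutral_cong_left finite_degree_le) (auto simp: t'_def)
  have p: "periodic_fun (s' i)" "periodic_fun (t' i)" for i
    using s(1) t(1) periodic_fun_const by (auto simp: s'_def t'_def)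
  show ?thesis unfolding quasi_poly_def
    by (intro exI[of _ "D + E"] exI[of _ "\<lambda>i n. s' i n + t' i n"])
      (auto simp: f g distrib_right sum.distrib intro: periodic_fun_combine p)
qed

lemma quasi_poly_periodic:
  assumes "periodic_fun p"
  shows "quasi_poly p"
  using quasi_poly_term[OF assms, of "\<lambda>_. 0"] by simp

lemma quasi_poly_sum:
  assumes "\<And>i. i \<in> A \<Longrightarrow> quasi_poly (f i)"
  shows "quasi_poly (\<lambda>n. \<Sum>i\<in>A. f i n)"
proof (cases "finite A")
  case True
  then show ?thesis using assms
    by (induction A rule: finite_induct) (auto intro: quasi_poly_add quasi_poly_periodic periodic_fun_const)
qed (simp add: quasi_poly_periodic periodic_fun_const)

lemma quasi_poly_mult:
  assumes "quasi_poly f" "quasi_poly g"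
  shows "quasi_poly (\<lambda>n. f n * g n)"
proof -
  obtain D s where s: "\<And>i. periodic_fun (s i)"
    "\<And>n. f n = (\<Sum>i\<in>{i. sum i UNIV \<le> D}. s i n * (\<Prod>j\<in>UNIV. of_nat (n j) ^ i j))"
    using assms(1) unfolding quasi_poly_def by blast
  obtain E t where t: "\<And>i. periodic_fun (t i)"
    "\<And>n. g n = (\<Sum>i\<in>{i. sum i UNIV \<le> E}. t i n * (\<Prod>j\<in>UNIV. of_nat (n j) ^ i j))"
    using assms(2) unfolding quasi_poly_def by blast
  have *: "quasi_poly (\<lambda>n. (s i n * t k n) * (\<Prod>j\<in>UNIV. of_nat (n j) ^ (i j + k j)))" for i k
    by (rule quasi_poly_term[OF periodic_fun_combine[OF s(1) t(1)]])
  have "quasi_poly (\<lambda>n. \<Sum>i\<in>{i. sum i UNIV \<le> D}. \<Sum>k\<in>{i. sum i UNIV \<le> E}.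
     (s i n * t k n) * (\<Prod>j\<in>UNIV. of_nat (n j) ^ (i j + k j)))"
    by (intro quasi_poly_sum *)
  also have "(\<lambda>n. \<Sum>i\<in>{i. sum i UNIV \<le> D}. \<Sum>k\<in>{i. sum i UNIV \<le> E}.
     (s i n * t k n) * (\<Prod>j\<in>UNIV. of_nat (n j) ^ (i j + k j))) = (\<lambda>n. f n * g n)"
    unfolding s(2) t(2) sum_product by (simp add: power_add prod.distrib mult_ac)
  finally show ?thesis .
qed

lemma quasi_poly_coordinate: "quasi_poly (\<lambda>n. of_nat (n j))"
proof -
  have "quasi_poly (\<lambda>n. 1 * (\<Prod>k\<in>UNIV. of_nat (n k) ^ (if k = j then 1 else 0)))"
    by (intro quasi_poly_term periodic_fun_const)
  also have "(\<lambda>n. 1 * (\<Prod>k\<in>UNIV. of_nat (n k) ^ (if k = j then 1 else 0))) = (\<lambda>n. of_nat (n j) :: rat)"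
    by (auto simp: fun_eq_iff if_distrib[of "\<lambda>e. _ ^ e"] cong: if_cong)
  finally show ?thesis .
qed

text \<open>The quotient is \<open>(l - l mod a) / a\<close>, where \<open>l\<close> is affine and
  the remainder is periodic with period \<open>a\<close> in each coordinate.\<close>

lemma quasi_poly_affine_div:
  assumes "a > 0"
  shows "quasi_poly (\<lambda>n. of_int (affine_eval p (\<lambda>j. int (n j)) div a))"
proof -
  let ?l = "\<lambda>n. affine_eval p (\<lambda>j. int (n j))"
  have per: "periodic_fun (\<lambda>n. of_int (?l n mod a))" unfolding periodic_fun_def
  proof (intro exI[of _ "nat a"] conjI allI)
    fix n :: "'a \<Rightarrow> nat" and j
    have "?l (n(j := n j + nat a)) =
      (\<Sum>k\<in>UNIV. fst p k * int (n k) + (if k = j then fst p k * a else 0)) + snd p"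
      unfolding affine_eval_def using assms by (intro arg_cong2[of _ _ _ _ "(+)"] sum.cong) (auto simp: algebra_simps)
    also have "\<dots> = ?l n + fst p j * a" by (simp add: sum.distrib affine_eval_def)
    finally show "of_int (?l (n(j := n j + nat a)) mod a) = (of_int (?l n mod a) :: rat)" by simp
  qed (use assms in auto)
  have "quasi_poly (\<lambda>n. (1 / of_int a) * (((\<Sum>j\<in>UNIV. of_int (fst p j) * of_nat (n j)) + of_int (snd p)) +
      (- 1) * of_int (?l n mod a)))"
    by (intro quasi_poly_mult quasi_poly_add quasi_poly_sum quasi_poly_coordinate
        quasi_poly_periodic[OF per] quasi_poly_periodic[OF periodic_fun_const])
  also have "(\<lambda>n. (1 / of_int a) * (((\<Sum>j\<in>UNIV. of_int (fst p j) * of_nat (n j)) + of_int (snd p)) +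
      (- 1) * of_int (?l n mod a))) = (\<lambda>n. of_int (?l n div a) :: rat)"
  proof
    fix n
    have "(\<Sum>j\<in>UNIV. of_int (fst p j) * of_nat (n j)) + of_int (snd p) = (of_int (?l n) :: rat)"
      by (simp add: affine_eval_def)
    moreover have "(of_int (?l n) :: rat) = of_int a * of_int (?l n div a) + of_int (?l n mod a)"
      by (metis mult_div_mod_eq of_int_add of_int_mult)
    ultimately show "(1 / of_int a) * (((\<Sum>j\<in>UNIV. of_int (fst p j) * of_nat (n j)) + of_int (snd p)) +
      (- 1) * of_int (?l n mod a)) = (of_int (?l n div a) :: rat)"
      using assms by simp
  qed
  finally show ?thesis .
qed

text \<open>Once the signs of the finitely many affine functions inside indicators are fixed, all
  indicators are constant; \<open>S\<close> records which of these functions are nonnegative. A sum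
  or product pools both families in \<open>A \<union> B\<close>, and each operand reads off its own
  part of \<open>S\<close>.\<close>

lemma quasi_alg_sign_cases:
  assumes "f \<in> quasi_alg (range affine_eval)"
  shows "\<exists>A g. finite A \<and> (\<forall>S. quasi_poly (g S)) \<and>
    (\<forall>n. f (\<lambda>j. int (n j)) = g {p\<in>A. affine_eval p (\<lambda>j. int (n j)) \<ge> 0} n)"
  using assms
proof induction
  case (div l a)
  then obtain p where "l = affine_eval p" by auto
  then show ?case using quasi_poly_affine_div[OF div(2), of p]
    by (intro exI[of _ "{}"] exI[of _ "\<lambda>_ n. of_int (l (\<lambda>j. int (n j)) div a)"]) auto
next
  case (indicator l)
  then obtain p where "l = affine_eval p" by auto
  then show ?case
    by (intro exI[of _ "{p}"] exI[of _ "\<lambda>S n. of_bool (p \<in> S)"])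
      (auto intro: quasi_poly_periodic periodic_fun_const)
next
  case (const c)
  show ?case
    by (intro exI[of _ "{}"] exI[of _ "\<lambda>S n. c"]) (auto intro: quasi_poly_periodic periodic_fun_const)
next
  case (add f1 f2)
  from add.IH(1) obtain A g where 1: "finite A" "\<forall>S. quasi_poly (g S)"
     "\<forall>n. f1 (\<lambda>j. int (n j)) = g {p\<in>A. affine_eval p (\<lambda>j. int (n j)) \<ge> 0} n"
    by (elim exE conjE) (rule that)
  from add.IH(2) obtain B h where 2: "finite B" "\<forall>S. quasi_poly (h S)"
     "\<forall>n. f2 (\<lambda>j. int (n j)) = h {p\<in>B. affine_eval p (\<lambda>j. int (n j)) \<ge> 0} n"
    by (elim exE conjE) (rule that)
  have int: "{p \<in> A \<union> B. P p} \<inter> A = {p\<in>A. P p}" "{p \<in> A \<union> B. P p} \<inter> B = {p\<in>B. P p}" for P by auto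
  show ?case
  proof (intro exI[of _ "A \<union> B"] exI[of _ "\<lambda>S n. g (S \<inter> A) n + h (S \<inter> B) n"] conjI allI)
    fix S show "quasi_poly (\<lambda>n. g (S \<inter> A) n + h (S \<inter> B) n)"
      by (rule quasi_poly_add[OF spec[OF 1(2)] spec[OF 2(2)]])
  qed (simp_all only: int 1 2 finite_Un simp_thms)
next
  case (mult f1 f2)
  from mult.IH(1) obtain A g where 1: "finite A" "\<forall>S. quasi_poly (g S)"
     "\<forall>n. f1 (\<lambda>j. int (n j)) = g {p\<in>A. affine_eval p (\<lambda>j. int (n j)) \<ge> 0} n"
    by (elim exE conjE) (rule that)
  from mult.IH(2) obtain B h where 2: "finite B" "\<forall>S. quasi_poly (h S)"
     "\<forall>n. f2 (\<lambda>j. int (n j)) = h {p\<in>B. affine_eval p (\<lambda>j. int (n j)) \<ge> 0} n"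
    by (elim exE conjE) (rule that)
  have int: "{p \<in> A \<union> B. P p} \<inter> A = {p\<in>A. P p}" "{p \<in> A \<union> B. P p} \<inter> B = {p\<in>B. P p}" for P by auto
  show ?case
  proof (intro exI[of _ "A \<union> B"] exI[of _ "\<lambda>S n. g (S \<inter> A) n * h (S \<inter> B) n"] conjI allI)
    fix S show "quasi_poly (\<lambda>n. g (S \<inter> A) n * h (S \<inter> B) n)"
      by (rule quasi_poly_mult[OF spec[OF 1(2)] spec[OF 2(2)]])
  qed (simp_all only: int 1 2 finite_Un simp_thms)
qed

section \<open>Polyhedral cells of sign patterns\<close>

definition sign_cell :: "(('r::finite \<Rightarrow> int) \<times> int) set \<Rightarrow> (('r \<Rightarrow> int) \<times> int) set \<Rightarrow> (real ^ 'r) set" where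
  "sign_cell A S = (\<Inter>p\<in>A. if p \<in> S then {x. (\<chi> j. of_int (fst p j)) \<bullet> x \<ge> - of_int (snd p)}
     else {x. (\<chi> j. of_int (fst p j)) \<bullet> x \<le> - of_int (snd p) - 1})"

lemma polyhedron_sign_cell: "finite A \<Longrightarrow> polyhedron (sign_cell A S)"
  unfolding sign_cell_def by (intro polyhedron_Inter) (auto intro: polyhedron_halfspace_le polyhedron_halfspace_ge)

text \<open>On lattice points the strict inequality \<open>l < 0\<close> can be replaced by the closed one \<open>l \<le> -1\<close>.\<close>
lemma lattice_pt_in_sign_cell:
  assumes "S \<subseteq> A"
  shows "lattice_pt n \<in> sign_cell A S \<longleftrightarrow> S = {p\<in>A. affine_eval p (\<lambda>j. int (n j)) \<ge> 0}"
proof -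
  have neg: "(of_int z :: real) \<le> - 1 \<longleftrightarrow> \<not> 0 \<le> z" for z :: int by linarith
  have inner: "(\<chi> j. of_int (fst p j)) \<bullet> lattice_pt n = of_int (affine_eval p (\<lambda>j. int (n j))) - of_int (snd p)" for p
    by (simp add: inner_vec_def lattice_pt_def affine_eval_def)
  have "lattice_pt n \<in> sign_cell A S \<longleftrightarrow>
     (\<forall>p\<in>A. if p \<in> S then (of_int (affine_eval p (\<lambda>j. int (n j))) :: real) \<ge> 0
        else (of_int (affine_eval p (\<lambda>j. int (n j))) :: real) \<le> - 1)"
    unfolding sign_cell_def INT_iff by (intro ball_cong refl) (auto simp: inner)
  also have "\<dots> \<longleftrightarrow> (\<forall>p\<in>A. p \<in> S \<longleftrightarrow> affine_eval p (\<lambda>j. int (n j)) \<ge> 0)"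
    by (intro ball_cong refl) (simp add: neg)
  also have "\<dots> \<longleftrightarrow> S = {p\<in>A. affine_eval p (\<lambda>j. int (n j)) \<ge> 0}" using assms by auto
  finally show ?thesis .
qed

text \<open>All patterns \<open>S \<subseteq> A\<close> are listed, realised or not. A lattice point
  determines its own pattern, so it lies in exactly one cell; cells of unrealised patterns contain
  no lattice point and do no harm.\<close>

theorem piecewise_quasi_poly_quasi_alg:
  assumes "f \<in> quasi_alg (range affine_eval)"
  shows "piecewise_quasi_poly (\<lambda>n. f (\<lambda>j. int (n j)))"
proof -
  obtain A g where A: "finite A" "\<And>S. quasi_poly (g S)"
    "\<And>n. f (\<lambda>j. int (n j)) = g {p\<in>A. affine_eval p (\<lambda>j. int (n j)) \<ge> 0} n"
    using quasi_alg_sign_cases[OF assms] by auto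
  obtain e where e: "bij_betw e {0..<card (Pow A)} (Pow A)"
    using ex_bij_betw_nat_finite[of "Pow A"] A(1) by auto
  have eA: "e i \<subseteq> A" if "i < card (Pow A)" for i
    using bij_betwE[OF e] that by auto
  show ?thesis unfolding piecewise_quasi_poly_def
  proof (intro exI[of _ "card (Pow A)"] exI[of _ "\<lambda>i. sign_cell A (e i)"] exI[of _ "\<lambda>i. g (e i)"] conjI allI impI)
    fix n
    let ?S = "{p\<in>A. affine_eval p (\<lambda>j. int (n j)) \<ge> 0}"
    have "?S \<in> e ` {0..<card (Pow A)}"
      unfolding bij_betw_imp_surj_on[OF e] by auto
    then obtain i where i: "i < card (Pow A)" "e i = ?S"
      by (elim imageE) (rule that, auto)
    show "\<exists>!i. i < card (Pow A) \<and> lattice_pt n \<in> sign_cell A (e i)"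
    proof (intro ex1I[of _ i] conjI)
      show "lattice_pt n \<in> sign_cell A (e i)" using lattice_pt_in_sign_cell[OF eA, of i n] i by simp
      fix k assume k: "k < card (Pow A) \<and> lattice_pt n \<in> sign_cell A (e k)"
      then have "e k = e i" using lattice_pt_in_sign_cell[OF eA, of k n] i by simp
      then show "k = i" using inj_onD[OF bij_betw_imp_inj_on[OF e], of k i] k i(1) by simp
    qed (use i in auto)
  next
    fix i n assume "i < card (Pow A)" "lattice_pt n \<in> sign_cell A (e i)"
    then show "f (\<lambda>j. int (n j)) = g (e i) n"
      using lattice_pt_in_sign_cell[OF eA, of i n] A(3)[of n] by simp
  qed (use A polyhedron_sign_cell in auto)
qed

section \<open>Finitely generated commutative monoids\<close>

text \<open>A finite \<open>B\<close> that works for the coordinates in \<open>I\<close> still works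
  for those \<open>w\<close> whose new coordinate is at least the maximum \<open>m\<close> of that
  coordinate on \<open>B\<close>. Each of the finitely many slices with value \<open>k < m\<close>
  receives its own finite set. The family \<open>f\<close> lets the same statement serve exponents,
  multisets and pairs of multisets.\<close>

lemma dickson:
  fixes f :: "'w \<Rightarrow> 'i \<Rightarrow> nat"
  assumes "finite I"
  shows "\<exists>B\<subseteq>W. finite B \<and> (\<forall>w\<in>W. \<exists>b\<in>B. \<forall>i\<in>I. f b i \<le> f w i)"
  using assms
proof (induction I arbitrary: W rule: finite_induct)
  case empty
  show ?case
  proof (cases "W = {}")
    case False
    then obtain w where "w \<in> W" by auto
    then show ?thesis by (intro exI[of _ "{w}"]) auto
  qed auto
next
  case (insert i I)
  obtain B where B: "B \<subseteq> W" "finite B" "\<forall>w\<in>W. \<exists>b\<in>B. \<forall>i\<in>I. f b i \<le> f w i"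
    using insert.IH[of W] by auto
  define m where "m = Max (insert 0 ((\<lambda>b. f b i) ` B))"
  have m: "f b i \<le> m" if "b \<in> B" for b
    using that B(2) unfolding m_def by (intro Max_ge) auto
  have "\<forall>k. \<exists>C\<subseteq>{w\<in>W. f w i = k}. finite C \<and> (\<forall>w\<in>{w\<in>W. f w i = k}. \<exists>b\<in>C. \<forall>i\<in>I. f b i \<le> f w i)"
    using insert.IH by blast
  then obtain C where C: "\<forall>k. C k \<subseteq> {w\<in>W. f w i = k} \<and> finite (C k) \<and>
      (\<forall>w\<in>{w\<in>W. f w i = k}. \<exists>b\<in>C k. \<forall>i\<in>I. f b i \<le> f w i)"
    unfolding choice_iff by (elim exE) (rule that)
  show ?case
  proof (intro exI[of _ "B \<union> (\<Union>k<m. C k)"] conjI ballI)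
    fix w assume w: "w \<in> W"
    show "\<exists>b\<in>B \<union> (\<Union>k<m. C k). \<forall>i\<in>insert i I. f b i \<le> f w i"
    proof (cases "f w i < m")
      case True
      obtain b where "b \<in> C (f w i)" "\<forall>i\<in>I. f b i \<le> f w i" using C w by blast
      moreover have "f b i = f w i" using C \<open>b \<in> C (f w i)\<close> by blast
      ultimately show ?thesis using True by (intro bexI[of _ b]) auto
    next
      case False
      then show ?thesis using B(3) w m by (metis UnI1 insert_iff le_trans not_le)
    qed
  qed (use B C in auto)
qed

text \<open>Finite multisets make a representation an object of its own, so that representations can
  be compared, subtracted and counted.\<close>

definition mgen :: "'m::comm_monoid_add set \<Rightarrow> 'm set" where
  "mgen S = {\<Sum>\<^sub># M | M. set_mset M \<subseteq> S}"

lemma mgen_base: "x \<in> S \<Longrightarrow> x \<in> mgen S"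
  unfolding mgen_def by (intro CollectI exI[of _ "{#x#}"]) auto

lemma mgen_0: "0 \<in> mgen S"
  unfolding mgen_def by (intro CollectI exI[of _ "{#}"]) auto

lemma mgen_add:
  assumes "x \<in> mgen S" "y \<in> mgen S"
  shows "x + y \<in> mgen S"
proof -
  obtain M N where "x = \<Sum>\<^sub># M" "set_mset M \<subseteq> S" "y = \<Sum>\<^sub># N" "set_mset N \<subseteq> S"
    using assms unfolding mgen_def by auto
  then show ?thesis unfolding mgen_def by (intro CollectI exI[of _ "M + N"]) auto
qed

lemma mgen_sum: "(\<And>i. i \<in> A \<Longrightarrow> f i \<in> mgen S) \<Longrightarrow> sum f A \<in> mgen S"
  by (induction A rule: infinite_finite_induct) (auto intro: mgen_0 mgen_add)

lemma mgen_least: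
  assumes "S \<subseteq> N" "0 \<in> N" "\<And>x y. x \<in> N \<Longrightarrow> y \<in> N \<Longrightarrow> x + y \<in> N"
  shows "mgen S \<subseteq> N"
proof
  fix x assume "x \<in> mgen S"
  then obtain M where "x = \<Sum>\<^sub># M" "set_mset M \<subseteq> S" unfolding mgen_def by auto
  moreover have "set_mset M \<subseteq> S \<Longrightarrow> \<Sum>\<^sub># M \<in> N"
    by (induction M) (use assms in auto)
  ultimately show "x \<in> N" by simp
qed

lemma mgen_mono: "S \<subseteq> T \<Longrightarrow> mgen S \<subseteq> mgen T"
  unfolding mgen_def by blast

lemma mgen_induct [consumes 1, case_names base zero add]:
  assumes "x \<in> mgen S" "\<And>x. x \<in> S \<Longrightarrow> P x" "P 0"
    "\<And>x y. x \<in> mgen S \<Longrightarrow> y \<in> mgen S \<Longrightarrow> P x \<Longrightarrow> P y \<Longrightarrow> P (x + y)"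
  shows "P x"
proof -
  have "mgen S \<subseteq> {x \<in> mgen S. P x}"
    using assms(2-) by (intro mgen_least) (auto intro: mgen_base mgen_0 mgen_add)
  then show ?thesis using assms(1) by auto
qed

definition fg_monoid :: "'m::comm_monoid_add set \<Rightarrow> bool" where
  "fg_monoid N \<longleftrightarrow> (\<exists>S. finite S \<and> N = mgen S)"

text \<open>Pairs of representations with equal value form a monoid closed under subtraction,
  hence generated by its minimal nonzero elements.\<close>
lemma fg_monoid_Int:
  fixes N N' :: "'m::cancel_comm_monoid_add set"
  assumes "fg_monoid N" "fg_monoid N'"
  shows "fg_monoid (N \<inter> N')"
proof -
  obtain S T where fin: "finite S" "finite T" and N: "N = mgen S" "N' = mgen T"
    using assms by (auto simp: fg_monoid_def)
  \<comment> \<open>The last condition excludes the empty pair, which would otherwise be the only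
    minimal element; it also makes the subtraction below decrease the size.\<close>
  define W where "W = {(P, Q). set_mset P \<subseteq> S \<and> set_mset Q \<subseteq> T \<and> \<Sum>\<^sub># P = \<Sum>\<^sub># Q \<and> size P + size Q \<noteq> 0}"
  define f where "f w i = (case i of Inl s \<Rightarrow> count (fst w) s | Inr t \<Rightarrow> count (snd w) t)"
    for w :: "'m multiset \<times> 'm multiset" and i
  have "\<exists>B\<subseteq>W. finite B \<and> (\<forall>w\<in>W. \<exists>b\<in>B. \<forall>i\<in>S <+> T. f b i \<le> f w i)"
    by (rule dickson) (use fin in auto)
  then obtain B where B: "B \<subseteq> W" "finite B" "\<forall>w\<in>W. \<exists>b\<in>B. \<forall>i\<in>S <+> T. f b i \<le> f w i"
    by (elim exE conjE) (rule that)
  define C where "C = (\<lambda>w. \<Sum>\<^sub># (fst w)) ` B"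
  have CN: "C \<subseteq> N \<inter> N'"
  proof
    fix x assume "x \<in> C"
    then obtain P Q where "x = \<Sum>\<^sub># P" "(P, Q) \<in> W" using B(1) by (force simp: C_def)
    then have "set_mset P \<subseteq> S" "set_mset Q \<subseteq> T" "x = \<Sum>\<^sub># P" "x = \<Sum>\<^sub># Q" by (simp_all add: W_def)
    then show "x \<in> N \<inter> N'" unfolding N mgen_def by blast
  qed
  have gen: "\<Sum>\<^sub># P \<in> mgen C" if "set_mset P \<subseteq> S" "set_mset Q \<subseteq> T" "\<Sum>\<^sub># P = \<Sum>\<^sub># Q" for P Q
    using that
  proof (induction "size P + size Q" arbitrary: P Q rule: less_induct)
    case less
    show ?case
    proof (cases "size P + size Q = 0")
      case True
      then show ?thesis by (auto intro: mgen_0)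
    next
      case False
      then have PQ: "(P, Q) \<in> W" using less.prems by (auto simp: W_def)
      with B(3) have "\<exists>b\<in>B. \<forall>i\<in>S <+> T. f b i \<le> f (P, Q) i" by (rule bspec)
      then obtain b where b: "b \<in> B" "\<forall>i\<in>S <+> T. f b i \<le> f (P, Q) i" by (elim bexE) (rule that)
      obtain P0 Q0 where b_eq: "b = (P0, Q0)" by (cases b)
      have W0: "set_mset P0 \<subseteq> S" "set_mset Q0 \<subseteq> T" "\<Sum>\<^sub># P0 = \<Sum>\<^sub># Q0" "size P0 + size Q0 \<noteq> 0"
        using b(1) B(1) by (auto simp: W_def b_eq)
      have "count P0 s \<le> count P s" for s
      proof (cases "s \<in> S")
        case True
        then show ?thesis using b(2) by (auto simp: f_def b_eq dest: bspec[of _ _ "Inl s"])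
      next
        case False
        then have "count P0 s = 0" using W0(1) by (meson count_inI subset_iff)
        then show ?thesis by simp
      qed
      then obtain P1 where P1: "P = P0 + P1" by (metis mset_subset_eq_exists_conv subseteq_mset_def)
      have "count Q0 s \<le> count Q s" for s
      proof (cases "s \<in> T")
        case True
        then show ?thesis using b(2) by (auto simp: f_def b_eq dest: bspec[of _ _ "Inr s"])
      next
        case False
        then have "count Q0 s = 0" using W0(2) by (meson count_inI subset_iff)
        then show ?thesis by simp
      qed
      then obtain Q1 where Q1: "Q = Q0 + Q1" by (metis mset_subset_eq_exists_conv subseteq_mset_def)
      have "\<Sum>\<^sub># P1 = \<Sum>\<^sub># Q1" using less.prems(3) W0(3) by (simp add: P1 Q1)
      then have "\<Sum>\<^sub># P1 \<in> mgen C"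
        using less.prems W0 by (intro less.hyps[of P1 Q1]) (auto simp: P1 Q1 nonempty_has_size)
      moreover have "\<Sum>\<^sub># P0 \<in> mgen C"
        using b(1) by (intro mgen_base) (auto simp: C_def b_eq intro!: image_eqI[of _ _ "(P0, Q0)"])
      ultimately show ?thesis by (simp add: P1 mgen_add)
    qed
  qed
  have "N \<inter> N' = mgen C"
  proof
    show "mgen C \<subseteq> N \<inter> N'"
      by (rule mgen_least[OF CN]) (auto simp: N mgen_0 mgen_add)
    show "N \<inter> N' \<subseteq> mgen C"
    proof
      fix x assume "x \<in> N \<inter> N'"
      then have "x \<in> mgen S" "x \<in> mgen T" by (auto simp: N)
      then obtain P Q where P: "x = \<Sum>\<^sub># P" "set_mset P \<subseteq> S" and Q: "x = \<Sum>\<^sub># Q" "set_mset Q \<subseteq> T"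
        unfolding mgen_def by blast
      show "x \<in> mgen C" using gen[OF P(2) Q(2)] P(1) Q(1) by simp
    qed
  qed
  moreover have "finite C" using B(2) by (simp add: C_def)
  ultimately show ?thesis unfolding fg_monoid_def by blast
qed

section \<open>Counting elements of given degree\<close>

definition mdeg :: "(nat \<Rightarrow> 'r \<Rightarrow> int) \<Rightarrow> nat multiset \<Rightarrow> 'r \<Rightarrow> int" where
  "mdeg d M j = (\<Sum>i\<in>#M. d i j)"

text \<open>Its cardinality as a function of \<open>z\<close> is the vector partition function of
  the degrees \<open>d 0, ..., d (p - 1)\<close>. With integer degrees, \<open>z\<close> can be
  shifted freely, since unattainable values just give the empty set.\<close>

definition reps :: "(nat \<Rightarrow> 'r \<Rightarrow> int) \<Rightarrow> nat \<Rightarrow> ('r \<Rightarrow> int) \<Rightarrow> nat multiset set" where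
  "reps d p z = {M. set_mset M \<subseteq> {..<p} \<and> mdeg d M = z}"

lemma mdeg_union: "mdeg d (M + N) = (\<lambda>j. mdeg d M j + mdeg d N j)"
  by (auto simp: mdeg_def)

lemma mdeg_empty [simp]: "mdeg d {#} = (\<lambda>j. 0)"
  by (auto simp: mdeg_def)

lemma mdeg_replicate: "mdeg d (replicate_mset k i) = (\<lambda>j. int k * d i j)"
  by (auto simp: mdeg_def)

lemma size_le_mdeg:
  fixes d :: "nat \<Rightarrow> 'r::finite \<Rightarrow> int"
  assumes "\<And>i. i < p \<Longrightarrow> (\<Sum>j\<in>UNIV. d i j) \<ge> 1" "set_mset M \<subseteq> {..<p}"
  shows "int (size M) \<le> (\<Sum>j\<in>UNIV. mdeg d M j)"
  using assms(2)
proof (induction M)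
  case (add i M)
  then have "(\<Sum>j\<in>UNIV. d i j) \<ge> 1" "int (size M) \<le> (\<Sum>j\<in>UNIV. mdeg d M j)" using assms(1) by auto
  then show ?case by (simp add: mdeg_def sum.distrib)
qed simp

lemma finite_reps:
  fixes d :: "nat \<Rightarrow> 'r::finite \<Rightarrow> int"
  assumes "\<And>i. i < p \<Longrightarrow> (\<Sum>j\<in>UNIV. d i j) \<ge> 1"
  shows "finite (reps d p z)"
proof (rule finite_subset)
  show "reps d p z \<subseteq> (\<Union>k\<in>{..nat (\<Sum>j\<in>UNIV. z j)}. {M. set_mset M \<subseteq> {..<p} \<and> size M = k})"
  proof
    fix M assume "M \<in> reps d p z"
    then have M: "set_mset M \<subseteq> {..<p}" "mdeg d M = z" by (auto simp: reps_def)
    then have "int (size M) \<le> (\<Sum>j\<in>UNIV. z j)" using size_le_mdeg[of p d M, OF assms M(1)] by simp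
    then have "size M \<in> {..nat (\<Sum>j\<in>UNIV. z j)}" by simp
    then show "M \<in> (\<Union>k\<in>{..nat (\<Sum>j\<in>UNIV. z j)}. {M. set_mset M \<subseteq> {..<p} \<and> size M = k})"
      using M(1) by blast
  qed
  show "finite (\<Union>k\<in>{..nat (\<Sum>j\<in>UNIV. z j)}. {M. set_mset M \<subseteq> {..<p} \<and> size M = k})"
    unfolding multisets_of_size_def[symmetric] by (intro finite_UN_I finite_multisets_of_size) auto
qed

text \<open>Split by the multiplicity \<open>k\<close> of the last generator. As every generator has
  total degree at least 1, \<open>k\<close> cannot exceed the total degree of \<open>z\<close>, and
  this provides the affine upper limit needed for \<open>quasi_alg_sum_interval\<close>.\<close>

lemma card_reps_Suc:
  fixes d :: "nat \<Rightarrow> 'r::finite \<Rightarrow> int"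
  assumes d: "\<And>i. i < Suc p \<Longrightarrow> (\<Sum>j\<in>UNIV. d i j) \<ge> 1"
  shows "card (reps d (Suc p) z) = (\<Sum>k=0..(\<Sum>j\<in>UNIV. z j). card (reps d p (\<lambda>j. z j - k * d p j)))"
proof -
  let ?Z = "SIGMA k:{0..(\<Sum>j\<in>UNIV. z j)}. reps d p (\<lambda>j. z j - k * d p j)"
  have split: "M = filter_mset (\<lambda>i. i \<noteq> p) M + replicate_mset (count M p) p" for M
    by (rule multiset_eqI) auto
  have "bij_betw (\<lambda>M. (int (count M p), filter_mset (\<lambda>i. i \<noteq> p) M)) (reps d (Suc p) z) ?Z"
  proof (rule bij_betw_byWitness[where f' = "\<lambda>(k, M). M + replicate_mset (nat k) p"])
    show "\<forall>M\<in>reps d (Suc p) z. (\<lambda>(k, M). M + replicate_mset (nat k) p)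
        (int (count M p), filter_mset (\<lambda>i. i \<noteq> p) M) = M"
      using split by auto
    show "\<forall>y\<in>?Z. (\<lambda>M. (int (count M p), filter_mset (\<lambda>i. i \<noteq> p) M))
        ((\<lambda>(k, M). M + replicate_mset (nat k) p) y) = y"
    proof
      fix y assume "y \<in> ?Z"
      then obtain k M where y: "y = (k, M)"
        and k: "k \<in> {0..(\<Sum>j\<in>UNIV. z j)}" "M \<in> reps d p (\<lambda>j. z j - k * d p j)" by (elim SigmaE)
      then have pM: "p \<notin># M" by (auto simp: reps_def)
      then have "count M p = 0" by (simp add: not_in_iff)
      moreover have "filter_mset (\<lambda>i. i \<noteq> p) M = M" using pM by (auto simp: filter_mset_eq_conv)
      moreover have "filter_mset (\<lambda>i. i \<noteq> p) (replicate_mset (nat k) p) = {#}"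
        by (auto simp: multiset_eq_iff)
      ultimately show "(\<lambda>M. (int (count M p), filter_mset (\<lambda>i. i \<noteq> p) M))
        ((\<lambda>(k, M). M + replicate_mset (nat k) p) y) = y"
        using k(1) by (simp add: y)
    qed
    show "(\<lambda>M. (int (count M p), filter_mset (\<lambda>i. i \<noteq> p) M)) ` reps d (Suc p) z \<subseteq> ?Z"
    proof
      fix y assume "y \<in> (\<lambda>M. (int (count M p), filter_mset (\<lambda>i. i \<noteq> p) M)) ` reps d (Suc p) z"
      then obtain M where M: "M \<in> reps d (Suc p) z" "y = (int (count M p), filter_mset (\<lambda>i. i \<noteq> p) M)" by auto
      have Mz: "set_mset M \<subseteq> {..<Suc p}" "mdeg d M = z" using M(1) by (auto simp: reps_def)
      have "int (count M p) \<le> int (size M)" by (simp add: count_le_size)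
      also have "\<dots> \<le> (\<Sum>j\<in>UNIV. z j)" using size_le_mdeg[of "Suc p" d M, OF d Mz(1)] Mz(2) by simp
      finally have 1: "int (count M p) \<in> {0..(\<Sum>j\<in>UNIV. z j)}" by simp
      have "mdeg d M = (\<lambda>j. mdeg d (filter_mset (\<lambda>i. i \<noteq> p) M) j + int (count M p) * d p j)"
        by (subst split) (simp only: mdeg_union mdeg_replicate)
      then have "mdeg d (filter_mset (\<lambda>i. i \<noteq> p) M) = (\<lambda>j. z j - int (count M p) * d p j)"
        using Mz(2) by (auto simp: fun_eq_iff)
      moreover have "set_mset (filter_mset (\<lambda>i. i \<noteq> p) M) \<subseteq> {..<p}" using Mz(1) by (auto simp: less_Suc_eq)
      ultimately show "y \<in> ?Z" using 1 by (auto simp: M(2) reps_def)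
    qed
    show "(\<lambda>(k, M). M + replicate_mset (nat k) p) ` ?Z \<subseteq> reps d (Suc p) z"
      by (auto simp: reps_def mdeg_union mdeg_replicate less_Suc_eq split: if_splits)
  qed
  then have "card (reps d (Suc p) z) = card ?Z" by (rule bij_betw_same_card)
  also have "\<dots> = (\<Sum>k=0..(\<Sum>j\<in>UNIV. z j). card (reps d p (\<lambda>j. z j - k * d p j)))"
    using d by (intro card_SigmaI) (auto intro!: finite_reps)
  finally show ?thesis .
qed

lemma affine_eval_shift:
  "affine_eval q (\<lambda>j. z j - k * v j) = affine_eval q z + (- (\<Sum>j\<in>UNIV. fst q j * v j)) * k"
  by (simp add: affine_eval_def sum_distrib_right sum_distrib_left sum_subtractf algebra_simps)

text \<open>Adding a generator means one more summation. The substitution of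
  \<open>z - k * d p\<close> for \<open>z\<close> sends affine functions of \<open>z\<close> to
  affine functions of the pair \<open>(z, k)\<close>, so it stays within the extended class.\<close>

lemma quasi_alg_card_reps:
  fixes d :: "nat \<Rightarrow> 'r::finite \<Rightarrow> int"
  assumes "\<And>i. i < p \<Longrightarrow> (\<Sum>j\<in>UNIV. d i j) \<ge> 1"
  shows "(\<lambda>z. of_nat (card (reps d p z))) \<in> quasi_alg (range affine_eval)"
  using assms
proof (induction p)
  case 0
  have coord: "(\<lambda>z. c * z j) \<in> range (affine_eval :: ('r \<Rightarrow> int) \<times> int \<Rightarrow> _)" for c j
    by (intro image_eqI[of _ _ "(\<lambda>k. if k = j then c else 0, 0)"])
      (auto simp: affine_eval_def fun_eq_iff if_distrib[of "\<lambda>x. x * _"] cong: if_cong)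
  \<comment> \<open>Without generators only \<open>z = 0\<close> is represented; two opposite
    inequalities in each coordinate express this. The factor 1 brings both into the form covered by
    \<open>coord\<close>.\<close>
  have "(\<lambda>z. \<Prod>j\<in>UNIV. of_bool (1 * z j \<ge> 0) * of_bool (- 1 * z j \<ge> 0)) \<in>
      quasi_alg (range (affine_eval :: ('r \<Rightarrow> int) \<times> int \<Rightarrow> _))"
    by (intro quasi_alg_prod quasi_alg.mult quasi_alg.indicator coord)
  also have "(\<lambda>z. \<Prod>j\<in>UNIV. of_bool (1 * z j \<ge> 0) * of_bool (- 1 * z j \<ge> 0)) =
      (\<lambda>z::'r \<Rightarrow> int. of_nat (card (reps d 0 z)) :: rat)"
  proof
    fix z :: "'r \<Rightarrow> int"
    show "(\<Prod>j\<in>UNIV. of_bool (1 * z j \<ge> 0) * of_bool (- 1 * z j \<ge> 0)) = (of_nat (card (reps d 0 z)) :: rat)"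
    proof (cases "z = (\<lambda>_. 0)")
      case True
      then have "reps d 0 z = {{#}}" by (auto simp: reps_def)
      then show ?thesis using True by simp
    next
      case False
      then have "reps d 0 z = {}" by (auto simp: reps_def)
      moreover from False obtain j where "z j \<noteq> 0" by auto
      then have "\<exists>j\<in>UNIV. of_bool (1 * z j \<ge> 0) * of_bool (- 1 * z j \<ge> 0) = (0::rat)"
        by (intro bexI[of _ j]) auto
      ultimately show ?thesis by (auto simp: prod_zero_iff simp del: mult_eq_0_iff)
    qed
  qed
  finally show ?case .
next
  case (Suc p)
  have "(\<lambda>y. of_nat (card (reps d p ((\<lambda>(z, k) j. z j - k * d p j) y)))) \<in>
      quasi_alg (extend_class (range (affine_eval :: ('r \<Rightarrow> int) \<times> int \<Rightarrow> _)))"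
  proof (rule quasi_alg_comp[where h = "\<lambda>(z, k) j. z j - k * d p j", OF Suc.IH])
    fix l assume "l \<in> range (affine_eval :: ('r \<Rightarrow> int) \<times> int \<Rightarrow> _)"
    then obtain q where q: "l = affine_eval q" by auto
    have "(\<lambda>(z, k). affine_eval q z + (- (\<Sum>j\<in>UNIV. fst q j * d p j)) * k)
       \<in> extend_class (range affine_eval)"
      by (intro extend_classI) auto
    then show "(\<lambda>y. l ((\<lambda>(z, k) j. z j - k * d p j) y)) \<in> extend_class (range affine_eval)"
      unfolding q by (simp only: case_prod_unfold affine_eval_shift)
  qed (use Suc.prems in auto)
  moreover have "(\<lambda>z. \<Sum>j\<in>UNIV. z j) \<in> range (affine_eval :: ('r \<Rightarrow> int) \<times> int \<Rightarrow> _)"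
    by (intro image_eqI[of _ _ "(\<lambda>_. 1, 0)"]) (auto simp: affine_eval_def)
  ultimately have "(\<lambda>z. \<Sum>k=0..(\<Sum>j\<in>UNIV. z j).
      of_nat (card (reps d p ((\<lambda>(z, k) j. z j - k * d p j) (z, k))))) \<in>
      quasi_alg (range (affine_eval :: ('r \<Rightarrow> int) \<times> int \<Rightarrow> _))"
    by (rule quasi_alg_sum_interval[OF affine_class_affine_eval])
  then show ?case by (simp add: card_reps_Suc[OF Suc.prems])
qed

text \<open>Inclusion-exclusion, one forbidden \<open>g\<close> at a time: the multisets above
  \<open>u\<close> that avoid \<open>g\<close> are those above \<open>u\<close> without those above
  the join of \<open>u\<close> and \<open>g\<close>. Keeping \<open>u\<close> arbitrary makes the
  induction go through; with nothing forbidden, subtracting \<open>u\<close> merely shifts the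
  degree.\<close>

lemma quasi_alg_card_avoiding_reps:
  fixes d :: "nat \<Rightarrow> 'r::finite \<Rightarrow> int"
  assumes d: "\<And>i. i < p \<Longrightarrow> (\<Sum>j\<in>UNIV. d i j) \<ge> 1" and "finite B"
  shows "(\<lambda>z. of_nat (card {M\<in>reps d p z. u \<subseteq># M \<and> (\<forall>g\<in>B. \<not> g \<subseteq># M)})) \<in> quasi_alg (range affine_eval)"
  using assms(2)
proof (induction B arbitrary: u rule: finite_induct)
  case empty
  show ?case
  proof (cases "set_mset u \<subseteq> {..<p}")
    case True
    have eq: "card {M\<in>reps d p z. u \<subseteq># M} = card (reps d p (\<lambda>j. z j - 1 * mdeg d u j))" for z
    proof -
      have "{M\<in>reps d p z. u \<subseteq># M} = (\<lambda>M. M + u) ` reps d p (\<lambda>j. z j - 1 * mdeg d u j)"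
      proof (intro equalityI subsetI)
        fix M assume "M \<in> {M\<in>reps d p z. u \<subseteq># M}"
        then obtain N where N: "M = N + u" "M \<in> reps d p z" by (metis (mono_tags) add.commute mem_Collect_eq mset_subset_eq_exists_conv)
        then show "M \<in> (\<lambda>M. M + u) ` reps d p (\<lambda>j. z j - 1 * mdeg d u j)"
          by (intro image_eqI[of _ _ N]) (auto simp: reps_def mdeg_union)
      qed (use True in \<open>auto simp: reps_def mdeg_union\<close>)
      then show ?thesis by (simp add: card_image)
    qed
    have "(\<lambda>z. of_nat (card (reps d p ((\<lambda>z j. z j - 1 * mdeg d u j) z)))) \<in> quasi_alg (range affine_eval)"
    proof (rule quasi_alg_comp[where h = "\<lambda>z j. z j - 1 * mdeg d u j", OF quasi_alg_card_reps])
      fix l assume "l \<in> range (affine_eval :: ('r \<Rightarrow> int) \<times> int \<Rightarrow> _)"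
      then obtain q where q: "l = affine_eval q" by auto
      show "(\<lambda>y. l ((\<lambda>z j. z j - 1 * mdeg d u j) y)) \<in> range affine_eval"
        unfolding q affine_eval_shift by (rule affine_class_shift(1)[OF affine_class_affine_eval rangeI])
    qed (use d in auto)
    then show ?thesis by (simp add: eq)
  next
    case False
    have "{M\<in>reps d p z. u \<subseteq># M \<and> (\<forall>g\<in>{}. \<not> g \<subseteq># M)} = {}" for z
      using False by (auto simp: reps_def dest: set_mset_mono)
    then show ?thesis by (simp only: card.empty of_nat_0 quasi_alg.const)
  qed
next
  case (insert g B)
  let ?S = "\<lambda>u z. {M\<in>reps d p z. u \<subseteq># M \<and> (\<forall>g\<in>B. \<not> g \<subseteq># M)}"
  have "of_nat (card {M\<in>reps d p z. u \<subseteq># M \<and> (\<forall>g\<in>insert g B. \<not> g \<subseteq># M)}) =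
     of_nat (card (?S u z)) - (of_nat (card (?S (u \<union># g) z)) :: rat)" for z
  proof -
    have fin: "finite (?S u z)" by (rule finite_subset[OF _ finite_reps[OF d]]) auto
    have sub: "?S (u \<union># g) z \<subseteq> ?S u z" by auto
    have "{M\<in>reps d p z. u \<subseteq># M \<and> (\<forall>g\<in>insert g B. \<not> g \<subseteq># M)} = ?S u z - ?S (u \<union># g) z" by auto
    then show ?thesis using card_Diff_subset[OF finite_subset[OF sub fin] sub] card_mono[OF fin sub]
      by (simp add: of_nat_diff)
  qed
  then show ?case using quasi_alg_diff[OF insert.IH[of u] insert.IH[of "u \<union># g"]] by (simp only:)
qed

text \<open>Each element is counted through its smallest representation in the multiset order; the
  representations that are not smallest form an up-set, which is finitely generated.\<close>
theorem quasi_alg_card_mgen: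
  fixes C :: "'m::comm_monoid_add set" and deg :: "'m \<Rightarrow> 'r::finite \<Rightarrow> int"
  assumes C: "finite C"
    and deg: "\<And>x y. deg (x + y) = (\<lambda>j. deg x j + deg y j)" "deg 0 = (\<lambda>j. 0)"
      "\<And>x. x \<in> C \<Longrightarrow> (\<Sum>j\<in>UNIV. deg x j) \<ge> 1"
  shows "(\<lambda>z. of_nat (card {x \<in> mgen C. deg x = z})) \<in> quasi_alg (range affine_eval)"
proof -
  define p where "p = card C"
  obtain h where h: "bij_betw h {..<p} C"
    using ex_bij_betw_nat_finite[OF C] by (auto simp: p_def atLeast0LessThan)
  define d where "d i = deg (h i)" for i
  define val where "val M = (\<Sum>i\<in>#M. h i)" for M
  have d1: "(\<Sum>j\<in>UNIV. d i j) \<ge> 1" if "i < p" for i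
    using deg(3) bij_betwE[OF h] that by (auto simp: d_def)
  have val_add: "val (M + N) = val M + val N" for M N by (simp add: val_def)
  have deg_val: "deg (val M) = mdeg d M" for M
    by (induction M) (auto simp: val_def mdeg_def d_def deg fun_eq_iff)
  define ms where "ms = {M. set_mset M \<subseteq> {..<p}}"
  have mgen_val: "mgen C = val ` ms"
  proof
    show "mgen C \<subseteq> val ` ms"
    proof (rule mgen_least)
      show "C \<subseteq> val ` ms"
      proof
        fix x assume "x \<in> C"
        then obtain i where "i < p" "h i = x" using bij_betw_imp_surj_on[OF h] by auto
        then show "x \<in> val ` ms" by (intro image_eqI[of _ _ "{#i#}"]) (auto simp: val_def ms_def)
      qed
      show "0 \<in> val ` ms" by (intro image_eqI[of _ _ "{#}"]) (auto simp: val_def ms_def)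
      fix x y assume "x \<in> val ` ms" "y \<in> val ` ms"
      then obtain M N where "x = val M" "y = val N" "M \<in> ms" "N \<in> ms" by auto
      then show "x + y \<in> val ` ms" by (intro image_eqI[of _ _ "M + N"]) (auto simp: val_add ms_def)
    qed
    show "val ` ms \<subseteq> mgen C"
    proof clarify
      fix M assume "M \<in> ms"
      then show "val M \<in> mgen C" unfolding ms_def mgen_def val_def
        using bij_betwE[OF h] by (intro CollectI exI[of _ "image_mset h M"]) auto
    qed
  qed
  define D where "D = {M\<in>ms. \<forall>N\<in>ms. val N = val M \<longrightarrow> M \<le> N}"
  obtain B where B: "B \<subseteq> ms - D" "finite B" "\<forall>M\<in>ms - D. \<exists>g\<in>B. \<forall>i\<in>{..<p}. count g i \<le> count M i"
    using dickson[OF finite_lessThan[of p], of "ms - D" count] by (elim exE conjE) (rule that)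
  have D_iff: "M \<in> D \<longleftrightarrow> (\<forall>g\<in>B. \<not> g \<subseteq># M)" if M: "M \<in> ms" for M
  proof
    assume MD: "M \<in> D"
    show "\<forall>g\<in>B. \<not> g \<subseteq># M"
    proof (intro ballI notI)
      fix g assume g: "g \<in> B" "g \<subseteq># M"
      then obtain N where N: "M = g + N" by (auto simp: mset_subset_eq_exists_conv)
      have "g \<in> ms" "g \<notin> D" using g B(1) by auto
      then obtain g' where g': "g' \<in> ms" "val g' = val g" "g' < g" by (auto simp: D_def not_le)
      \<comment> \<open>The multiset order is strictly compatible with addition, so a smaller
        representation of the part \<open>g\<close> yields a smaller one of the whole of
        \<open>M\<close>. This is what makes the complement of \<open>D\<close> an up-set.\<close>
      have "g' + N < M" using g'(3) by (simp add: N)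
      moreover have "g' + N \<in> ms" using g'(1) M by (auto simp: ms_def N)
      moreover have "val (g' + N) = val M" using g'(2) by (simp add: N val_add)
      ultimately show False using MD by (auto simp: D_def not_le dest!: bspec[of _ _ "g' + N"])
    qed
  next
    assume *: "\<forall>g\<in>B. \<not> g \<subseteq># M"
    show "M \<in> D"
    proof (rule ccontr)
      assume "M \<notin> D"
      with M have "M \<in> ms - D" by simp
      with B(3) have "\<exists>g\<in>B. \<forall>i\<in>{..<p}. count g i \<le> count M i" by (rule bspec)
      then obtain g where g: "g \<in> B" "\<forall>i\<in>{..<p}. count g i \<le> count M i" by (elim bexE) (rule that)
      have "count g i \<le> count M i" for i
      proof (cases "i < p")
        case False
        then have "i \<notin># g" using g(1) B(1) by (auto simp: ms_def)
        then show ?thesis by (simp add: not_in_iff)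
      qed (use g in auto)
      then have "g \<subseteq># M" by (simp add: subseteq_mset_def)
      with * g show False by auto
    qed
  qed
  have "card {x \<in> mgen C. deg x = z} = card {M\<in>reps d p z. {#} \<subseteq># M \<and> (\<forall>g\<in>B. \<not> g \<subseteq># M)}" for z
  proof -
    have eq: "{M\<in>reps d p z. {#} \<subseteq># M \<and> (\<forall>g\<in>B. \<not> g \<subseteq># M)} = {M\<in>D. mdeg d M = z}"
      using D_iff by (auto simp: reps_def ms_def D_def)
    have "{x \<in> mgen C. deg x = z} = val ` {M\<in>D. mdeg d M = z}"
    proof (intro equalityI subsetI)
      fix x assume "x \<in> {x \<in> mgen C. deg x = z}"
      then obtain M0 where M0: "M0 \<in> ms" "x = val M0" and z: "deg x = z" by (auto simp: mgen_val)
      define M where "M = (LEAST M. M \<in> ms \<and> val M = x)"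
      have M: "M \<in> ms \<and> val M = x" unfolding M_def using M0 by (intro LeastI[of "\<lambda>M. M \<in> ms \<and> val M = x" M0]) simp
      have "M \<le> N" if "N \<in> ms" "val N = x" for N
        unfolding M_def using that by (intro Least_le) simp
      then have "M \<in> D" using M by (auto simp: D_def)
      then show "x \<in> val ` {M\<in>D. mdeg d M = z}"
        using M z deg_val[of M] by (intro image_eqI[of _ _ M]) auto
    next
      fix x assume "x \<in> val ` {M\<in>D. mdeg d M = z}"
      then show "x \<in> {x \<in> mgen C. deg x = z}" by (auto simp: mgen_val D_def deg_val)
    qed
    moreover have "inj_on val {M\<in>D. mdeg d M = z}"
      by (rule inj_onI) (auto simp: D_def intro: antisym)
    ultimately show ?thesis unfolding eq by (simp add: card_image)
  qed
  then show ?thesis using quasi_alg_card_avoiding_reps[where p = p and d = d and u = "{#}", OF d1 B(2)] by simp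
qed

section \<open>Noetherian subrings\<close>

lemma subring_closed:
  assumes "is_subring A"
  shows "1 \<in> A" "0 \<in> A" "x \<in> A \<Longrightarrow> y \<in> A \<Longrightarrow> x + y \<in> A" "x \<in> A \<Longrightarrow> y \<in> A \<Longrightarrow> x - y \<in> A"
    "x \<in> A \<Longrightarrow> y \<in> A \<Longrightarrow> x * y \<in> A" "x \<in> A \<Longrightarrow> - x \<in> A" "x \<in> A \<Longrightarrow> x ^ k \<in> A"
proof -
  show 1: "1 \<in> A" and "x \<in> A \<Longrightarrow> y \<in> A \<Longrightarrow> x + y \<in> A" and m: "\<And>x y. x \<in> A \<Longrightarrow> y \<in> A \<Longrightarrow> x - y \<in> A"
    and p: "\<And>x y. x \<in> A \<Longrightarrow> y \<in> A \<Longrightarrow> x * y \<in> A"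
    using assms by (auto simp: is_subring_def)
  show 0: "0 \<in> A" using m[OF 1 1] by simp
  show "x \<in> A \<Longrightarrow> - x \<in> A" using m[OF 0, of x] by simp
  show "x \<in> A \<Longrightarrow> x ^ k \<in> A" by (induction k) (use 1 p in auto)
qed

lemma subring_sum: "is_subring A \<Longrightarrow> (\<And>i. i \<in> S \<Longrightarrow> f i \<in> A) \<Longrightarrow> sum f S \<in> A"
  by (induction S rule: infinite_finite_induct) (auto intro: subring_closed)

definition adjoin :: "'a::comm_ring_1 set \<Rightarrow> 'a \<Rightarrow> 'a set" where
  "adjoin B x = {\<Sum>i<m. b i * x ^ i | b m. \<forall>i. b i \<in> B}"

lemma adjoinI: "\<forall>i. b i \<in> B \<Longrightarrow> (\<Sum>i<m. b i * x ^ i) \<in> adjoin B x"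
  unfolding adjoin_def by (intro CollectI exI[of _ b] exI[of _ m] conjI refl)

lemma adjoin_term:
  assumes "is_subring B" "b \<in> B"
  shows "b * x ^ k \<in> adjoin B x"
proof -
  have "(\<Sum>i<Suc k. (if i = k then b else 0) * x ^ i) = (\<Sum>i<Suc k. if i = k then b * x ^ i else 0)"
    by (intro sum.cong) auto
  also have "\<dots> = b * x ^ k" by simp
  finally have "b * x ^ k = (\<Sum>i<Suc k. (if i = k then b else 0) * x ^ i)" ..
  moreover have "\<forall>i. (if i = k then b else 0) \<in> B" using assms subring_closed by auto
  ultimately show ?thesis using adjoinI[of "\<lambda>i. if i = k then b else 0" B x "Suc k"] by (simp only: simp_thms)
qed

lemma adjoin_add:
  assumes B: "is_subring B" and "f \<in> adjoin B x" "g \<in> adjoin B x"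
  shows "f + g \<in> adjoin B x"
proof -
  obtain b m where b: "\<forall>i. b i \<in> B" "f = (\<Sum>i<m. b i * x ^ i)" using assms(2) unfolding adjoin_def by blast
  obtain c n where c: "\<forall>i. c i \<in> B" "g = (\<Sum>i<n. c i * x ^ i)" using assms(3) unfolding adjoin_def by blast
  define b' where "b' i = (if i < m then b i else 0)" for i
  define c' where "c' i = (if i < n then c i else 0)" for i
  have f: "f = (\<Sum>i<m + n. b' i * x ^ i)"
    unfolding b(2) by (intro sum.mono_neutral_cong_left) (auto simp: b'_def)
  have g: "g = (\<Sum>i<m + n. c' i * x ^ i)"
    unfolding c(2) by (intro sum.mono_neutral_cong_left) (auto simp: c'_def)
  have "f + g = (\<Sum>i<m + n. (b' i + c' i) * x ^ i)" unfolding f g by (simp add: sum.distrib distrib_right)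
  moreover have "\<forall>i. b' i + c' i \<in> B" using b c subring_closed[OF B] by (auto simp: b'_def c'_def)
  ultimately show ?thesis using adjoinI[of "\<lambda>i. b' i + c' i" B x "m + n"] by (simp only: simp_thms)
qed

lemma adjoin_sum:
  assumes "is_subring B" "\<And>i. i \<in> S \<Longrightarrow> f i \<in> adjoin B x"
  shows "sum f S \<in> adjoin B x"
  using assms(2)
proof (induction S rule: infinite_finite_induct)
  case empty
  show ?case using adjoin_term[OF assms(1) subring_closed(2)[OF assms(1)], of x 0] by simp
next
  case (infinite S)
  then show ?case using adjoin_term[OF assms(1) subring_closed(2)[OF assms(1)], of x 0] by simp
qed (auto intro: adjoin_add assms)

lemma is_subring_adjoin:
  assumes B: "is_subring B"
  shows "is_subring (adjoin B x)"
  unfolding is_subring_def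
proof (intro conjI ballI)
  show "1 \<in> adjoin B x" using adjoin_term[OF B subring_closed(1)[OF B], of x 0] by simp
  fix f g assume f: "f \<in> adjoin B x" and g: "g \<in> adjoin B x"
  show "f + g \<in> adjoin B x" by (rule adjoin_add[OF B f g])
  obtain b m where b: "\<forall>i. b i \<in> B" "f = (\<Sum>i<m. b i * x ^ i)" using f unfolding adjoin_def by blast
  obtain c n where c: "\<forall>i. c i \<in> B" "g = (\<Sum>i<n. c i * x ^ i)" using g unfolding adjoin_def by blast
  have "f * g = (\<Sum>i<m. \<Sum>j<n. (b i * c j) * x ^ (i + j))"
    unfolding b c sum_product by (simp add: power_add mult_ac)
  also have "\<dots> \<in> adjoin B x"
    using b c by (intro adjoin_sum[OF B] adjoin_term[OF B] subring_closed(5)[OF B]) auto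
  finally show "f * g \<in> adjoin B x" .
  have "- g = (\<Sum>j<n. (- c j) * x ^ j)" unfolding c by (simp add: sum_negf)
  also have "\<dots> \<in> adjoin B x"
    using c by (intro adjoin_sum[OF B] adjoin_term[OF B] subring_closed(6)[OF B]) auto
  finally show "f - g \<in> adjoin B x" using adjoin_add[OF B f, of "- g"] by simp
qed

lemma adjoin_least:
  assumes "is_subring A" "B \<subseteq> A" "x \<in> A"
  shows "adjoin B x \<subseteq> A"
  using assms unfolding adjoin_def by (auto intro!: subring_sum subring_closed)

text \<open>When \<open>x\<close> satisfies relations over \<open>B\<close>, an element has no
  well-defined leading coefficient. The set therefore refers to expressions: it collects the
  coefficients of \<open>x ^ k\<close> in all expressions of formal degree \<open>k\<close> whose
  value lies in \<open>I\<close>.\<close>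

definition lead_ideal :: "'a::comm_ring_1 set \<Rightarrow> 'a \<Rightarrow> 'a set \<Rightarrow> nat \<Rightarrow> 'a set" where
  "lead_ideal B x I k = {b\<in>B. \<exists>c. (\<forall>i. c i \<in> B) \<and> b * x ^ k + (\<Sum>i<k. c i * x ^ i) \<in> I}"

lemma lead_idealI:
  "b \<in> B \<Longrightarrow> (\<And>i. c i \<in> B) \<Longrightarrow> b * x ^ k + (\<Sum>i<k. c i * x ^ i) \<in> I \<Longrightarrow> b \<in> lead_ideal B x I k"
  unfolding lead_ideal_def by blast

lemma ideal_of_lead_ideal:
  assumes B: "is_subring B" and I: "ideal_of (adjoin B x) I"
  shows "ideal_of B (lead_ideal B x I k)"
  unfolding ideal_of_def
proof (intro conjI ballI)
  show "lead_ideal B x I k \<subseteq> B" by (auto simp: lead_ideal_def)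
  show "0 \<in> lead_ideal B x I k"
    using I by (intro lead_idealI[of _ _ "\<lambda>_. 0"] subring_closed(2)[OF B]) (auto simp: ideal_of_def)
  fix a b assume a: "a \<in> lead_ideal B x I k" and b: "b \<in> lead_ideal B x I k"
  from a obtain c where c: "a \<in> B" "\<And>i. c i \<in> B" "a * x ^ k + (\<Sum>i<k. c i * x ^ i) \<in> I"
    unfolding lead_ideal_def by blast
  from b obtain d where d: "b \<in> B" "\<And>i. d i \<in> B" "b * x ^ k + (\<Sum>i<k. d i * x ^ i) \<in> I"
    unfolding lead_ideal_def by blast
  have "(a * x ^ k + (\<Sum>i<k. c i * x ^ i)) + (b * x ^ k + (\<Sum>i<k. d i * x ^ i)) \<in> I"
    using c d I by (auto simp: ideal_of_def)
  also have "(a * x ^ k + (\<Sum>i<k. c i * x ^ i)) + (b * x ^ k + (\<Sum>i<k. d i * x ^ i)) =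
    (a + b) * x ^ k + (\<Sum>i<k. (c i + d i) * x ^ i)" by (simp add: sum.distrib algebra_simps)
  finally show "a + b \<in> lead_ideal B x I k"
    using c d by (intro lead_idealI[of _ _ "\<lambda>i. c i + d i"] subring_closed[OF B])
next
  fix a b assume a: "a \<in> B" and b: "b \<in> lead_ideal B x I k"
  from b obtain d where d: "b \<in> B" "\<And>i. d i \<in> B" "b * x ^ k + (\<Sum>i<k. d i * x ^ i) \<in> I" unfolding lead_ideal_def by blast
  have "a \<in> adjoin B x" using adjoin_term[OF B a, of x 0] by simp
  then have "a * (b * x ^ k + (\<Sum>i<k. d i * x ^ i)) \<in> I"
    using d I by (auto simp: ideal_of_def)
  also have "a * (b * x ^ k + (\<Sum>i<k. d i * x ^ i)) = (a * b) * x ^ k + (\<Sum>i<k. (a * d i) * x ^ i)"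
    by (simp add: sum_distrib_left algebra_simps)
  finally show "a * b \<in> lead_ideal B x I k"
    using a d by (intro lead_idealI[of _ _ "\<lambda>i. a * d i"] subring_closed[OF B])
qed

lemma lead_ideal_Suc:
  assumes B: "is_subring B" and I: "ideal_of (adjoin B x) I"
  shows "lead_ideal B x I k \<subseteq> lead_ideal B x I (Suc k)"
proof
  fix b assume "b \<in> lead_ideal B x I k"
  then obtain d where d: "b \<in> B" "\<And>i. d i \<in> B" "b * x ^ k + (\<Sum>i<k. d i * x ^ i) \<in> I" unfolding lead_ideal_def by blast
  have "x \<in> adjoin B x" using adjoin_term[OF B subring_closed(1)[OF B], of x 1] by simp
  then have "x * (b * x ^ k + (\<Sum>i<k. d i * x ^ i)) \<in> I"
    using d I by (auto simp: ideal_of_def)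
  also have "x * (b * x ^ k + (\<Sum>i<k. d i * x ^ i)) =
     b * x ^ Suc k + (\<Sum>i<Suc k. (case i of 0 \<Rightarrow> 0 | Suc i \<Rightarrow> d i) * x ^ i)"
    unfolding sum.lessThan_Suc_shift by (simp add: sum_distrib_left algebra_simps)
  finally show "b \<in> lead_ideal B x I (Suc k)"
    using d by (intro lead_idealI[of _ _ "\<lambda>i. case i of 0 \<Rightarrow> 0 | Suc i \<Rightarrow> d i"])
      (auto split: nat.split intro: subring_closed(2)[OF B])
qed

lemma lead_ideal_mono: "I \<subseteq> I' \<Longrightarrow> lead_ideal B x I k \<subseteq> lead_ideal B x I' k"
  unfolding lead_ideal_def by blast

text \<open>From an element of \<open>I'\<close> subtract an element of \<open>I\<close> whose
  expression has the same top coefficient. The difference lies in \<open>I'\<close> and has a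
  shorter expression, so induction on the length puts it into \<open>I\<close>.\<close>

lemma lead_ideal_determines:
  assumes B: "is_subring B" and I: "ideal_of (adjoin B x) I" "ideal_of (adjoin B x) I'" "I \<subseteq> I'"
    and lead: "\<And>k. lead_ideal B x I' k \<subseteq> lead_ideal B x I k"
  shows "I' \<subseteq> I"
proof
  fix f assume f: "f \<in> I'"
  then obtain b m where b: "\<forall>i. b i \<in> B" "f = (\<Sum>i<m. b i * x ^ i)"
    using I(2) unfolding ideal_of_def adjoin_def by blast
  have "\<And>b. (\<forall>i. b i \<in> B) \<Longrightarrow> (\<Sum>i<m. b i * x ^ i) \<in> I' \<Longrightarrow> (\<Sum>i<m. b i * x ^ i) \<in> I"
  proof (induction m)
    case 0
    then show ?case using I(1) by (auto simp: ideal_of_def)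
  next
    case (Suc m)
    have "b m \<in> lead_ideal B x I' m"
      using Suc.prems by (intro lead_idealI[of _ _ b]) (auto simp: add.commute)
    with lead have "b m \<in> lead_ideal B x I m" by auto
    then obtain c where c: "\<And>i. c i \<in> B" "b m * x ^ m + (\<Sum>i<m. c i * x ^ i) \<in> I" (is "?g \<in> I")
      unfolding lead_ideal_def by blast
    have m1: "- 1 \<in> adjoin B x"
      by (intro subring_closed(6) subring_closed(1) is_subring_adjoin B)
    have "- 1 * ?g \<in> I'" using c(2) I(3) I(2) m1 unfolding ideal_of_def by blast
    with Suc.prems(2) have "(\<Sum>i<Suc m. b i * x ^ i) + - 1 * ?g \<in> I'" using I(2) unfolding ideal_of_def by blast
    also have eq: "(\<Sum>i<Suc m. b i * x ^ i) + - 1 * ?g = (\<Sum>i<m. (b i - c i) * x ^ i)"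
      by (simp add: left_diff_distrib sum_subtractf)
    finally have "(\<Sum>i<m. (b i - c i) * x ^ i) \<in> I"
      using Suc.prems(1) c(1) subring_closed(4)[OF B] by (intro Suc.IH) auto
    then have "?g + (\<Sum>i<m. (b i - c i) * x ^ i) \<in> I" using c(2) I(1) unfolding ideal_of_def by blast
    then show ?case by (simp add: left_diff_distrib sum_subtractf add.commute)
  qed
  with b f show "f \<in> I" by blast
qed

text \<open>Hilbert's basis theorem; \<open>x\<close> need not be transcendental over \<open>B\<close>.\<close>
theorem noetherian_adjoin:
  assumes "noetherian_subring B"
  shows "noetherian_subring (adjoin B x)"
proof -
  have B: "is_subring B" using assms by (simp add: noetherian_subring_def)
  have acc: "\<exists>N. \<forall>m\<ge>N. L m = L N" if "\<And>i. ideal_of B (L i)" "\<And>i. L i \<subseteq> L (Suc i)" for L :: "nat \<Rightarrow> 'a set"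
    using assms that unfolding noetherian_subring_def by blast
  show ?thesis unfolding noetherian_subring_def
  proof (intro conjI allI impI is_subring_adjoin[OF B])
    fix I :: "nat \<Rightarrow> 'a set"
    assume "(\<forall>i. ideal_of (adjoin B x) (I i)) \<and> (\<forall>i. I i \<subseteq> I (Suc i))"
    then have I: "\<And>i. ideal_of (adjoin B x) (I i)" and mono: "\<And>i. I i \<subseteq> I (Suc i)" by auto
    have monoI: "I i \<subseteq> I j" if "i \<le> j" for i j using lift_Suc_mono_le[of I, OF mono that] .
    define L where "L k m = lead_ideal B x (I m) k" for k m
    have L_ideal: "ideal_of B (L k m)" for k m unfolding L_def by (rule ideal_of_lead_ideal[OF B I])
    have L_mono: "L k m \<subseteq> L k' m'" if "k \<le> k'" "m \<le> m'" for k m k' m'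
    proof -
      have "L k m \<subseteq> L k' m" unfolding L_def
        using lift_Suc_mono_le[of "lead_ideal B x (I m)", OF lead_ideal_Suc[OF B I] that(1)] .
      also have "\<dots> \<subseteq> L k' m'" unfolding L_def by (rule lead_ideal_mono[OF monoI[OF that(2)]])
      finally show ?thesis .
    qed
    \<comment> \<open>\<open>L\<close> increases in both arguments, so the diagonal is a chain of
      ideals of \<open>B\<close>. Its stabilisation controls all degrees \<open>k \<ge> N\<close> at
      once.\<close>
    have "\<exists>N. \<forall>m\<ge>N. L m m = L N N"
      by (rule acc[of "\<lambda>m. L m m"], rule L_ideal, rule L_mono) simp_all
    then obtain N where N: "\<And>m. m \<ge> N \<Longrightarrow> L m m = L N N" by auto
    have "\<exists>M. \<forall>m\<ge>M. L k m = L k M" for k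
      by (rule acc[of "L k"], rule L_ideal, rule L_mono) simp_all
    then obtain M where M: "\<And>k m. m \<ge> M k \<Longrightarrow> L k m = L k (M k)" by metis
    \<comment> \<open>Beyond \<open>T\<close> the finitely many rows \<open>k < N\<close> have
      stabilised individually. A row \<open>k \<ge> N\<close> is squeezed between
      \<open>L N N\<close> and a later diagonal member, which are equal.\<close>
    define T where "T = N + (\<Sum>k<N. M k)"
    have stab: "L k m = L k T" if "m \<ge> T" for k m
    proof (cases "k < N")
      case True
      then have "M k \<le> (\<Sum>k<N. M k)" by (intro member_le_sum) auto
      then have "M k \<le> T" by (simp add: T_def)
      then show ?thesis using M[of k m] M[of k T] that by simp
    next
      case False
      have *: "L k j = L N N" if "j \<ge> N" for j
      proof
        show "L N N \<subseteq> L k j" using False that by (intro L_mono) auto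
        have "L k j \<subseteq> L (max k j) (max k j)" by (intro L_mono) auto
        also have "\<dots> = L N N" using that by (intro N) auto
        finally show "L k j \<subseteq> L N N" .
      qed
      have "N \<le> T" by (simp add: T_def)
      with * that show ?thesis by simp
    qed
    show "\<exists>N. \<forall>m\<ge>N. I m = I N"
    proof (intro exI[of _ T] allI impI equalityI)
      fix m assume m: "T \<le> m"
      show "I T \<subseteq> I m" by (rule monoI[OF m])
      show "I m \<subseteq> I T"
      proof (rule lead_ideal_determines[OF B I I monoI[OF m]])
        fix k show "lead_ideal B x (I m) k \<subseteq> lead_ideal B x (I T) k"
          using stab[OF m, of k] by (simp add: L_def)
      qed
    qed
  qed
qed

text \<open>The minimality clause identifies \<open>A\<close> as the subring generated by
  \<open>B\<close> and \<open>X\<close>, so comparing it with a concrete ring takes one inclusion by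
  minimality and one by writing elements out.\<close>

lemma noetherian_adjoin_finite:
  assumes "finite X" "noetherian_subring B"
  shows "\<exists>A. noetherian_subring A \<and> B \<subseteq> A \<and> X \<subseteq> A \<and>
    (\<forall>A'. is_subring A' \<and> B \<subseteq> A' \<and> X \<subseteq> A' \<longrightarrow> A \<subseteq> A')"
  using assms(1)
proof (induction X rule: finite_induct)
  case empty
  show ?case using assms(2) by (intro exI[of _ B]) auto
next
  case (insert x X)
  then obtain A where A: "noetherian_subring A" "B \<subseteq> A" "X \<subseteq> A"
    "\<And>A'. is_subring A' \<Longrightarrow> B \<subseteq> A' \<Longrightarrow> X \<subseteq> A' \<Longrightarrow> A \<subseteq> A'" by auto
  have sub: "is_subring A" using A(1) by (simp add: noetherian_subring_def)
  have "A \<subseteq> adjoin A x" using adjoin_term[OF sub, of _ x 0] by auto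
  moreover have "x \<in> adjoin A x" using adjoin_term[OF sub subring_closed(1)[OF sub], of x 1] by simp
  ultimately show ?case
  proof (intro exI[of _ "adjoin A x"] conjI allI impI)
    fix A' assume A': "is_subring A' \<and> B \<subseteq> A' \<and> insert x X \<subseteq> A'"
    then show "adjoin A x \<subseteq> A'" using A(4)[of A'] by (intro adjoin_least) auto
  qed (use A noetherian_adjoin[OF A(1), of x] in auto)
qed

lemma noetherian_field:
  fixes B :: "'a::comm_ring_1 set"
  assumes B: "is_subring B" and inv: "\<And>b. b \<in> B \<Longrightarrow> b \<noteq> 0 \<Longrightarrow> \<exists>c\<in>B. c * b = 1"
  shows "noetherian_subring B"
  unfolding noetherian_subring_def
proof (intro conjI allI impI B)
  fix L :: "nat \<Rightarrow> 'a set"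
  assume L: "(\<forall>i. ideal_of B (L i)) \<and> (\<forall>i. L i \<subseteq> L (Suc i))"
  have cases: "L i = {0} \<or> L i = B" for i
  proof (cases "\<exists>b\<in>L i. b \<noteq> 0")
    case True
    then obtain b where b: "b \<in> L i" "b \<noteq> 0" by auto
    then obtain c where "c \<in> B" "c * b = 1" using inv[of b] L unfolding ideal_of_def by blast
    then have "1 \<in> L i" using L b unfolding ideal_of_def by metis
    then have "a \<in> L i" if "a \<in> B" for a using L that unfolding ideal_of_def by (metis mult.right_neutral)
    then show ?thesis using L unfolding ideal_of_def by blast
  next
    case False
    then show ?thesis using L unfolding ideal_of_def by blast
  qed
  have monoL: "L i \<subseteq> L j" if "i \<le> j" for i j using lift_Suc_mono_le[of L, OF _ that] L by simp
  show "\<exists>N. \<forall>m\<ge>N. L m = L N"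
  proof (cases "\<exists>N. L N = B")
    case True
    then obtain N where N: "L N = B" by auto
    have "L m = L N" if "m \<ge> N" for m
      using monoL[OF that] N L unfolding ideal_of_def by blast
    then show ?thesis by blast
  next
    case False
    then have "L m = {0}" for m using cases by blast
    then show ?thesis by blast
  qed
qed

section \<open>Monomial ideals\<close>

definition upset :: "('v \<Rightarrow>\<^sub>0 nat) set \<Rightarrow> bool" where
  "upset U \<longleftrightarrow> (\<forall>a\<in>U. \<forall>c. a + c \<in> U)"

definition mon_span :: "('v \<Rightarrow>\<^sub>0 nat) set \<Rightarrow> ('v, 'k::field) mpoly set" where
  "mon_span U = {f. Poly_Mapping.keys f \<subseteq> U}"

definition sumset :: "'a::plus set \<Rightarrow> 'a set \<Rightarrow> 'a set" where
  "sumset U V = {a + b | a b. a \<in> U \<and> b \<in> V}"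

abbreviation exp_le :: "('v \<Rightarrow>\<^sub>0 nat) \<Rightarrow> ('v \<Rightarrow>\<^sub>0 nat) \<Rightarrow> bool" where
  "exp_le a b \<equiv> (\<forall>i. Poly_Mapping.lookup a i \<le> Poly_Mapping.lookup b i)"

lemma exp_le_add:
  assumes "exp_le a b"
  shows "b = a + (b - a)"
  using assms by (intro poly_mapping_eqI) (simp add: lookup_add lookup_minus)

lemma upsetD: "upset U \<Longrightarrow> a \<in> U \<Longrightarrow> exp_le a b \<Longrightarrow> b \<in> U"
  using exp_le_add unfolding upset_def by metis

lemma upset_sumset:
  assumes "upset V"
  shows "upset (sumset U V)"
  using assms unfolding upset_def sumset_def by (auto simp: add.assoc) blast

lemma poly_mapping_monomials:
  fixes f :: "'a \<Rightarrow>\<^sub>0 'b::comm_monoid_add"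
  shows "f = (\<Sum>a\<in>Poly_Mapping.keys f. Poly_Mapping.single a (Poly_Mapping.lookup f a))"
proof (rule poly_mapping_eqI)
  fix k
  have "Poly_Mapping.lookup (\<Sum>a\<in>Poly_Mapping.keys f. Poly_Mapping.single a (Poly_Mapping.lookup f a)) k =
    (\<Sum>a\<in>Poly_Mapping.keys f. if a = k then Poly_Mapping.lookup f a else 0)"
    by (simp add: lookup_sum lookup_single when_def)
  also have "\<dots> = Poly_Mapping.lookup f k"
    by (simp add: in_keys_iff)
  finally show "Poly_Mapping.lookup f k = Poly_Mapping.lookup
      (\<Sum>a\<in>Poly_Mapping.keys f. Poly_Mapping.single a (Poly_Mapping.lookup f a)) k" ..
qed

lemma ideal_sum: "is_ideal I \<Longrightarrow> (\<And>i. i \<in> A \<Longrightarrow> f i \<in> I) \<Longrightarrow> sum f A \<in> I"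
  by (induction A rule: infinite_finite_induct) (auto simp: is_ideal_def)

lemma is_ideal_mon_span:
  assumes "upset U"
  shows "is_ideal (mon_span U)"
  unfolding is_ideal_def
proof (intro conjI ballI allI)
  show "0 \<in> mon_span U" by (simp add: mon_span_def)
  show "x + y \<in> mon_span U" if "x \<in> mon_span U" "y \<in> mon_span U" for x y
    using that keys_add[of x y] by (auto simp: mon_span_def)
  show "a * x \<in> mon_span U" if "x \<in> mon_span U" for x a
  proof -
    have "b + c \<in> U" if "b \<in> Poly_Mapping.keys a" "c \<in> Poly_Mapping.keys x" for b c
      using that \<open>x \<in> mon_span U\<close> assms by (subst add.commute) (auto simp: mon_span_def upset_def)
    then show ?thesis using keys_mult[of a x] by (auto simp: mon_span_def)
  qed
qed

lemma ideal_gen_superset: "S \<subseteq> ideal_gen S"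
  by (auto simp: ideal_gen_def)

lemma ideal_gen_least: "is_ideal I \<Longrightarrow> S \<subseteq> I \<Longrightarrow> ideal_gen S \<subseteq> I"
  by (auto simp: ideal_gen_def)

lemma is_ideal_ideal_gen: "is_ideal (ideal_gen S)"
  unfolding is_ideal_def ideal_gen_def by auto

lemma single_eq_scaled_monom: "Poly_Mapping.single a c = Poly_Mapping.single 0 c * monom a"
  by (simp add: monom_def mult_single)

lemma mon_span_subset_ideal:
  assumes I: "is_ideal I" and "\<And>a. a \<in> U \<Longrightarrow> monom a \<in> I"
  shows "mon_span U \<subseteq> I"
proof
  fix f :: "('a, 'b) mpoly" assume f: "f \<in> mon_span U"
  have "Poly_Mapping.single a c \<in> I" if "a \<in> U" for a c
    using I assms(2)[OF that] by (subst single_eq_scaled_monom) (auto simp: is_ideal_def)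
  then have "(\<Sum>a\<in>Poly_Mapping.keys f. Poly_Mapping.single a (Poly_Mapping.lookup f a)) \<in> I"
    using f by (intro ideal_sum[OF I]) (auto simp: mon_span_def)
  then show "f \<in> I" using poly_mapping_monomials[of f] by simp
qed

lemma monom_in_mon_span_iff: "monom a \<in> mon_span U \<longleftrightarrow> a \<in> U"
  by (simp add: monom_def mon_span_def)

lemma monom_add: "monom (a + b) = monom a * monom b"
  by (simp add: monom_def mult_single)

lemma ideal_gen_eq_mon_span:
  assumes "upset U" "S \<subseteq> mon_span U" "\<And>a. a \<in> U \<Longrightarrow> monom a \<in> ideal_gen S"
  shows "ideal_gen S = mon_span U"
  using ideal_gen_least[OF is_ideal_mon_span[OF assms(1)] assms(2)]
    mon_span_subset_ideal[OF is_ideal_ideal_gen assms(3)] by blast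

lemma ideal_gen_monoms: "ideal_gen (monom ` B) = mon_span (sumset B UNIV)"
proof (rule ideal_gen_eq_mon_span)
  show "upset (sumset B UNIV)" by (rule upset_sumset) (simp add: upset_def)
  have "a \<in> sumset B UNIV" if "a \<in> B" for a
    using that unfolding sumset_def by (intro CollectI exI[of _ a] exI[of _ 0]) auto
  then show "monom ` B \<subseteq> mon_span (sumset B UNIV)"
    by (auto simp: monom_in_mon_span_iff)
  fix a assume "a \<in> sumset B UNIV"
  then obtain b c where "a = c + b" "b \<in> B" by (auto simp: sumset_def add.commute)
  then show "monom a \<in> ideal_gen (monom ` B)"
    using is_ideal_ideal_gen[of "monom ` B"] subsetD[OF ideal_gen_superset, of "monom b" "monom ` B"]
    by (auto simp: monom_add is_ideal_def)
qed

lemma monomial_ideal_mon_span: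
  assumes "monomial_ideal I"
  shows "\<exists>B. I = mon_span (sumset B UNIV)"
proof -
  obtain M where "M \<subseteq> range monom" "I = ideal_gen M" using assms by (auto simp: monomial_ideal_def)
  then obtain B where "M = monom ` B" by (meson subset_imageE)
  then show ?thesis using \<open>I = ideal_gen M\<close> ideal_gen_monoms by blast
qed

lemma ideal_mult_mon_span:
  fixes U V :: "('v \<Rightarrow>\<^sub>0 nat) set"
  assumes "upset V"
  shows "ideal_mult (mon_span U) (mon_span V) = (mon_span (sumset U V) :: ('v, 'k::field) mpoly set)"
proof -
  let ?S = "{x * y |x y. x \<in> mon_span U \<and> y \<in> mon_span V} :: ('v, 'k) mpoly set"
  have "ideal_gen ?S = mon_span (sumset U V)"
  proof (rule ideal_gen_eq_mon_span)
    show "upset (sumset U V)" by (rule upset_sumset[OF assms])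
    show "?S \<subseteq> mon_span (sumset U V)"
    proof
      fix z assume "z \<in> ?S"
      then obtain x y where "z = x * y" "x \<in> mon_span U" "y \<in> mon_span V" by auto
      then show "z \<in> mon_span (sumset U V)"
        using keys_mult[of x y] unfolding mon_span_def sumset_def by blast
    qed
    fix a assume "a \<in> sumset U V"
    then obtain b c where "a = b + c" "b \<in> U" "c \<in> V" by (auto simp: sumset_def)
    then have "monom a \<in> ?S"
      by (intro CollectI exI[of _ "monom b"] exI[of _ "monom c"]) (simp add: monom_add monom_in_mon_span_iff)
    then show "monom a \<in> ideal_gen ?S" by (rule subsetD[OF ideal_gen_superset])
  qed
  then show ?thesis by (simp only: ideal_mult_def)
qed

text \<open>The zeroth power is the whole ring, hence \<open>UNIV\<close> and not
  \<open>{0}\<close>. With this start every \<open>exp_pow U k\<close> is an up-set, whatever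
  \<open>U\<close> is.\<close>

primrec exp_pow :: "('v \<Rightarrow>\<^sub>0 nat) set \<Rightarrow> nat \<Rightarrow> ('v \<Rightarrow>\<^sub>0 nat) set" where
  "exp_pow U 0 = UNIV"
| "exp_pow U (Suc k) = sumset U (exp_pow U k)"

lemma upset_exp_pow: "upset (exp_pow U k)"
  by (induction k) (auto intro: upset_sumset simp: upset_def[of UNIV])

lemma ideal_pow_mon_span: "ideal_pow (mon_span U) k = mon_span (exp_pow U k)"
  by (induction k) (auto simp: ideal_mult_mon_span upset_exp_pow mon_span_def[of UNIV])

definition exp_multipow :: "('r \<Rightarrow> ('v \<Rightarrow>\<^sub>0 nat) set) \<Rightarrow> ('r \<Rightarrow> nat) \<Rightarrow> ('v \<Rightarrow>\<^sub>0 nat) set" where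
  "exp_multipow U n = {(\<Sum>j\<in>UNIV. f j) | f. \<forall>j. f j \<in> exp_pow (U j) (n j)}"

lemma upset_exp_multipow: "upset (exp_multipow (U :: 'r::finite \<Rightarrow> _) n)"
  unfolding upset_def
proof (intro ballI allI)
  fix a c assume "a \<in> exp_multipow U n"
  then obtain f where f: "a = (\<Sum>j\<in>UNIV. f j)" "\<forall>j. f j \<in> exp_pow (U j) (n j)"
    by (auto simp: exp_multipow_def)
  fix c
  obtain j0 :: 'r where True by simp
  have "(\<Sum>j\<in>UNIV. f j + (if j = j0 then c else 0)) = a + c"
    by (simp add: sum.distrib f)
  moreover have "f j + (if j = j0 then c else 0) \<in> exp_pow (U j) (n j)" for j
    using f(2) upset_exp_pow[of "U j" "n j"] by (auto simp: upset_def)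
  ultimately show "a + c \<in> exp_multipow U n"
    unfolding exp_multipow_def
    by (intro CollectI exI[of _ "\<lambda>j. f j + (if j = j0 then c else 0)"]) simp
qed

lemma keys_prod_subset:
  fixes f :: "'r \<Rightarrow> ('v, 'k::field) mpoly"
  assumes "finite A"
  shows "Poly_Mapping.keys (\<Prod>j\<in>A. f j) \<subseteq> {(\<Sum>j\<in>A. g j) | g. \<forall>j\<in>A. g j \<in> Poly_Mapping.keys (f j)}"
  using assms
proof (induction A rule: finite_induct)
  case (insert x A)
  show ?case
  proof
    fix a assume "a \<in> Poly_Mapping.keys (\<Prod>j\<in>insert x A. f j)"
    then obtain b c where bc: "a = b + c" "b \<in> Poly_Mapping.keys (f x)" "c \<in> Poly_Mapping.keys (\<Prod>j\<in>A. f j)"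
      using insert.hyps keys_mult[of "f x" "\<Prod>j\<in>A. f j"] by auto
    obtain g where g: "c = (\<Sum>j\<in>A. g j)" "\<forall>j\<in>A. g j \<in> Poly_Mapping.keys (f j)" using insert.IH bc(3) by blast
    have "(\<Sum>j\<in>insert x A. (g(x := b)) j) = b + (\<Sum>j\<in>A. (g(x := b)) j)" using insert.hyps by simp
    also have "(\<Sum>j\<in>A. (g(x := b)) j) = c" unfolding g(1) using insert.hyps by (intro sum.cong) auto
    finally have "a = (\<Sum>j\<in>insert x A. (g(x := b)) j)" by (simp add: bc)
    moreover have "\<forall>j\<in>insert x A. (g(x := b)) j \<in> Poly_Mapping.keys (f j)" using g bc by auto
    ultimately show "a \<in> {(\<Sum>j\<in>insert x A. g j) | g. \<forall>j\<in>insert x A. g j \<in> Poly_Mapping.keys (f j)}"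
      by (intro CollectI exI[of _ "g(x := b)"] conjI)
  qed
qed (simp add: keys_one)

lemma monom_sum: "monom (\<Sum>j\<in>A. f j) = (\<Prod>j\<in>A. monom (f j))"
proof (induction A rule: infinite_finite_induct)
  case (insert x A)
  then show ?case by (simp add: monom_add)
qed (simp_all add: monom_def)

lemma ideal_multipow_mon_span:
  fixes U :: "'r::finite \<Rightarrow> ('v \<Rightarrow>\<^sub>0 nat) set"
  shows "ideal_multipow (\<lambda>j. mon_span (U j)) n = (mon_span (exp_multipow U n) :: ('v, 'k::field) mpoly set)"
  unfolding ideal_multipow_def ideal_pow_mon_span
proof (rule ideal_gen_eq_mon_span[OF upset_exp_multipow])
  show "{\<Prod>j\<in>UNIV. f j |f. \<forall>j. f j \<in> mon_span (exp_pow (U j) (n j))} \<subseteq>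
    (mon_span (exp_multipow U n) :: ('v, 'k) mpoly set)"
  proof
    fix z :: "('v, 'k) mpoly"
    assume "z \<in> {\<Prod>j\<in>UNIV. f j |f. \<forall>j. f j \<in> mon_span (exp_pow (U j) (n j))}"
    then obtain f :: "'r \<Rightarrow> ('v, 'k) mpoly"
      where f: "z = (\<Prod>j\<in>UNIV. f j)" "\<forall>j. Poly_Mapping.keys (f j) \<subseteq> exp_pow (U j) (n j)"
      by (auto simp: mon_span_def)
    have "{(\<Sum>j\<in>UNIV. g j) | g. \<forall>j\<in>UNIV. g j \<in> Poly_Mapping.keys (f j)} \<subseteq> exp_multipow U n"
      using f(2) unfolding exp_multipow_def by blast
    then show "z \<in> mon_span (exp_multipow U n)"
      using keys_prod_subset[of UNIV f] unfolding f(1) mon_span_def by auto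
  qed
  fix a assume "a \<in> exp_multipow U n"
  then obtain f where f: "a = (\<Sum>j\<in>UNIV. f j)" "\<forall>j. f j \<in> exp_pow (U j) (n j)"
    by (auto simp: exp_multipow_def)
  have "monom a \<in> {\<Prod>j\<in>UNIV. f j |f. \<forall>j. f j \<in> (mon_span (exp_pow (U j) (n j)) :: ('v, 'k) mpoly set)}"
    using f by (intro CollectI exI[of _ "\<lambda>j. monom (f j)"]) (simp add: monom_sum monom_in_mon_span_iff)
  then show "monom a \<in> ideal_gen {\<Prod>j\<in>UNIV. f j |f. \<forall>j. f j \<in> (mon_span (exp_pow (U j) (n j)) :: ('v, 'k) mpoly set)}"
    by (rule subsetD[OF ideal_gen_superset])
qed

section \<open>Saturation of monomial ideals\<close>

text \<open>For an up-set \<open>U\<close>, the exponents of the contraction of the localisation at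
  \<open>(X_i : i \<in> A)\<close>: variables outside \<open>A\<close> become units, so only
  coordinates in \<open>A\<close> are compared.\<close>

definition local_exps :: "('v \<Rightarrow>\<^sub>0 nat) set \<Rightarrow> 'v set \<Rightarrow> ('v \<Rightarrow>\<^sub>0 nat) set" where
  "local_exps U A = {a. \<exists>b\<in>U. \<forall>i\<in>A. Poly_Mapping.lookup b i \<le> Poly_Mapping.lookup a i}"

text \<open>The sets \<open>A\<close> of variables such that the prime \<open>(X_i : i \<in> A)\<close> does not contain \<open>J\<close>.\<close>
definition avoiding :: "('v, 'k::field) mpoly set \<Rightarrow> 'v set set" where
  "avoiding J = {A. \<exists>g\<in>J. \<exists>a\<in>Poly_Mapping.keys g. \<forall>i\<in>A. Poly_Mapping.lookup a i = 0}"

text \<open>The variables carry no order, so exponents are transported to lexicographically ordered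
  maps on the naturals. Coordinate 0, which is compared first, holds the degree in \<open>A\<close>;
  the later coordinates hold the exponents themselves and make the map injective.\<close>

lemma exp_order_exists:
  fixes A :: "'v::finite set"
  obtains e :: "('v \<Rightarrow>\<^sub>0 nat) \<Rightarrow> (nat \<Rightarrow>\<^sub>0 nat)" where
    "\<And>a b. e (a + b) = e a + e b" "inj e"
    "\<And>a b. (\<Sum>i\<in>A. Poly_Mapping.lookup a i) < (\<Sum>i\<in>A. Poly_Mapping.lookup b i) \<Longrightarrow> e a < e b"
proof -
  obtain idx :: "'v \<Rightarrow> nat" where idx: "inj idx"
    using finite_imp_inj_to_nat_seg[of "UNIV :: 'v set"] by auto
  define e where "e a = Poly_Mapping.single 0 (\<Sum>i\<in>A. Poly_Mapping.lookup a i) +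
      (\<Sum>i\<in>UNIV. Poly_Mapping.single (Suc (idx i)) (Poly_Mapping.lookup a i))" for a :: "'v \<Rightarrow>\<^sub>0 nat"
  have e0: "Poly_Mapping.lookup (e a) 0 = (\<Sum>i\<in>A. Poly_Mapping.lookup a i)" for a
    by (simp add: e_def lookup_add lookup_sum lookup_single)
  have eS: "Poly_Mapping.lookup (e a) (Suc (idx i)) = Poly_Mapping.lookup a i" for a i
  proof -
    have "Poly_Mapping.lookup (e a) (Suc (idx i)) = (\<Sum>k\<in>UNIV. if k = i then Poly_Mapping.lookup a k else 0)"
      using idx by (auto simp: e_def lookup_add lookup_sum lookup_single when_def inj_eq intro!: sum.cong)
    then show ?thesis by simp
  qed
  show thesis
  proof (rule that[of e])
    show "e (a + b) = e a + e b" for a b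
      by (simp add: e_def lookup_add single_add sum.distrib algebra_simps)
    show "inj e" by (rule injI, rule poly_mapping_eqI) (metis eS)
    show "e a < e b" if "(\<Sum>i\<in>A. Poly_Mapping.lookup a i) < (\<Sum>i\<in>A. Poly_Mapping.lookup b i)" for a b
      unfolding less_poly_mapping.rep_eq less_fun_def using that by (intro exI[of _ 0]) (simp add: e0)
  qed
qed

lemma exists_min_image:
  fixes e :: "'a \<Rightarrow> 'b::linorder"
  assumes "finite S" "S \<noteq> {}"
  obtains a where "a \<in> S" "\<And>b. b \<in> S \<Longrightarrow> e a \<le> e b"
  using assms by (metis arg_min_if_finite(1) arg_min_least)

lemma lookup_mult_unique:
  fixes f g :: "'a::comm_monoid_add \<Rightarrow>\<^sub>0 'b::comm_semiring_0"
  assumes "a \<in> Poly_Mapping.keys f" "b \<in> Poly_Mapping.keys g"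
    and uniq: "\<And>a' b'. a' \<in> Poly_Mapping.keys f \<Longrightarrow> b' \<in> Poly_Mapping.keys g \<Longrightarrow> a' + b' = a + b \<Longrightarrow> a' = a \<and> b' = b"
  shows "Poly_Mapping.lookup (f * g) (a + b) = Poly_Mapping.lookup f a * Poly_Mapping.lookup g b"
proof -
  let ?f = "Poly_Mapping.lookup f" and ?g = "Poly_Mapping.lookup g"
  let ?K = "Poly_Mapping.keys f \<times> Poly_Mapping.keys g"
  have "f * g = (\<Sum>k\<in>Poly_Mapping.keys f. Poly_Mapping.single k (?f k)) *
     (\<Sum>l\<in>Poly_Mapping.keys g. Poly_Mapping.single l (?g l))"
    using poly_mapping_monomials[of f] poly_mapping_monomials[of g] by simp
  also have "\<dots> = (\<Sum>(k, l)\<in>?K. Poly_Mapping.single (k + l) (?f k * ?g l))"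
    by (simp add: sum_product mult_single sum.cartesian_product)
  finally have "Poly_Mapping.lookup (f * g) (a + b) = (\<Sum>(k, l)\<in>?K. (?f k * ?g l when k + l = a + b))"
    by (simp add: lookup_sum lookup_single case_prod_unfold)
  also have "\<dots> = (\<Sum>(k, l)\<in>{(a, b)}. (?f k * ?g l when k + l = a + b))"
    using assms(1,2) by (intro sum.mono_neutral_right) (auto simp: when_def split: if_splits dest: uniq)
  finally show ?thesis by simp
qed

text \<open>The hypothesis on \<open>b\<close> says that \<open>g\<close> lies outside the prime
  \<open>(X_i : i \<in> A)\<close>. The least term \<open>c\<close> of \<open>g\<close> then
  involves no variable of \<open>A\<close>. If \<open>a\<close> is the least term of
  \<open>f\<close> outside \<open>local_exps U A\<close>, any other pair of terms with exponent
  \<open>c + a\<close> would again have its \<open>f\<close>-part outside that set, contradicting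
  minimality. So the term \<open>c + a\<close> survives in the product, yet it lies outside
  \<open>local_exps U A\<close> along with \<open>a\<close>.\<close>

lemma mon_span_local_exps_cancel:
  fixes f g :: "('v::finite, 'k::field) mpoly"
  assumes g: "b \<in> Poly_Mapping.keys g" "\<forall>i\<in>A. Poly_Mapping.lookup b i = 0"
    and fg: "g * f \<in> mon_span (local_exps U A)"
  shows "f \<in> mon_span (local_exps U A)"
proof (rule ccontr)
  obtain e :: "('v \<Rightarrow>\<^sub>0 nat) \<Rightarrow> (nat \<Rightarrow>\<^sub>0 nat)" where e: "\<And>a b. e (a + b) = e a + e b" "inj e"
    "\<And>a b. (\<Sum>i\<in>A. Poly_Mapping.lookup a i) < (\<Sum>i\<in>A. Poly_Mapping.lookup b i) \<Longrightarrow> e a < e b"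
    using exp_order_exists[of A] by metis
  assume "f \<notin> mon_span (local_exps U A)"
  then have "Poly_Mapping.keys f - local_exps U A \<noteq> {}" by (auto simp: mon_span_def)
  then obtain a where a: "a \<in> Poly_Mapping.keys f - local_exps U A"
    "\<And>a'. a' \<in> Poly_Mapping.keys f - local_exps U A \<Longrightarrow> e a \<le> e a'"
    using exists_min_image[of "Poly_Mapping.keys f - local_exps U A" e] by auto
  obtain c where c: "c \<in> Poly_Mapping.keys g" "\<And>c'. c' \<in> Poly_Mapping.keys g \<Longrightarrow> e c \<le> e c'"
    using exists_min_image[of "Poly_Mapping.keys g" e] g(1) by (metis empty_iff finite_keys)
  have "\<not> (\<Sum>i\<in>A. Poly_Mapping.lookup b i) < (\<Sum>i\<in>A. Poly_Mapping.lookup c i)"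
    using e(3)[of b c] c(2)[OF g(1)] by auto
  then have "(\<Sum>i\<in>A. Poly_Mapping.lookup c i) = 0" using g(2) by simp
  then have c0: "Poly_Mapping.lookup c i = 0" if "i \<in> A" for i using that by simp
  have "Poly_Mapping.lookup (g * f) (c + a) = Poly_Mapping.lookup g c * Poly_Mapping.lookup f a"
  proof (rule lookup_mult_unique)
    fix c' a' assume c': "c' \<in> Poly_Mapping.keys g" and a': "a' \<in> Poly_Mapping.keys f" and eq: "c' + a' = c + a"
    have "a' \<notin> local_exps U A"
    proof
      assume "a' \<in> local_exps U A"
      then obtain u where u: "u \<in> U" "\<forall>i\<in>A. Poly_Mapping.lookup u i \<le> Poly_Mapping.lookup a' i"
        by (auto simp: local_exps_def)
      have "Poly_Mapping.lookup a' i \<le> Poly_Mapping.lookup a i" if "i \<in> A" for i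
        using c0[OF that] arg_cong[OF eq, of "\<lambda>m. Poly_Mapping.lookup m i"] by (simp add: lookup_add)
      with u(2) have "\<forall>i\<in>A. Poly_Mapping.lookup u i \<le> Poly_Mapping.lookup a i" by (meson le_trans)
      with u(1) have "a \<in> local_exps U A" unfolding local_exps_def by blast
      with a(1) show False by auto
    qed
    then have "e a \<le> e a'" "e c \<le> e c'" using a(2) a' c(2) c' by auto
    moreover have "e c' + e a' = e c + e a" using arg_cong[OF eq, of e] by (simp add: e(1))
    ultimately have "e a = e a'" "e c = e c'"
      by (metis add_less_le_mono add_le_less_mono antisym_conv2 order_less_irrefl)+
    then show "c' = c \<and> a' = a" using e(2) by (auto dest: injD)
  qed (use a c in auto)
  then have "c + a \<in> Poly_Mapping.keys (g * f)"
    using a(1) c(1) by (auto simp: in_keys_iff)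
  then have "c + a \<in> local_exps U A" using fg by (auto simp: mon_span_def)
  then have "a \<in> local_exps U A" using c0 by (auto simp: local_exps_def lookup_add)
  with a(1) show False by auto
qed

lemma power_in_ideal_pow: "g \<in> J \<Longrightarrow> g ^ k \<in> ideal_pow J k"
proof (induction k)
  case (Suc k)
  then have "g * g ^ k \<in> {x * y |x y. x \<in> J \<and> y \<in> ideal_pow J k}" by blast
  then show ?case unfolding ideal_pow.simps ideal_mult_def power_Suc by (rule subsetD[OF ideal_gen_superset])
qed simp

lemma ideal_mult_mono: "I \<subseteq> I' \<Longrightarrow> J \<subseteq> J' \<Longrightarrow> ideal_mult I J \<subseteq> ideal_mult I' J'"
  unfolding ideal_mult_def
  by (intro ideal_gen_least is_ideal_ideal_gen subset_trans[OF _ ideal_gen_superset]) blast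

lemma ideal_pow_mono: "I \<subseteq> I' \<Longrightarrow> ideal_pow I k \<subseteq> ideal_pow I' k"
  by (induction k) (simp_all add: ideal_mult_mono)

text \<open>One inclusion cancels the factors of \<open>g ^ k\<close> one by one, for a
  \<open>g\<close> in \<open>J\<close> outside the prime given by \<open>A\<close>. For the other, a
  single power of \<open>J\<close> has to serve all terms of \<open>f\<close> and all
  \<open>A\<close>; this rests on the finiteness of the set of variables and a pigeonhole
  estimate.\<close>

lemma saturation_mon_span:
  fixes J :: "('v::finite, 'k::field) mpoly set"
  assumes U: "upset U"
  shows "saturation (mon_span U) J = mon_span {a. \<forall>A\<in>avoiding J. a \<in> local_exps U A}"
proof (intro equalityI subsetI)
  fix f assume "f \<in> saturation (mon_span U) J"
  then obtain k where k: "\<forall>y\<in>ideal_pow J k. y * f \<in> mon_span U" by (auto simp: saturation_def)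
  have "f \<in> mon_span (local_exps U A)" if A: "A \<in> avoiding J" for A
  proof -
    obtain g b where g: "g \<in> J" "b \<in> Poly_Mapping.keys g" "\<forall>i\<in>A. Poly_Mapping.lookup b i = 0"
      using A by (auto simp: avoiding_def)
    have "mon_span U \<subseteq> mon_span (local_exps U A)" by (auto simp: mon_span_def local_exps_def)
    then have "g ^ k * f \<in> mon_span (local_exps U A)" using k power_in_ideal_pow[OF g(1)] by blast
    then show ?thesis
    proof (induction k)
      case (Suc k)
      then show ?case using mon_span_local_exps_cancel[OF g(2,3), of "g ^ k * f" U] by (simp add: mult.assoc)
    qed simp
  qed
  then show "f \<in> mon_span {a. \<forall>A\<in>avoiding J. a \<in> local_exps U A}" by (auto simp: mon_span_def)
next
  fix f :: "('v, 'k) mpoly" assume f: "f \<in> mon_span {a. \<forall>A\<in>avoiding J. a \<in> local_exps U A}"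
  \<comment> \<open>\<open>J\<close> is enlarged to the monomial span of \<open>W\<close>, whose
    powers are visible on exponents. By \<open>anti\<close>, every exponent in \<open>W\<close> has
    a nonzero entry in every set that is not avoiding.\<close>
  define W where "W = {b :: 'v \<Rightarrow>\<^sub>0 nat. {i. Poly_Mapping.lookup b i = 0} \<in> avoiding J}"
  have anti: "A \<in> avoiding J" if "A' \<in> avoiding J" "A \<subseteq> A'" for A A'
    using that by (fastforce simp: avoiding_def)
  have "\<forall>a A. \<exists>u. a \<in> Poly_Mapping.keys f \<and> A \<in> avoiding J \<longrightarrow>
      u \<in> U \<and> (\<forall>i\<in>A. Poly_Mapping.lookup u i \<le> Poly_Mapping.lookup a i)"
  proof (intro allI)
    fix a A
    show "\<exists>u. a \<in> Poly_Mapping.keys f \<and> A \<in> avoiding J \<longrightarrow>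
      u \<in> U \<and> (\<forall>i\<in>A. Poly_Mapping.lookup u i \<le> Poly_Mapping.lookup a i)"
    proof (cases "a \<in> Poly_Mapping.keys f \<and> A \<in> avoiding J")
      case True
      then have "a \<in> local_exps U A" using f by (auto simp: mon_span_def)
      then show ?thesis by (auto simp: local_exps_def)
    qed auto
  qed
  then obtain u where u: "\<And>a A. a \<in> Poly_Mapping.keys f \<Longrightarrow> A \<in> avoiding J \<Longrightarrow> u a A \<in> U"
    "\<And>a A i. a \<in> Poly_Mapping.keys f \<Longrightarrow> A \<in> avoiding J \<Longrightarrow> i \<in> A \<Longrightarrow>
       Poly_Mapping.lookup (u a A) i \<le> Poly_Mapping.lookup a i" by metis
  define N where "N = (\<Sum>(a, A)\<in>Poly_Mapping.keys f \<times> UNIV. \<Sum>i\<in>UNIV. Poly_Mapping.lookup (u a A) i)"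
  have N: "Poly_Mapping.lookup (u a A) i \<le> N" if "a \<in> Poly_Mapping.keys f" for a A i
  proof -
    have "Poly_Mapping.lookup (u a A) i \<le> (\<Sum>i\<in>UNIV. Poly_Mapping.lookup (u a A) i)"
      by (intro member_le_sum) auto
    also have "\<dots> \<le> N" unfolding N_def
      using that member_le_sum[of "(a, A)" "Poly_Mapping.keys f \<times> UNIV"
          "\<lambda>(a, A). \<Sum>i\<in>UNIV. Poly_Mapping.lookup (u a A) i"] by auto
    finally show ?thesis .
  qed
  have JW: "J \<subseteq> mon_span W" unfolding mon_span_def W_def avoiding_def by blast
  have big: "k \<le> (\<Sum>i\<in>A. Poly_Mapping.lookup y i)" if "y \<in> exp_pow W k" "A \<notin> avoiding J" for y k A
    using that(1)
  proof (induction k arbitrary: y)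
    case (Suc k)
    then obtain b z where bz: "y = b + z" "b \<in> W" "z \<in> exp_pow W k" by (auto simp: sumset_def)
    have "\<not> A \<subseteq> {i. Poly_Mapping.lookup b i = 0}" using anti bz(2) that(2) by (auto simp: W_def)
    then obtain i where i: "i \<in> A" "Poly_Mapping.lookup b i \<noteq> 0" by auto
    have "Poly_Mapping.lookup b i \<le> (\<Sum>i\<in>A. Poly_Mapping.lookup b i)" using i by (intro member_le_sum) auto
    then have "1 \<le> (\<Sum>i\<in>A. Poly_Mapping.lookup b i)" using i by linarith
    then show ?case using Suc.IH[OF bz(3)] by (simp add: bz(1) lookup_add sum.distrib)
  qed simp
  \<comment> \<open>If all entries on a set of variables are below \<open>N\<close>, their sum is at
    most \<open>CARD('v) * N\<close>. One more than this contradicts \<open>big\<close> on any set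
    that is not avoiding.\<close>
  define k where "k = Suc (CARD('v) * N)"
  show "f \<in> saturation (mon_span U) J"
    unfolding saturation_def
  proof (intro CollectI exI[of _ k] ballI)
    fix y assume "y \<in> ideal_pow J k"
    then have y: "Poly_Mapping.keys y \<subseteq> exp_pow W k"
      using ideal_pow_mono[OF JW, of k] unfolding ideal_pow_mon_span by (auto simp: mon_span_def)
    have "c + a \<in> U" if c: "c \<in> Poly_Mapping.keys y" and a: "a \<in> Poly_Mapping.keys f" for c a
    proof -
      \<comment> \<open>On \<open>A\<close>, where \<open>c\<close> is small, the witness
        \<open>u a A\<close> is already below \<open>a\<close>; off \<open>A\<close> the exponent
        \<open>c\<close> alone exceeds it, since \<open>N\<close> bounds all witnesses.\<close>
      define A where "A = {i. Poly_Mapping.lookup c i < N}"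
      have "A \<in> avoiding J"
      proof (rule ccontr)
        assume "A \<notin> avoiding J"
        with big y c have "k \<le> (\<Sum>i\<in>A. Poly_Mapping.lookup c i)" by blast
        also have "\<dots> \<le> (\<Sum>i\<in>A. N)" by (intro sum_mono) (auto simp: A_def)
        also have "\<dots> \<le> CARD('v) * N" by (simp add: card_mono)
        finally show False by (simp add: k_def)
      qed
      have "Poly_Mapping.lookup (u a A) i \<le> Poly_Mapping.lookup (c + a) i" for i
      proof (cases "i \<in> A")
        case True
        then show ?thesis using u(2)[OF a \<open>A \<in> avoiding J\<close> True] by (simp add: lookup_add)
      next
        case False
        then show ?thesis using N[OF a, of A i] by (simp add: A_def lookup_add)
      qed
      then show ?thesis using upsetD[OF U u(1)[OF a \<open>A \<in> avoiding J\<close>]] by blast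
    qed
    then show "y * f \<in> mon_span U" using keys_mult[of y f] by (fastforce simp: mon_span_def)
  qed
qed

lemma avoiding_max_ideal: "avoiding (max_ideal :: ('v, 'k::field) mpoly set) = {A. A \<noteq> UNIV}"
proof (intro equalityI subsetI)
  fix A :: "'v set" assume "A \<in> {A. A \<noteq> UNIV}"
  then obtain i where i: "i \<notin> A" by auto
  have "Var i \<in> (max_ideal :: ('v, 'k) mpoly set)" unfolding max_ideal_def by (rule subsetD[OF ideal_gen_superset rangeI])
  moreover have "Poly_Mapping.single i 1 \<in> Poly_Mapping.keys (Var i :: ('v, 'k) mpoly)"
    by (simp add: Var_def monom_def)
  moreover have "\<forall>k\<in>A. Poly_Mapping.lookup (Poly_Mapping.single i (1::nat)) k = 0"
    using i by (auto simp: lookup_single when_def)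
  ultimately show "A \<in> avoiding (max_ideal :: ('v, 'k) mpoly set)" unfolding avoiding_def by blast
next
  fix A assume "A \<in> avoiding (max_ideal :: ('v, 'k) mpoly set)"
  then obtain g :: "('v, 'k) mpoly" and a where g: "g \<in> max_ideal" "a \<in> Poly_Mapping.keys g"
    "\<forall>i\<in>A. Poly_Mapping.lookup a i = 0" by (auto simp: avoiding_def)
  have up: "upset {a :: 'v \<Rightarrow>\<^sub>0 nat. a \<noteq> 0}"
    by (auto simp: upset_def poly_mapping_eq_iff lookup_add fun_eq_iff)
  have "Poly_Mapping.single i (1::nat) \<noteq> 0" for i :: 'v
    by (metis lookup_single_eq lookup_zero one_neq_zero)
  then have "range Var \<subseteq> (mon_span {a. a \<noteq> 0} :: ('v, 'k) mpoly set)"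
    by (auto simp: Var_def monom_in_mon_span_iff)
  then have "max_ideal \<subseteq> (mon_span {a. a \<noteq> 0} :: ('v, 'k) mpoly set)"
    unfolding max_ideal_def by (intro ideal_gen_least is_ideal_mon_span up)
  then have "a \<noteq> 0" using g by (auto simp: mon_span_def)
  then obtain i where "Poly_Mapping.lookup a i \<noteq> 0" by (auto simp: poly_mapping_eq_iff fun_eq_iff)
  then show "A \<in> {A. A \<noteq> UNIV}" using g(3) by auto
qed

section \<open>Length of quotients of monomial ideals\<close>

text \<open>Pivot positions of \<open>L\<close> modulo \<open>mon_span U\<close>, in the sense of an
  echelon form with the least exponent outside \<open>U\<close> as the pivot.\<close>

definition initial_exps :: "(('v \<Rightarrow>\<^sub>0 nat) \<Rightarrow> 'o::linorder) \<Rightarrow> ('v \<Rightarrow>\<^sub>0 nat) set \<Rightarrow>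
    ('v, 'k::field) mpoly set \<Rightarrow> ('v \<Rightarrow>\<^sub>0 nat) set" where
  "initial_exps e U L = {a. \<exists>f\<in>L. a \<in> Poly_Mapping.keys f - U \<and> (\<forall>b\<in>Poly_Mapping.keys f - U. e a \<le> e b)}"

text \<open>With equal pivots, each \<open>f\<close> in \<open>L'\<close> reduces to an element of
  \<open>L\<close>: cancelling its least term outside \<open>U\<close> by an element of
  \<open>L\<close> moves that term strictly up within the finite set \<open>V - U\<close>. The
  induction measure counts the elements of \<open>V - U\<close> at or above it.\<close>

lemma initial_exps_strict_mono:
  fixes L L' :: "('v::finite, 'k::field) mpoly set" and e :: "('v \<Rightarrow>\<^sub>0 nat) \<Rightarrow> 'o::linorder"
  assumes e: "inj e" and fin: "finite (V - U)" and L: "is_ideal L" "is_ideal L'" "L \<subset> L'"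
    and UV: "mon_span U \<subseteq> L" "L' \<subseteq> mon_span V"
  shows "initial_exps e U L \<subset> initial_exps e U L'"
proof -
  have sub: "initial_exps e U L \<subseteq> initial_exps e U L'" using L(3) unfolding initial_exps_def by blast
  have "L' \<subseteq> L" if eq: "initial_exps e U L' \<subseteq> initial_exps e U L"
  proof
    fix f assume "f \<in> L'"
    then show "f \<in> L"
    proof (induction "card {b\<in>V - U. \<exists>a\<in>Poly_Mapping.keys f - U. e a \<le> e b}" arbitrary: f rule: less_induct)
      case less
      show ?case
      proof (cases "Poly_Mapping.keys f - U = {}")
        case True
        then show ?thesis using UV(1) by (auto simp: mon_span_def)
      next
        case False
        obtain a where a: "a \<in> Poly_Mapping.keys f - U" "\<And>b. b \<in> Poly_Mapping.keys f - U \<Longrightarrow> e a \<le> e b"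
          using exists_min_image[of "Poly_Mapping.keys f - U" e] False by auto
        then have "a \<in> initial_exps e U L'" using less.prems unfolding initial_exps_def by blast
        then have "a \<in> initial_exps e U L" using eq by auto
        then obtain g where g: "g \<in> L" "a \<in> Poly_Mapping.keys g - U" "\<forall>b\<in>Poly_Mapping.keys g - U. e a \<le> e b"
          unfolding initial_exps_def by blast
        define c where "c = Poly_Mapping.lookup f a / Poly_Mapping.lookup g a"
        define h where "h = Poly_Mapping.single 0 (- c) * g"
        define f' where "f' = f + h"
        have lookup_h: "Poly_Mapping.lookup h b = - c * Poly_Mapping.lookup g b" for b
          unfolding h_def mult_map_scale_conv_mult[symmetric] by (simp add: map.rep_eq when_def)
        have hL: "h \<in> L" using g(1) L(1) by (auto simp: h_def is_ideal_def)
        have f'L': "f' \<in> L'" using hL L less.prems by (auto simp: f'_def is_ideal_def)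
        have f'a: "Poly_Mapping.lookup f' a = 0"
          using g(2) by (simp add: f'_def lookup_add lookup_h c_def in_keys_iff)
        have gt: "e a < e b" if "b \<in> Poly_Mapping.keys f' - U" for b
        proof -
          have "b \<noteq> a" using that f'a by (auto simp: in_keys_iff)
          then have "e b \<noteq> e a" using e by (auto dest: injD)
          moreover have "b \<in> Poly_Mapping.keys f \<or> b \<in> Poly_Mapping.keys g"
            using that by (auto simp: f'_def in_keys_iff lookup_add lookup_h)
          then have "e a \<le> e b" using a(2) g(3) that by auto
          ultimately show ?thesis by auto
        qed
        have "card {b\<in>V - U. \<exists>a\<in>Poly_Mapping.keys f' - U. e a \<le> e b} <
              card {b\<in>V - U. \<exists>a\<in>Poly_Mapping.keys f - U. e a \<le> e b}"
        proof (rule psubset_card_mono)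
          have "a \<in> V - U" using a(1) less.prems UV(2) by (auto simp: mon_span_def)
          then have "a \<in> {b\<in>V - U. \<exists>a\<in>Poly_Mapping.keys f - U. e a \<le> e b}" using a(1) by auto
          moreover have "a \<notin> {b\<in>V - U. \<exists>a\<in>Poly_Mapping.keys f' - U. e a \<le> e b}" using gt by force
          moreover have "{b\<in>V - U. \<exists>a\<in>Poly_Mapping.keys f' - U. e a \<le> e b} \<subseteq>
              {b\<in>V - U. \<exists>a\<in>Poly_Mapping.keys f - U. e a \<le> e b}"
            using gt a(1) by (auto intro: less_imp_le less_le_trans)
          ultimately show "{b\<in>V - U. \<exists>a\<in>Poly_Mapping.keys f' - U. e a \<le> e b} \<subset>
              {b\<in>V - U. \<exists>a\<in>Poly_Mapping.keys f - U. e a \<le> e b}" by blast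
        qed (rule finite_subset[OF _ fin], blast)
        then have "f' \<in> L" using f'L' by (rule less.hyps)
        moreover have "- 1 * h \<in> L" using hL L(1) unfolding is_ideal_def by blast
        ultimately have "f' + - 1 * h \<in> L" using L(1) unfolding is_ideal_def by blast
        then show ?thesis by (simp add: f'_def)
      qed
    qed
  qed
  with sub L(3) show ?thesis by blast
qed

lemma chain_mono:
  assumes "\<forall>i<n. L i \<subset> L (Suc i)" "i \<le> j" "j \<le> (n::nat)"
  shows "L i \<subseteq> (L j :: 'a set)"
  using assms(2,3)
proof (induction j rule: dec_induct)
  case (step j)
  then have "L i \<subseteq> L j" "L j \<subset> L (Suc j)" using assms(1) by auto
  then show ?case by auto
qed simp

text \<open>An element of \<open>V - U\<close> of largest total degree can be adjoined to
  \<open>U\<close> without losing the up-set property: its proper multiples lie in \<open>V\<close>,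
  have larger degree, and so are in \<open>U\<close> already.\<close>

lemma mon_span_chain_exists:
  assumes "finite (V - U)" "upset U" "upset V" "U \<subseteq> V"
  shows "\<exists>L :: nat \<Rightarrow> ('v::finite, 'k::field) mpoly set. L 0 = mon_span U \<and> L (card (V - U)) = mon_span V \<and>
     (\<forall>i\<le>card (V - U). is_ideal (L i)) \<and> (\<forall>i<card (V - U). L i \<subset> L (Suc i))"
  using assms
proof (induction "card (V - U)" arbitrary: U)
  case 0
  then have "V = U" by auto
  then show ?case using is_ideal_mon_span[OF \<open>upset U\<close>] by (intro exI[of _ "\<lambda>_. mon_span U"]) auto
next
  case (Suc m)
  let ?deg = "\<lambda>a. \<Sum>i\<in>UNIV. Poly_Mapping.lookup a i"
  have "V - U \<noteq> {}" using Suc.hyps(2) by (metis card.empty nat.distinct(1))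
  then obtain a where a: "a \<in> V - U" "\<And>b. b \<in> V - U \<Longrightarrow> - int (?deg a) \<le> - int (?deg b)"
    using exists_min_image[of "V - U" "\<lambda>a. - int (?deg a)"] Suc.prems(1) by auto
  have up: "upset (insert a U)"
    unfolding upset_def
  proof (intro ballI allI)
    fix b c assume b: "b \<in> insert a U"
    show "b + c \<in> insert a U"
    proof (cases "b \<in> U")
      case True
      then show ?thesis using Suc.prems(2) by (auto simp: upset_def)
    next
      case False
      then have ba: "b = a" using b by simp
      show ?thesis
      proof (cases "c = 0")
        case False
        then obtain i where "Poly_Mapping.lookup c i \<noteq> 0" by (auto simp: poly_mapping_eq_iff fun_eq_iff)
        moreover have "Poly_Mapping.lookup c i \<le> ?deg c" by (intro member_le_sum) auto
        ultimately have "?deg (a + c) > ?deg a" by (simp add: lookup_add sum.distrib)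
        then have "a + c \<notin> V - U" using a(2)[of "a + c"] by (auto simp del: of_nat_sum)
        moreover have "a + c \<in> V" using a(1) Suc.prems(3) by (auto simp: upset_def)
        ultimately show ?thesis by (simp add: ba)
      qed (simp add: ba)
    qed
  qed
  have eq: "V - insert a U = (V - U) - {a}" by auto
  have m: "m = card (V - insert a U)" using Suc.hyps(2) a(1) Suc.prems(1) unfolding eq by simp
  have "\<exists>L :: nat \<Rightarrow> ('v, 'k) mpoly set. L 0 = mon_span (insert a U) \<and> L (card (V - insert a U)) = mon_span V \<and>
     (\<forall>i\<le>card (V - insert a U). is_ideal (L i)) \<and> (\<forall>i<card (V - insert a U). L i \<subset> L (Suc i))"
    using Suc.prems a(1) by (intro Suc.hyps(1) m up) auto
  then obtain L :: "nat \<Rightarrow> ('v, 'k) mpoly set" where L: "L 0 = mon_span (insert a U)" "L m = mon_span V"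
    "\<forall>i\<le>m. is_ideal (L i)" "\<forall>i<m. L i \<subset> L (Suc i)" unfolding m[symmetric] by (elim exE conjE) (rule that)
  have "monom a \<in> (mon_span (insert a U) :: ('v, 'k) mpoly set)" "monom a \<notin> (mon_span U :: ('v, 'k) mpoly set)"
    using a(1) by (simp_all add: monom_in_mon_span_iff)
  moreover have "mon_span U \<subseteq> (mon_span (insert a U) :: ('v, 'k) mpoly set)" by (auto simp: mon_span_def)
  ultimately have strict: "mon_span U \<subset> L 0" unfolding L(1) by blast
  show ?case unfolding Suc.hyps(2)[symmetric]
  proof (intro exI[of _ "\<lambda>i. case i of 0 \<Rightarrow> mon_span U | Suc i \<Rightarrow> L i"] conjI allI impI)
    fix i assume "i \<le> Suc m"
    then show "is_ideal (case i of 0 \<Rightarrow> mon_span U | Suc i \<Rightarrow> L i)"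
      using L(3) is_ideal_mon_span[OF \<open>upset U\<close>] by (cases i) auto
  next
    fix i assume "i < Suc m"
    then show "(case i of 0 \<Rightarrow> mon_span U | Suc i \<Rightarrow> L i) \<subset> (case Suc i of 0 \<Rightarrow> mon_span U | Suc i \<Rightarrow> L i)"
      using L(4) strict by (cases i) auto
  qed (simp_all add: L(2))
qed

text \<open>In a strict chain the pivot sets grow strictly inside \<open>V - U\<close>, which bounds
  its length; adding monomials one at a time attains the bound. Only the injectivity of
  \<open>e\<close> matters here, so the order is taken with \<open>A = {}\<close>.\<close>

theorem quot_length_mon_span:
  assumes "finite (V - U)" "upset U" "upset V" "U \<subseteq> V"
  shows "quot_length (mon_span U) (mon_span V :: ('v::finite, 'k::field) mpoly set) = enat (card (V - U))"
proof (rule antisym)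
  obtain e :: "('v \<Rightarrow>\<^sub>0 nat) \<Rightarrow> (nat \<Rightarrow>\<^sub>0 nat)" where e: "inj e"
    using exp_order_exists[of "{} :: 'v set"] by metis
  show "quot_length (mon_span U) (mon_span V :: ('v, 'k) mpoly set) \<le> enat (card (V - U))"
    unfolding quot_length_def
  proof (rule Sup_least, clarify)
    fix n and L :: "nat \<Rightarrow> ('v, 'k) mpoly set"
    assume L: "L 0 = mon_span U" "L n = mon_span V" "\<forall>i\<le>n. is_ideal (L i)" "\<forall>i<n. L i \<subset> L (Suc i)"
    have sub: "initial_exps e U (L i) \<subseteq> V - U" if "i \<le> n" for i
      using chain_mono[OF L(4) that] L(2) unfolding initial_exps_def mon_span_def by fastforce
    have "i \<le> n \<Longrightarrow> i \<le> card (initial_exps e U (L i))" for i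
    proof (induction i)
      case (Suc i)
      have "initial_exps e U (L i) \<subset> initial_exps e U (L (Suc i))"
        using Suc.prems L chain_mono[OF L(4), of 0 i] chain_mono[OF L(4), of "Suc i" n]
        by (intro initial_exps_strict_mono[OF e assms(1)]) auto
      then have "card (initial_exps e U (L i)) < card (initial_exps e U (L (Suc i)))"
        using finite_subset[OF sub assms(1)] Suc.prems by (intro psubset_card_mono) auto
      then show ?case using Suc by auto
    qed simp
    from this[of n] have "n \<le> card (V - U)" using card_mono[OF assms(1) sub[of n]] by simp
    then show "enat n \<le> enat (card (V - U))" by simp
  qed
  show "enat (card (V - U)) \<le> quot_length (mon_span U) (mon_span V :: ('v, 'k) mpoly set)"
    unfolding quot_length_def using mon_span_chain_exists[OF assms, where 'k = 'k] by (intro Sup_upper) blast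
qed

section \<open>The monoids of exponents\<close>

lemma monomial_ideal_finite:
  fixes I :: "('v::finite, 'k::field) mpoly set"
  assumes "monomial_ideal I"
  shows "\<exists>B. finite B \<and> I = mon_span (sumset B UNIV)"
proof -
  obtain W where W: "I = mon_span (sumset W UNIV)" using monomial_ideal_mon_span[OF assms] by auto
  obtain B where B: "B \<subseteq> W" "finite B" "\<forall>w\<in>W. \<exists>b\<in>B. \<forall>i\<in>UNIV. Poly_Mapping.lookup b i \<le> Poly_Mapping.lookup w i"
    using dickson[OF finite_class.finite_UNIV, of W "Poly_Mapping.lookup"] by (elim exE conjE) (rule that)
  have "sumset W UNIV \<subseteq> sumset B UNIV"
  proof
    fix a assume "a \<in> sumset W UNIV"
    then obtain w c where w: "a = w + c" "w \<in> W" by (auto simp: sumset_def)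
    then obtain b where b: "b \<in> B" "exp_le b w" using B(3) by auto
    have "a = b + ((w - b) + c)" using exp_le_add[OF b(2)] w(1) by (simp add: add.assoc[symmetric])
    then show "a \<in> sumset B UNIV" using b(1) unfolding sumset_def by blast
  qed
  moreover have "sumset B UNIV \<subseteq> sumset W UNIV" using B(1) unfolding sumset_def by blast
  ultimately show ?thesis using W B(2) by (intro exI[of _ B]) auto
qed

definition power_gens :: "('r \<Rightarrow> ('v \<Rightarrow>\<^sub>0 nat) set) \<Rightarrow> (('v \<Rightarrow>\<^sub>0 nat) \<times> ('r \<Rightarrow>\<^sub>0 nat)) set" where
  "power_gens B = (\<Union>j. (\<lambda>g. (g, Poly_Mapping.single j 1)) ` B j)"

text \<open>For \<open>T = power_gens B\<close> the fibre over \<open>n\<close> consists of the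
  localised exponents of the power with exponent \<open>n\<close>. The case \<open>A = UNIV\<close>
  is the exponent monoid of the ordinary multi-Rees algebra.\<close>

definition local_monoid :: "(('v \<Rightarrow>\<^sub>0 nat) \<times> ('r \<Rightarrow>\<^sub>0 nat)) set \<Rightarrow> 'v set \<Rightarrow>
    (('v \<Rightarrow>\<^sub>0 nat) \<times> ('r \<Rightarrow>\<^sub>0 nat)) set" where
  "local_monoid T A = {(a, n). \<exists>b. (b, n) \<in> mgen T \<and> (\<forall>i\<in>A. Poly_Mapping.lookup b i \<le> Poly_Mapping.lookup a i)}"

lemma poly_mapping_sum_UNIV:
  fixes a :: "'v::finite \<Rightarrow>\<^sub>0 nat"
  shows "(\<Sum>i\<in>UNIV. Poly_Mapping.single i (Poly_Mapping.lookup a i)) = a"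
  by (rule poly_mapping_eqI) (simp add: lookup_sum lookup_single when_def)

lemma exp_pow_add:
  assumes "a \<in> exp_pow U k" "b \<in> exp_pow U l"
  shows "a + b \<in> exp_pow U (k + l)"
  using assms(1)
proof (induction k arbitrary: a)
  case 0
  then show ?case using assms(2) upset_exp_pow[of U l] by (auto simp: upset_def add.commute[of a])
next
  case (Suc k)
  then obtain u c where "a = u + c" "u \<in> U" "c \<in> exp_pow U k" by (auto simp: sumset_def)
  then show ?case using Suc.IH[of c] by (auto simp: sumset_def add.assoc)
qed

text \<open>In a sum of elements of \<open>power_gens B\<close> the second component counts the
  factors taken from each ideal. So the fibre over \<open>n\<close> consists of the products with
  the prescribed number of generators from every ideal, and these generate the product of the
  powers.\<close>

lemma exp_multipow_iff:
  fixes B :: "'r::finite \<Rightarrow> ('v::finite \<Rightarrow>\<^sub>0 nat) set"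
  shows "a \<in> exp_multipow (\<lambda>j. sumset (B j) UNIV) (Poly_Mapping.lookup n) \<longleftrightarrow>
    (\<exists>b. (b, n) \<in> mgen (power_gens B) \<and> exp_le b a)"
proof
  let ?U = "\<lambda>j. sumset (B j) UNIV"
  assume "a \<in> exp_multipow ?U (Poly_Mapping.lookup n)"
  then obtain f where f: "a = (\<Sum>j\<in>UNIV. f j)" "\<forall>j. f j \<in> exp_pow (?U j) (Poly_Mapping.lookup n j)"
    by (auto simp: exp_multipow_def)
  have "\<exists>b. (b, Poly_Mapping.single j k) \<in> mgen (power_gens B) \<and> exp_le b c" if "c \<in> exp_pow (?U j) k" for c j k
    using that
  proof (induction k arbitrary: c)
    case 0
    then show ?case using mgen_0[of "power_gens B"] by (intro exI[of _ 0]) (auto simp: zero_prod_def)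
  next
    case (Suc k)
    then obtain g d e where gde: "c = (g + d) + e" "g \<in> B j" "e \<in> exp_pow (?U j) k" by (auto simp: sumset_def)
    obtain b where b: "(b, Poly_Mapping.single j k) \<in> mgen (power_gens B)" "exp_le b e" using Suc.IH[OF gde(3)] by auto
    have "(g, Poly_Mapping.single j 1) \<in> mgen (power_gens B)"
      using gde(2) by (intro mgen_base) (auto simp: power_gens_def)
    from mgen_add[OF this b(1)] have "(g + b, Poly_Mapping.single j (Suc k)) \<in> mgen (power_gens B)"
      by (simp add: single_add[symmetric])
    moreover have "exp_le (g + b) c" using b(2) by (simp add: gde(1) lookup_add add_mono trans_le_add1)
    ultimately show ?case by blast
  qed
  then have "\<forall>j. \<exists>b. (b, Poly_Mapping.single j (Poly_Mapping.lookup n j)) \<in> mgen (power_gens B) \<and> exp_le b (f j)"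
    using f(2) by blast
  then obtain b where b: "\<And>j. (b j, Poly_Mapping.single j (Poly_Mapping.lookup n j)) \<in> mgen (power_gens B)"
    "\<And>j. exp_le (b j) (f j)" by metis
  have "(\<Sum>j\<in>UNIV. (b j, Poly_Mapping.single j (Poly_Mapping.lookup n j))) \<in> mgen (power_gens B)"
    by (intro mgen_sum b)
  then have "(\<Sum>j\<in>UNIV. b j, n) \<in> mgen (power_gens B)"
    by (simp add: sum_prod poly_mapping_sum_UNIV)
  moreover have "exp_le (\<Sum>j\<in>UNIV. b j) a"
    using b(2) by (auto simp: f(1) lookup_sum intro: sum_mono)
  ultimately show "\<exists>b. (b, n) \<in> mgen (power_gens B) \<and> exp_le b a" by blast
next
  let ?U = "\<lambda>j. sumset (B j) UNIV"
  have "fst x \<in> exp_multipow ?U (Poly_Mapping.lookup (snd x))" if "x \<in> mgen (power_gens B)" for x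
    using that
  proof (induction rule: mgen_induct)
    case (base x)
    then obtain j g where x: "x = (g, Poly_Mapping.single j 1)" "g \<in> B j" by (auto simp: power_gens_def)
    have "g \<in> sumset (B j) UNIV" using x(2) unfolding sumset_def by (intro CollectI exI[of _ g] exI[of _ 0]) auto
    then have "g \<in> exp_pow (?U j) 1"
      using sumset_def[of "?U j" UNIV] by (simp, intro CollectI exI[of _ g] exI[of _ 0]) auto
    then have "\<forall>k. (if k = j then g else 0) \<in> exp_pow (?U k) (Poly_Mapping.lookup (Poly_Mapping.single j 1) k)"
      by (auto simp: lookup_single when_def)
    moreover have "g = (\<Sum>k\<in>UNIV. if k = j then g else 0)" by simp
    ultimately show ?case unfolding x exp_multipow_def fst_conv snd_conv
      by (intro CollectI exI[of _ "\<lambda>k. if k = j then g else 0"] conjI)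
  next
    case zero
    show ?case by (auto simp: exp_multipow_def intro!: exI[of _ "\<lambda>_. 0"])
  next
    case (add x y)
    obtain f where f: "fst x = (\<Sum>j\<in>UNIV. f j)" "\<forall>j. f j \<in> exp_pow (?U j) (Poly_Mapping.lookup (snd x) j)"
      using add.IH(1) by (auto simp: exp_multipow_def)
    obtain g where g: "fst y = (\<Sum>j\<in>UNIV. g j)" "\<forall>j. g j \<in> exp_pow (?U j) (Poly_Mapping.lookup (snd y) j)"
      using add.IH(2) by (auto simp: exp_multipow_def)
    have "\<forall>j. f j + g j \<in> exp_pow (?U j) (Poly_Mapping.lookup (snd (x + y)) j)"
      using f(2) g(2) by (simp add: lookup_add exp_pow_add)
    moreover have "fst (x + y) = (\<Sum>j\<in>UNIV. f j + g j)" by (simp add: f(1) g(1) sum.distrib)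
    ultimately show ?case unfolding exp_multipow_def by (intro CollectI exI[of _ "\<lambda>j. f j + g j"] conjI)
  qed
  then have *: "b \<in> exp_multipow ?U (Poly_Mapping.lookup n)" if "(b, n) \<in> mgen (power_gens B)" for b
    using that by fastforce
  assume "\<exists>b. (b, n) \<in> mgen (power_gens B) \<and> exp_le b a"
  then show "a \<in> exp_multipow ?U (Poly_Mapping.lookup n)"
    using upsetD[OF upset_exp_multipow *] by blast
qed

lemma local_exps_exp_multipow:
  fixes B :: "'r::finite \<Rightarrow> ('v::finite \<Rightarrow>\<^sub>0 nat) set"
  shows "a \<in> local_exps (exp_multipow (\<lambda>j. sumset (B j) UNIV) (Poly_Mapping.lookup n)) A \<longleftrightarrow>
    (a, n) \<in> local_monoid (power_gens B) A"
  unfolding local_exps_def local_monoid_def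
proof (simp only: mem_Collect_eq case_prod_conv Bex_def exp_multipow_iff, intro iffI)
  assume "\<exists>x. (\<exists>b. (b, n) \<in> mgen (power_gens B) \<and> exp_le b x) \<and>
    (\<forall>i\<in>A. Poly_Mapping.lookup x i \<le> Poly_Mapping.lookup a i)"
  then show "\<exists>b. (b, n) \<in> mgen (power_gens B) \<and> (\<forall>i\<in>A. Poly_Mapping.lookup b i \<le> Poly_Mapping.lookup a i)"
    by (meson le_trans)
qed blast

definition var_gens :: "(('v \<Rightarrow>\<^sub>0 nat) \<times> ('r \<Rightarrow>\<^sub>0 nat)) set" where
  "var_gens = range (\<lambda>i. (Poly_Mapping.single i 1, 0))"

lemma mgen_single: "(Poly_Mapping.single i k, 0) \<in> mgen var_gens"
proof (induction k)
  case 0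
  show ?case using mgen_0[of var_gens] by (simp add: zero_prod_def)
next
  case (Suc k)
  have "(Poly_Mapping.single i 1, 0) \<in> mgen var_gens" by (intro mgen_base) (simp add: var_gens_def)
  from mgen_add[OF this Suc] show ?case by (simp add: single_add[symmetric])
qed

lemma mgen_var_gens: "((a :: 'v::finite \<Rightarrow>\<^sub>0 nat), 0) \<in> mgen var_gens"
proof -
  have "(\<Sum>i\<in>UNIV. (Poly_Mapping.single i (Poly_Mapping.lookup a i), 0)) \<in> mgen var_gens"
    by (intro mgen_sum mgen_single)
  then show ?thesis by (simp add: sum_prod poly_mapping_sum_UNIV)
qed

lemma fg_monoid_UNIV: "fg_monoid (UNIV :: (('v::finite \<Rightarrow>\<^sub>0 nat) \<times> ('r::finite \<Rightarrow>\<^sub>0 nat)) set)"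
proof -
  let ?S = "var_gens \<union> prod.swap ` var_gens :: (('v \<Rightarrow>\<^sub>0 nat) \<times> ('r \<Rightarrow>\<^sub>0 nat)) set"
  have "(a, n) \<in> mgen ?S" for a n
  proof -
    have "prod.swap x \<in> mgen ?S" if "x \<in> mgen var_gens" for x :: "('r \<Rightarrow>\<^sub>0 nat) \<times> ('v \<Rightarrow>\<^sub>0 nat)"
      using that
    proof (induction rule: mgen_induct)
      case (add x y)
      have "prod.swap (x + y) = prod.swap x + prod.swap y" by (simp add: prod_eq_iff)
      then show ?case using add mgen_add by simp
    qed (auto intro: mgen_base mgen_0 simp: zero_prod_def[symmetric] prod.swap_def)
    from this[OF mgen_var_gens[of n]] have "(0, n) \<in> mgen ?S" by simp
    moreover have "(a, 0) \<in> mgen ?S" using mgen_var_gens[of a] mgen_mono[of var_gens ?S] by blast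
    ultimately show ?thesis using mgen_add[of "(a, 0)" ?S "(0, n)"] by simp
  qed
  then have "UNIV = mgen ?S" by auto
  moreover have "finite ?S" by (simp add: var_gens_def)
  ultimately show ?thesis unfolding fg_monoid_def by blast
qed

lemma local_monoid_add:
  assumes "x \<in> local_monoid T A" "y \<in> local_monoid T A"
  shows "x + y \<in> local_monoid T A"
proof -
  obtain a n b where x: "x = (a, n)" "(b, n) \<in> mgen T" "\<forall>i\<in>A. Poly_Mapping.lookup b i \<le> Poly_Mapping.lookup a i"
    using assms(1) by (auto simp: local_monoid_def)
  obtain a' n' b' where y: "y = (a', n')" "(b', n') \<in> mgen T" "\<forall>i\<in>A. Poly_Mapping.lookup b' i \<le> Poly_Mapping.lookup a' i"
    using assms(2) by (auto simp: local_monoid_def)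
  have "(b + b', n + n') \<in> mgen T" using mgen_add[OF x(2) y(2)] by simp
  moreover have "\<forall>i\<in>A. Poly_Mapping.lookup (b + b') i \<le> Poly_Mapping.lookup (a + a') i"
    using x(3) y(3) by (auto simp: lookup_add intro: add_mono)
  ultimately show ?thesis by (auto simp: local_monoid_def x(1) y(1))
qed

lemma zero_local_monoid: "(a, 0) \<in> local_monoid T A"
  using mgen_0[of T] by (auto simp: local_monoid_def zero_prod_def intro!: exI[of _ 0])

text \<open>Erasing the coordinates outside \<open>A\<close> by \<open>\<rho>\<close> gives the
  smallest representatives: \<open>(a, n) = (\<rho> b, n) + (a - \<rho> b, 0)\<close>. The erased
  generators of \<open>T\<close> together with the variables therefore suffice.\<close>

lemma fg_local_monoid:
  fixes T :: "(('v::finite \<Rightarrow>\<^sub>0 nat) \<times> ('r::finite \<Rightarrow>\<^sub>0 nat)) set"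
  assumes "finite T"
  shows "fg_monoid (local_monoid T A)"
proof -
  define \<rho> where "\<rho> a = (\<Sum>i\<in>A. Poly_Mapping.single i (Poly_Mapping.lookup a i))" for a :: "'v \<Rightarrow>\<^sub>0 nat"
  have lookup_\<rho>: "Poly_Mapping.lookup (\<rho> a) i = (if i \<in> A then Poly_Mapping.lookup a i else 0)" for a i
    by (simp add: \<rho>_def lookup_sum lookup_single when_def)
  have \<rho>_add: "\<rho> (a + b) = \<rho> a + \<rho> b" for a b
    by (rule poly_mapping_eqI) (simp add: lookup_\<rho> lookup_add)
  have \<rho>_0: "\<rho> 0 = 0" by (rule poly_mapping_eqI) (simp add: lookup_\<rho>)
  let ?S = "(\<lambda>x. (\<rho> (fst x), snd x)) ` T \<union> var_gens"
  have "local_monoid T A = mgen ?S"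
  proof
    show "mgen ?S \<subseteq> local_monoid T A"
    proof (rule mgen_least)
      have "(\<rho> g, n) \<in> local_monoid T A" if "(g, n) \<in> T" for g n
        using mgen_base[OF that] by (auto simp: local_monoid_def lookup_\<rho>)
      then show "?S \<subseteq> local_monoid T A"
        by (auto simp: var_gens_def zero_local_monoid)
      show "0 \<in> local_monoid T A" using zero_local_monoid[of 0 T A] by (simp add: zero_prod_def)
    qed (rule local_monoid_add)
    have \<rho>T: "(\<rho> (fst x), snd x) \<in> mgen ?S" if "x \<in> mgen T" for x
      using that
    proof (induction rule: mgen_induct)
      case (base x)
      then show ?case by (intro mgen_base) auto
    next
      case zero
      then show ?case using mgen_0[of ?S] by (simp add: \<rho>_0 zero_prod_def)
    next
      case (add x y)
      from mgen_add[OF add.IH] show ?case by (simp add: \<rho>_add)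
    qed
    show "local_monoid T A \<subseteq> mgen ?S"
    proof
      fix x assume "x \<in> local_monoid T A"
      then obtain a n b where x: "x = (a, n)" "(b, n) \<in> mgen T" "\<forall>i\<in>A. Poly_Mapping.lookup b i \<le> Poly_Mapping.lookup a i"
        by (auto simp: local_monoid_def)
      have "exp_le (\<rho> b) a" using x(3) by (simp add: lookup_\<rho>)
      from exp_le_add[OF this] have "x = (\<rho> b, n) + (a - \<rho> b, 0)" by (simp add: x(1))
      moreover have "(\<rho> b, n) \<in> mgen ?S" using \<rho>T[OF x(2)] by simp
      moreover have "(a - \<rho> b, 0) \<in> mgen ?S"
        using mgen_var_gens[of "a - \<rho> b"] mgen_mono[of var_gens ?S] by blast
      ultimately show "x \<in> mgen ?S" by (simp only: mgen_add)
    qed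
  qed
  moreover have "finite ?S" using assms by (simp add: var_gens_def)
  ultimately show ?thesis unfolding fg_monoid_def by blast
qed

definition sat_monoid :: "(('v \<Rightarrow>\<^sub>0 nat) \<times> ('r \<Rightarrow>\<^sub>0 nat)) set \<Rightarrow> 'v set set \<Rightarrow>
    (('v \<Rightarrow>\<^sub>0 nat) \<times> ('r \<Rightarrow>\<^sub>0 nat)) set" where
  "sat_monoid T AA = (\<Inter>A\<in>AA. local_monoid T A)"

lemma fg_sat_monoid:
  fixes T :: "(('v::finite \<Rightarrow>\<^sub>0 nat) \<times> ('r::finite \<Rightarrow>\<^sub>0 nat)) set"
  assumes "finite T"
  shows "fg_monoid (sat_monoid T AA)"
proof -
  have "finite AA" by (rule finite_subset[of _ UNIV]) auto
  then show ?thesis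
    unfolding sat_monoid_def
    by (induction AA rule: finite_induct) (simp_all add: fg_monoid_UNIV fg_monoid_Int fg_local_monoid assms)
qed

section \<open>Cutting exponents by a linear bound in the degree\<close>

definition total_degree :: "('r::finite \<Rightarrow>\<^sub>0 nat) \<Rightarrow> nat" where
  "total_degree n = (\<Sum>j\<in>UNIV. Poly_Mapping.lookup n j)"

definition bounded_monoid :: "nat \<Rightarrow> (('v \<Rightarrow>\<^sub>0 nat) \<times> ('r::finite \<Rightarrow>\<^sub>0 nat)) set" where
  "bounded_monoid c = {(a, n). \<forall>i. Poly_Mapping.lookup a i \<le> c * total_degree n}"

lemma total_degree_add: "total_degree (m + n) = total_degree m + total_degree n"
  by (simp add: total_degree_def lookup_add sum.distrib)

lemma total_degree_single [simp]: "total_degree (Poly_Mapping.single j k) = k"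
  by (simp add: total_degree_def lookup_single when_def)

lemma total_degree_0 [simp]: "total_degree 0 = 0"
  by (simp add: total_degree_def)

lemma total_degree_eq_0_iff: "total_degree n = 0 \<longleftrightarrow> n = 0"
  by (auto simp: total_degree_def poly_mapping_eq_iff fun_eq_iff)

lemma inj_on_lookup: "inj_on Poly_Mapping.lookup X"
  by (rule inj_onI) (simp only: lookup_inject)

lemma lookup_box_subset_PiE:
  "Poly_Mapping.lookup ` {a :: 'v::finite \<Rightarrow>\<^sub>0 nat. \<forall>i. Poly_Mapping.lookup a i < m} \<subseteq> PiE UNIV (\<lambda>_. {..<m})"
  by auto

lemma finite_box: "finite {a :: 'v::finite \<Rightarrow>\<^sub>0 nat. \<forall>i. Poly_Mapping.lookup a i < m}"
proof (rule finite_imageD)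
  show "finite (Poly_Mapping.lookup ` {a :: 'v \<Rightarrow>\<^sub>0 nat. \<forall>i. Poly_Mapping.lookup a i < m})"
    by (rule finite_subset[OF lookup_box_subset_PiE]) (intro finite_PiE, auto)
qed (rule inj_on_lookup)

lemma card_box_le: "card {a :: 'v::finite \<Rightarrow>\<^sub>0 nat. \<forall>i. Poly_Mapping.lookup a i < m} \<le> m ^ CARD('v)"
proof -
  let ?X = "{a :: 'v \<Rightarrow>\<^sub>0 nat. \<forall>i. Poly_Mapping.lookup a i < m}"
  have "card ?X = card (Poly_Mapping.lookup ` ?X)"
    by (rule card_image[OF inj_on_lookup, symmetric])
  also have "\<dots> \<le> card (PiE (UNIV :: 'v set) (\<lambda>_. {..<m}))"
    by (rule card_mono[OF _ lookup_box_subset_PiE]) (intro finite_PiE, auto)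
  also have "\<dots> = m ^ CARD('v)" by (simp add: card_PiE)
  finally show ?thesis .
qed

text \<open>Generators in degree 1 suffice. Peeling off \<open>min (a_i) c\<close> in every
  coordinate, together with one unit vector of \<open>n\<close>, leaves exponents at most
  \<open>c\<close> times the remaining degree.\<close>

lemma fg_bounded_monoid:
  "fg_monoid (bounded_monoid c :: (('v::finite \<Rightarrow>\<^sub>0 nat) \<times> ('r::finite \<Rightarrow>\<^sub>0 nat)) set)"
proof -
  let ?S = "{a :: 'v \<Rightarrow>\<^sub>0 nat. \<forall>i. Poly_Mapping.lookup a i < Suc c} \<times> range (\<lambda>j :: 'r. Poly_Mapping.single j (1::nat))"
  have "bounded_monoid c = mgen ?S"
  proof
    show "mgen ?S \<subseteq> bounded_monoid c"
      by (rule mgen_least) (auto simp: bounded_monoid_def total_degree_add lookup_add distrib_left less_Suc_eq_le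
          zero_prod_def intro!: add_mono)
    have "(a, n) \<in> mgen ?S" if "(a, n) \<in> bounded_monoid c" for a n
      using that
    proof (induction "total_degree n" arbitrary: a n)
      case 0
      then have "n = 0" by (simp add: total_degree_eq_0_iff)
      moreover from this 0 have "a = 0" by (auto simp: bounded_monoid_def poly_mapping_eq_iff fun_eq_iff)
      ultimately show ?case using mgen_0[of ?S] by (simp add: zero_prod_def)
    next
      case (Suc k)
      then have "n \<noteq> 0" using total_degree_eq_0_iff[of n] by simp
      then obtain j where j: "Poly_Mapping.lookup n j \<noteq> 0" by (auto simp: poly_mapping_eq_iff fun_eq_iff)
      define n' where "n' = n - Poly_Mapping.single j 1"
      have n: "n = Poly_Mapping.single j 1 + n'"
        unfolding n'_def using j by (intro exp_le_add) (auto simp: lookup_single when_def)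
      then have k: "k = total_degree n'" using Suc.hyps(2) by (simp add: total_degree_add)
      define a1 where "a1 = (\<Sum>i\<in>UNIV. Poly_Mapping.single i (min (Poly_Mapping.lookup a i) c))"
      have a1: "Poly_Mapping.lookup a1 i = min (Poly_Mapping.lookup a i) c" for i
        by (simp add: a1_def lookup_sum lookup_single when_def)
      have a: "a = a1 + (a - a1)" by (rule exp_le_add) (simp add: a1)
      have "Poly_Mapping.lookup a i \<le> c * Suc k" for i
        using Suc.prems Suc.hyps(2) by (simp add: bounded_monoid_def)
      then have "Poly_Mapping.lookup (a - a1) i \<le> c * k" for i
        by (simp add: lookup_minus a1 min_def le_diff_conv add.commute)
      then have "(a - a1, n') \<in> mgen ?S"
        by (intro Suc.hyps(1) k) (simp add: bounded_monoid_def k)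
      moreover have "(a1, Poly_Mapping.single j 1) \<in> mgen ?S"
        by (intro mgen_base) (auto simp: a1 less_Suc_eq_le)
      ultimately have "(a1, Poly_Mapping.single j 1) + (a - a1, n') \<in> mgen ?S" by (intro mgen_add)
      then show ?case using a n by simp
    qed
    then show "bounded_monoid c \<subseteq> mgen ?S" by auto
  qed
  moreover have "finite ?S" using finite_box by (intro finite_cartesian_product) auto
  ultimately show ?thesis unfolding fg_monoid_def by blast
qed

lemma mgen_remove_0: "mgen (C - {0}) = mgen C"
proof
  show "mgen C \<subseteq> mgen (C - {0})"
    by (rule mgen_least) (auto intro: mgen_0 mgen_add mgen_base)
qed (auto intro!: mgen_mono)

text \<open>The bound forces an element of degree 0 to be 0. After removing 0 from the generators
  all of them have total degree at least 1, as the counting theorem demands.\<close>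

lemma quasi_alg_card_fibre:
  fixes N :: "(('v::finite \<Rightarrow>\<^sub>0 nat) \<times> ('r::finite \<Rightarrow>\<^sub>0 nat)) set"
  assumes "fg_monoid N" "N \<subseteq> bounded_monoid c"
  shows "\<exists>f \<in> quasi_alg (range affine_eval). \<forall>n. f (\<lambda>j. int (Poly_Mapping.lookup n j)) = of_nat (card {a. (a, n) \<in> N})"
proof -
  obtain C where C: "finite C" "N = mgen C" "0 \<notin> C"
    using assms(1) unfolding fg_monoid_def by (metis Diff_iff finite_Diff insertI1 mgen_remove_0)
  define deg where "deg x j = int (Poly_Mapping.lookup (snd x) j)" for x :: "('v \<Rightarrow>\<^sub>0 nat) \<times> ('r \<Rightarrow>\<^sub>0 nat)" and j
  have "(\<lambda>z. of_nat (card {x \<in> mgen C. deg x = z})) \<in> quasi_alg (range affine_eval)"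
  proof (rule quasi_alg_card_mgen[OF C(1)])
    fix x assume x: "x \<in> C"
    then have "x \<in> bounded_monoid c" using assms(2) C(2) mgen_base by blast
    then have "fst x = 0" if "snd x = 0"
      using that by (intro poly_mapping_eqI) (auto simp: bounded_monoid_def)
    then have "snd x \<noteq> 0" using x C(3) by (metis prod.collapse zero_prod_def)
    then have "total_degree (snd x) \<noteq> 0" by (simp add: total_degree_eq_0_iff)
    then show "(\<Sum>j\<in>UNIV. deg x j) \<ge> 1"
      unfolding deg_def of_nat_sum[symmetric] total_degree_def[symmetric] by linarith
  qed (auto simp: deg_def lookup_add fun_eq_iff)
  moreover have "card {x \<in> mgen C. deg x = (\<lambda>j. int (Poly_Mapping.lookup n j))} = card {a. (a, n) \<in> N}" for n
  proof -
    have deg_eq: "deg x = (\<lambda>j. int (Poly_Mapping.lookup n j)) \<longleftrightarrow> snd x = n" for x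
      unfolding deg_def fun_eq_iff by (auto intro: poly_mapping_eqI)
    have "{x \<in> mgen C. deg x = (\<lambda>j. int (Poly_Mapping.lookup n j))} = (\<lambda>a. (a, n)) ` {a. (a, n) \<in> N}"
      unfolding C(2) deg_eq by auto
    then show ?thesis by (simp add: card_image inj_on_def)
  qed
  ultimately show ?thesis by (intro bexI) auto
qed

section \<open>The symbolic multi-Rees algebra\<close>

definition monoid_algebra :: "(('v \<Rightarrow>\<^sub>0 nat) \<times> ('r \<Rightarrow>\<^sub>0 nat)) set \<Rightarrow> (('r \<Rightarrow>\<^sub>0 nat) \<Rightarrow>\<^sub>0 ('v, 'k::field) mpoly) set" where
  "monoid_algebra N = {P. \<forall>n. Poly_Mapping.lookup P n \<in> mon_span {a. (a, n) \<in> N}}"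

lemma mon_span_closed:
  "0 \<in> mon_span U" "f \<in> mon_span U \<Longrightarrow> g \<in> mon_span U \<Longrightarrow> f + g \<in> mon_span U"
  "f \<in> mon_span U \<Longrightarrow> g \<in> mon_span U \<Longrightarrow> f - g \<in> mon_span U"
  using keys_add[of f g] keys_diff[of f g] by (auto simp: mon_span_def)

lemma mon_span_sum: "(\<And>i. i \<in> A \<Longrightarrow> f i \<in> mon_span U) \<Longrightarrow> sum f A \<in> mon_span U"
  by (induction A rule: infinite_finite_induct) (auto intro: mon_span_closed)

lemma mon_span_mult: "f \<in> mon_span U \<Longrightarrow> g \<in> mon_span V \<Longrightarrow> f * g \<in> mon_span (sumset U V)"
  using keys_mult[of f g] unfolding mon_span_def sumset_def by blast

lemma is_subring_monoid_algebra:
  fixes N :: "(('v \<Rightarrow>\<^sub>0 nat) \<times> ('r \<Rightarrow>\<^sub>0 nat)) set"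
  assumes "0 \<in> N" "\<And>x y. x \<in> N \<Longrightarrow> y \<in> N \<Longrightarrow> x + y \<in> N"
  shows "is_subring (monoid_algebra N :: (('r \<Rightarrow>\<^sub>0 nat) \<Rightarrow>\<^sub>0 ('v, 'k::field) mpoly) set)"
  unfolding is_subring_def
proof (intro conjI ballI)
  have "(0, 0) \<in> N" using assms(1) by (simp add: zero_prod_def)
  then show "1 \<in> monoid_algebra N"
    by (auto simp: monoid_algebra_def lookup_one when_def mon_span_closed) (simp add: mon_span_def)
  fix P Q :: "('r \<Rightarrow>\<^sub>0 nat) \<Rightarrow>\<^sub>0 ('v, 'k) mpoly"
  assume P: "P \<in> monoid_algebra N" and Q: "Q \<in> monoid_algebra N"
  then show "P + Q \<in> monoid_algebra N" "P - Q \<in> monoid_algebra N"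
    by (auto simp: monoid_algebra_def lookup_add lookup_minus intro: mon_span_closed)
  let ?p = "Poly_Mapping.lookup P" and ?q = "Poly_Mapping.lookup Q"
  have "P * Q = (\<Sum>k\<in>Poly_Mapping.keys P. Poly_Mapping.single k (?p k)) *
     (\<Sum>l\<in>Poly_Mapping.keys Q. Poly_Mapping.single l (?q l))"
    using poly_mapping_monomials[of P] poly_mapping_monomials[of Q] by simp
  then have PQ: "P * Q = (\<Sum>k\<in>Poly_Mapping.keys P. \<Sum>l\<in>Poly_Mapping.keys Q. Poly_Mapping.single (k + l) (?p k * ?q l))"
    by (simp add: sum_product mult_single)
  have "Poly_Mapping.lookup (P * Q) n \<in> mon_span {a. (a, n) \<in> N}" for n
    unfolding PQ lookup_sum
  proof (intro mon_span_sum)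
    fix k l
    have sub: "sumset {a. (a, k) \<in> N} {a. (a, l) \<in> N} \<subseteq> {a. (a, k + l) \<in> N}"
    proof
      fix a assume "a \<in> sumset {a. (a, k) \<in> N} {a. (a, l) \<in> N}"
      then obtain b c where "a = b + c" "(b, k) \<in> N" "(c, l) \<in> N" by (auto simp: sumset_def)
      then show "a \<in> {a. (a, k + l) \<in> N}" using assms(2)[of "(b, k)" "(c, l)"] by simp
    qed
    have "?p k * ?q l \<in> mon_span (sumset {a. (a, k) \<in> N} {a. (a, l) \<in> N})"
      using P Q by (intro mon_span_mult) (auto simp: monoid_algebra_def)
    then have "?p k * ?q l \<in> mon_span {a. (a, k + l) \<in> N}" using sub by (auto simp: mon_span_def)
    then show "Poly_Mapping.lookup (Poly_Mapping.single (k + l) (?p k * ?q l)) n \<in> mon_span {a. (a, n) \<in> N}"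
      by (auto simp: lookup_single when_def mon_span_closed)
  qed
  then show "P * Q \<in> monoid_algebra N" by (simp add: monoid_algebra_def)
qed

lemma single_in_monoid_algebra_iff:
  "Poly_Mapping.single n (monom a) \<in> monoid_algebra N \<longleftrightarrow> (a, n) \<in> N"
  by (auto simp: monoid_algebra_def lookup_single when_def monom_in_mon_span_iff mon_span_closed)

text \<open>The base of the adjunction is the copy of the field formed by the constants
  \<open>\<kappa> c\<close>. Monomials for the generators in \<open>C\<close> multiply to monomials
  for all of \<open>N\<close>, and every element of the algebra is a finite combination of these
  with constant coefficients.\<close>

theorem noetherian_monoid_algebra:
  fixes N :: "(('v \<Rightarrow>\<^sub>0 nat) \<times> ('r \<Rightarrow>\<^sub>0 nat)) set"
  assumes "fg_monoid N"
  shows "noetherian_subring (monoid_algebra N :: (('r \<Rightarrow>\<^sub>0 nat) \<Rightarrow>\<^sub>0 ('v, 'k::field) mpoly) set)"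
proof -
  let ?S = "monoid_algebra N :: (('r \<Rightarrow>\<^sub>0 nat) \<Rightarrow>\<^sub>0 ('v, 'k) mpoly) set"
  obtain C where C: "finite C" "N = mgen C" using assms by (auto simp: fg_monoid_def)
  have S: "is_subring ?S" by (rule is_subring_monoid_algebra) (auto simp: C(2) mgen_0 mgen_add)
  define \<kappa> :: "'k \<Rightarrow> ('r \<Rightarrow>\<^sub>0 nat) \<Rightarrow>\<^sub>0 ('v, 'k) mpoly"
    where "\<kappa> c = Poly_Mapping.single 0 (Poly_Mapping.single 0 c)" for c
  have \<kappa>: "\<kappa> 1 = 1" "\<kappa> (c + d) = \<kappa> c + \<kappa> d" "\<kappa> (c - d) = \<kappa> c - \<kappa> d" "\<kappa> (c * d) = \<kappa> c * \<kappa> d" for c d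
    by (simp_all add: \<kappa>_def single_add single_diff mult_single)
  have "is_subring (range \<kappa>)" unfolding is_subring_def
  proof (intro conjI ballI)
    show "1 \<in> range \<kappa>" using \<kappa>(1) by (metis rangeI)
  qed (auto simp: \<kappa>(2-)[symmetric])
  then have K: "noetherian_subring (range \<kappa>)"
  proof (rule noetherian_field)
    fix b assume "b \<in> range \<kappa>" "b \<noteq> 0"
    then obtain c where c: "b = \<kappa> c" by auto
    with \<open>b \<noteq> 0\<close> have "c \<noteq> 0" by (auto simp: \<kappa>_def)
    with c have "\<kappa> (inverse c) * b = 1" by (simp add: \<kappa>(4)[symmetric] \<kappa>(1))
    then show "\<exists>c\<in>range \<kappa>. c * b = 1" by blast
  qed
  define X where "X = (\<lambda>(a, n). Poly_Mapping.single n (monom a :: ('v, 'k) mpoly)) ` C"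
  have "finite X" using C(1) by (simp add: X_def)
  from noetherian_adjoin_finite[OF this K] obtain A where A: "noetherian_subring A" "range \<kappa> \<subseteq> A" "X \<subseteq> A"
    "\<And>A'. is_subring A' \<Longrightarrow> range \<kappa> \<subseteq> A' \<Longrightarrow> X \<subseteq> A' \<Longrightarrow> A \<subseteq> A'" by auto
  have subA: "is_subring A" using A(1) by (simp add: noetherian_subring_def)
  have "A \<subseteq> ?S"
  proof (rule A(4)[OF S])
    have "(0, 0) \<in> N" using mgen_0[of C] C(2) by (simp add: zero_prod_def)
    then show "range \<kappa> \<subseteq> ?S"
      by (auto simp: \<kappa>_def monoid_algebra_def lookup_single when_def mon_span_closed)
        (auto simp: mon_span_def)
    show "X \<subseteq> ?S" using C(2) mgen_base by (auto simp: X_def single_in_monoid_algebra_iff)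
  qed
  moreover have "?S \<subseteq> A"
  proof
    fix P :: "('r \<Rightarrow>\<^sub>0 nat) \<Rightarrow>\<^sub>0 ('v, 'k) mpoly" assume P: "P \<in> ?S"
    have mon: "Poly_Mapping.single (snd x) (monom (fst x)) \<in> A" if "x \<in> mgen C" for x
      using that
    proof (induction rule: mgen_induct)
      case (base x)
      then show ?case using A(3) by (force simp: X_def)
    next
      case zero
      then show ?case using subring_closed(1)[OF subA] by (simp add: monom_def)
    next
      case (add x y)
      then show ?case using subring_closed(5)[OF subA add.IH] by (simp add: mult_single monom_add)
    qed
    have "Poly_Mapping.single n (Poly_Mapping.single a c) \<in> A" if "(a, n) \<in> N" for a n c
    proof -
      have "\<kappa> c * Poly_Mapping.single n (monom a) \<in> A"
        using mon[of "(a, n)"] that A(2) C(2) by (intro subring_closed(5)[OF subA]) auto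
      then show ?thesis by (simp add: \<kappa>_def mult_single monom_def)
    qed
    moreover have "a \<in> Poly_Mapping.keys (Poly_Mapping.lookup P n) \<Longrightarrow> (a, n) \<in> N" for a n
      using P by (auto simp: monoid_algebra_def mon_span_def)
    ultimately have terms: "(\<Sum>n\<in>Poly_Mapping.keys P. \<Sum>a\<in>Poly_Mapping.keys (Poly_Mapping.lookup P n).
        Poly_Mapping.single n (Poly_Mapping.single a (Poly_Mapping.lookup (Poly_Mapping.lookup P n) a))) \<in> A"
      by (intro subring_sum[OF subA]) auto
    have single_sum: "Poly_Mapping.single n (sum g Y) = (\<Sum>a\<in>Y. Poly_Mapping.single n (g a))"
      for n :: "'r \<Rightarrow>\<^sub>0 nat" and g :: "('v \<Rightarrow>\<^sub>0 nat) \<Rightarrow> ('v, 'k) mpoly" and Y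
      by (induction Y rule: infinite_finite_induct) (auto simp: single_add)
    have "P = (\<Sum>n\<in>Poly_Mapping.keys P. Poly_Mapping.single n (Poly_Mapping.lookup P n))"
      by (rule poly_mapping_monomials)
    also have "\<dots> = (\<Sum>n\<in>Poly_Mapping.keys P. \<Sum>a\<in>Poly_Mapping.keys (Poly_Mapping.lookup P n).
        Poly_Mapping.single n (Poly_Mapping.single a (Poly_Mapping.lookup (Poly_Mapping.lookup P n) a)))"
      unfolding single_sum[symmetric] poly_mapping_monomials[symmetric] ..
    finally show "P \<in> A" using terms by simp
  qed
  ultimately show ?thesis using A(1) by simp
qed

section \<open>Numerical polynomial bounds\<close>

lemma sum_fun_upd:
  fixes k :: "'r::finite \<Rightarrow> nat"
  shows "sum (k(j := v)) UNIV = v + sum k (UNIV - {j})"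
  by (subst sum.remove[of _ j]) (auto intro: sum.cong)

lemma poly_eval_coordinate_mult:
  fixes c :: "('r::finite \<Rightarrow> nat) \<Rightarrow> rat"
  shows "\<exists>c'. \<forall>x. poly_eval (Suc D) c' x = of_int (x j) * poly_eval D c x"
proof (intro exI allI)
  fix x :: "'r \<Rightarrow> int"
  let ?c = "\<lambda>i. if i j = 0 then 0 else c (i(j := i j - 1))"
  let ?m = "\<lambda>i. \<Prod>j\<in>UNIV. of_int (x j) ^ i j :: rat"
  have sum_eq: "sum k UNIV = k j + sum k (UNIV - {j})" for k :: "'r \<Rightarrow> nat"
    by (rule sum.remove) auto
  have "poly_eval (Suc D) ?c x = (\<Sum>i\<in>{i. sum i UNIV \<le> Suc D \<and> i j \<noteq> 0}. c (i(j := i j - 1)) * ?m i)"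
    unfolding poly_eval_def by (intro sum.mono_neutral_cong_right finite_degree_le) auto
  also have "\<dots> = (\<Sum>k\<in>{k. sum k UNIV \<le> D}. of_int (x j) * (c k * ?m k))"
  proof (rule sum.reindex_bij_witness[of _ "\<lambda>k. k(j := Suc (k j))" "\<lambda>i. i(j := i j - 1)"], goal_cases)
    case (1 i)
    then show ?case by auto
  next
    case (2 i)
    then show ?case using sum_eq[of i] unfolding mem_Collect_eq sum_fun_upd by auto
  next
    case (3 k)
    then show ?case by auto
  next
    case (4 k)
    then show ?case using sum_eq[of k] unfolding mem_Collect_eq sum_fun_upd by auto
  next
    case (5 i)
    have "?m i = of_int (x j) ^ i j * (\<Prod>l\<in>UNIV - {j}. of_int (x l) ^ i l)" by (rule prod.remove) auto
    also have "(\<Prod>l\<in>UNIV - {j}. of_int (x l) ^ i l) = (\<Prod>l\<in>UNIV - {j}. (of_int (x l) :: rat) ^ (i(j := i j - 1)) l)"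
      by (intro prod.cong) auto
    also have "(of_int (x j) :: rat) ^ i j = of_int (x j) * of_int (x j) ^ (i(j := i j - 1)) j"
      using 5 by (simp add: power_eq_if)
    also have "\<dots> * (\<Prod>l\<in>UNIV - {j}. of_int (x l) ^ (i(j := i j - 1)) l) =
       of_int (x j) * ?m (i(j := i j - 1))"
      by (subst prod.remove[of UNIV j]) (auto simp: mult.assoc)
    finally show ?case by (simp add: mult_ac)
  qed
  also have "\<dots> = of_int (x j) * poly_eval D c x"
    by (simp add: poly_eval_def sum_distrib_left)
  finally show "poly_eval (Suc D) ?c x = of_int (x j) * poly_eval D c x" .
qed

text \<open>Provides the bounding polynomial: its value is the size of the box of exponents that can
  contribute to the length.\<close>

lemma poly_eval_linear_power:
  "\<exists>cf. \<forall>x :: 'r::finite \<Rightarrow> int. poly_eval D cf x = (of_nat c * (\<Sum>j\<in>UNIV. of_int (x j))) ^ D"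
proof (induction D)
  case 0
  have "{i :: 'r \<Rightarrow> nat. sum i UNIV \<le> 0} = {\<lambda>_. 0}" by auto
  then show ?case by (intro exI[of _ "\<lambda>_. 1"]) (simp add: poly_eval_def)
next
  case (Suc D)
  then obtain cf where cf: "\<And>x :: 'r \<Rightarrow> int. poly_eval D cf x = (of_nat c * (\<Sum>j\<in>UNIV. of_int (x j))) ^ D" by auto
  obtain cj where cj: "\<And>j x. poly_eval (Suc D) (cj j) x = of_int (x j) * poly_eval D cf x"
    using poly_eval_coordinate_mult[of D _ cf] by metis
  show ?case
  proof (intro exI[of _ "\<lambda>i. \<Sum>j\<in>UNIV. of_nat c * cj j i"] allI)
    fix x :: "'r \<Rightarrow> int"
    have "poly_eval (Suc D) (\<lambda>i. \<Sum>j\<in>UNIV. of_nat c * cj j i) x = (\<Sum>j\<in>UNIV. of_nat c * poly_eval (Suc D) (cj j) x)"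
      unfolding poly_eval_def sum_distrib_left sum_distrib_right by (subst sum.swap) (simp add: mult.assoc)
    also have "\<dots> = (of_nat c * (\<Sum>j\<in>UNIV. of_int (x j))) ^ Suc D"
      unfolding cj cf by (simp add: sum_distrib_left sum_distrib_right mult.assoc)
    finally show "poly_eval (Suc D) (\<lambda>i. \<Sum>j\<in>UNIV. of_nat c * cj j i) x =
      (of_nat c * (\<Sum>j\<in>UNIV. of_int (x j))) ^ Suc D" .
  qed
qed

lemma mgen_power_gens_bound:
  fixes B :: "'r::finite \<Rightarrow> ('v::finite \<Rightarrow>\<^sub>0 nat) set"
  assumes "\<And>j. finite (B j)"
  shows "\<exists>c. \<forall>b n i. (b, n) \<in> mgen (power_gens B) \<longrightarrow> Poly_Mapping.lookup b i \<le> c * total_degree n"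
proof -
  \<comment> \<open>A crude common bound: the sum of all exponents of all generators dominates each
    single one. Each factor of a product then adds at most \<open>c\<close> to any exponent.\<close>
  define c where "c = (\<Sum>g\<in>(\<Union>j. B j). \<Sum>i\<in>UNIV. Poly_Mapping.lookup g i)"
  have c: "Poly_Mapping.lookup g i \<le> c" if "g \<in> B j" for g i j
  proof -
    have "Poly_Mapping.lookup g i \<le> (\<Sum>i\<in>UNIV. Poly_Mapping.lookup g i)" by (intro member_le_sum) auto
    also have "\<dots> \<le> c" unfolding c_def
      using that assms member_le_sum[of g "\<Union>j. B j" "\<lambda>g. \<Sum>i\<in>UNIV. Poly_Mapping.lookup g i"] by auto
    finally show ?thesis .
  qed
  have "mgen (power_gens B) \<subseteq> bounded_monoid c"
    using c by (intro mgen_least)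
      (auto simp: power_gens_def bounded_monoid_def total_degree_add lookup_add distrib_left zero_prod_def intro!: add_mono)
  then show ?thesis by (intro exI[of _ c]) (auto simp: bounded_monoid_def)
qed

section \<open>Noetherian gradedness, the length function and its polynomial bound\<close>

theorem theorem1p2:
  fixes I :: "'r::finite \<Rightarrow> ('v::finite, 'k::field) mpoly set"
    and J :: "('v, 'k) mpoly set"
  assumes mon: "\<And>j. monomial_ideal (I j)"
    and J: "is_ideal J"
  shows "noetherian_subring (symb_multi_rees J I)
       \<and> (\<forall>f. Poly_Mapping.single 0 f \<in> symb_multi_rees J I)
       \<and> (\<forall>P\<in>symb_multi_rees J I. \<forall>n.
            Poly_Mapping.single n (Poly_Mapping.lookup P n) \<in> symb_multi_rees J I)
       \<and> (\<exists>F :: ('r \<Rightarrow> nat) \<Rightarrow> nat.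
           piecewise_quasi_poly (\<lambda>n. of_nat (F n)) \<and>
           (\<exists>N. \<forall>n. (\<forall>j. n j \<ge> N) \<longrightarrow> H0_length (ideal_multipow I n) = enat (F n)))
       \<and> (\<exists>c N. numerical_poly CARD('v) c \<and>
           (\<forall>n. (\<forall>j. n j \<ge> N) \<longrightarrow>
              (\<exists>k. H0_length (ideal_multipow I n) = enat k \<and>
                   of_nat k \<le> poly_eval CARD('v) c (\<lambda>j. int (n j)))))"
proof -
  have "\<forall>j. \<exists>B. finite B \<and> I j = mon_span (sumset B UNIV)" using monomial_ideal_finite mon by blast
  then obtain B where B: "\<And>j. finite (B j)" and I: "\<And>j. I j = mon_span (sumset (B j) UNIV)" by metis
  define U where "U n = exp_multipow (\<lambda>j. sumset (B j) UNIV) n" for n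
  define T where "T = power_gens B"
  have finT: "finite T" using B by (simp add: T_def power_gens_def)
  have up: "upset (U n)" for n unfolding U_def by (rule upset_exp_multipow)
  have I_eq: "I = (\<lambda>j. mon_span (sumset (B j) UNIV))" using I by auto
  have pow: "ideal_multipow I n = mon_span (U n)" for n
    unfolding I_eq U_def by (rule ideal_multipow_mon_span)
  have sat: "saturation (ideal_multipow I (Poly_Mapping.lookup n)) J' = mon_span {a. (a, n) \<in> sat_monoid T (avoiding J')}"
    for n and J' :: "('v, 'k) mpoly set"
    unfolding pow saturation_mon_span[OF up] unfolding U_def
    by (simp add: local_exps_exp_multipow T_def sat_monoid_def)
  have rees: "symb_multi_rees J I = monoid_algebra (sat_monoid T (avoiding J))"
    unfolding symb_multi_rees_def monoid_algebra_def sat ..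
  \<comment> \<open>In degree 0 the ideal is the whole ring, so no exponent is excluded; this embeds
    \<open>R\<close> as the degree 0 part.\<close>
  have zero: "(a, 0) \<in> sat_monoid T AA" for a AA by (simp add: sat_monoid_def zero_local_monoid)
  have grade0: "Poly_Mapping.single 0 f \<in> symb_multi_rees J I" for f
    unfolding rees monoid_algebra_def by (auto simp: lookup_single when_def mon_span_closed zero) (simp add: mon_span_def)
  have graded: "Poly_Mapping.single n (Poly_Mapping.lookup P n) \<in> symb_multi_rees J I"
    if "P \<in> symb_multi_rees J I" for P n
    using that unfolding rees monoid_algebra_def by (auto simp: lookup_single when_def mon_span_closed)
  obtain c where c: "\<And>b n i. (b, n) \<in> mgen T \<Longrightarrow> Poly_Mapping.lookup b i \<le> c * total_degree n"
    using mgen_power_gens_bound[of B] B unfolding T_def by metis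
  \<comment> \<open>By \<open>avoiding_max_ideal\<close>, \<open>S1\<close> describes the
    saturations with respect to \<open>m_R\<close>, while \<open>S2\<close> describes the powers
    themselves. The length over \<open>n\<close> is the number of elements in the fibre of
    \<open>S1 - S2\<close>.\<close>
  define S1 where "S1 = sat_monoid T {A. A \<noteq> UNIV}"
  define S2 where "S2 = local_monoid T UNIV"
  have S21: "S2 \<subseteq> S1" by (auto simp: S1_def S2_def sat_monoid_def local_monoid_def)
  have bound: "Poly_Mapping.lookup a i < c * total_degree n" if a: "(a, n) \<in> S1 - S2" for a n i
  proof -
    \<comment> \<open>Membership for the set \<open>UNIV - {i}\<close> gives a product of generators
      that divides \<open>X^a\<close> except possibly in \<open>X_i\<close>. Outside
      \<open>S2\<close> it must fail there, so \<open>a_i\<close> is smaller than an exponent of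
      that product.\<close>
    have "UNIV - {i} \<in> {A. A \<noteq> UNIV}" by blast
    then have "(a, n) \<in> local_monoid T (UNIV - {i})" using a unfolding S1_def sat_monoid_def by blast
    then obtain b where b: "(b, n) \<in> mgen T" "\<forall>k\<in>UNIV - {i}. Poly_Mapping.lookup b k \<le> Poly_Mapping.lookup a k"
      by (auto simp: local_monoid_def)
    have "\<not> Poly_Mapping.lookup b i \<le> Poly_Mapping.lookup a i"
    proof
      assume "Poly_Mapping.lookup b i \<le> Poly_Mapping.lookup a i"
      then have "exp_le b a" using b(2) by (metis DiffI UNIV_I singletonD)
      then have "(a, n) \<in> S2" using b(1) by (auto simp: S2_def local_monoid_def)
      with a show False by simp
    qed
    then show ?thesis using c[OF b(1), of i] by linarith
  qed
  \<comment> \<open>Degrees of the Rees algebra are finitely supported maps, while the length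
    function takes plain functions; the finite index type makes the two interchangeable.\<close>
  define pm where "pm n = Abs_poly_mapping n" for n :: "'r \<Rightarrow> nat"
  have pm: "Poly_Mapping.lookup (pm n) = n" for n by (simp add: pm_def)
  define D where "D n = {a. (a, n) \<in> S1} - {a. (a, n) \<in> S2}" for n
  have D_box: "D n \<subseteq> {a. \<forall>i. Poly_Mapping.lookup a i < c * total_degree n}" for n
    using bound by (auto simp: D_def)
  have fin: "finite (D n)" for n by (rule finite_subset[OF D_box finite_box])
  have U_S2: "U n = {a. (a, pm n) \<in> S2}" for n
    using exp_multipow_iff[of _ B "pm n"] by (auto simp: U_def S2_def local_monoid_def T_def pm)
  have len: "H0_length (ideal_multipow I n) = enat (card (D (pm n)))" for n
  proof -
    have "saturation (ideal_multipow I n) max_ideal = mon_span {a. (a, pm n) \<in> S1}"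
      using sat[of "pm n" max_ideal] by (simp add: pm avoiding_max_ideal S1_def)
    moreover have "upset {a. (a, pm n) \<in> S1}"
      unfolding upset_def
    proof (intro ballI allI)
      fix a b assume "a \<in> {a. (a, pm n) \<in> S1}"
      then have "(a, pm n) + (b, 0) \<in> S1"
        unfolding S1_def sat_monoid_def by (blast intro: local_monoid_add zero_local_monoid)
      then show "a + b \<in> {a. (a, pm n) \<in> S1}" by simp
    qed
    ultimately show ?thesis unfolding H0_length_def pow
      using quot_length_mon_span[OF _ up, of "{a. (a, pm n) \<in> S1}" n, where 'k = 'k] fin[of "pm n"] S21
      by (auto simp: U_S2 D_def)
  qed
  define F where "F n = card (D (pm n))" for n
  define K1 where "K1 = S1 \<inter> bounded_monoid c"
  define K2 where "K2 = S2 \<inter> bounded_monoid c"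
  have fg: "fg_monoid K1" "fg_monoid K2" unfolding K1_def K2_def S1_def S2_def
    by (intro fg_monoid_Int fg_sat_monoid fg_local_monoid fg_bounded_monoid finT)+
  obtain f1 where f1: "f1 \<in> quasi_alg (range affine_eval)"
    "\<And>n. f1 (\<lambda>j. int (Poly_Mapping.lookup n j)) = of_nat (card {a. (a, n) \<in> K1})"
    using quasi_alg_card_fibre[OF fg(1), of c] by (auto simp: K1_def)
  obtain f2 where f2: "f2 \<in> quasi_alg (range affine_eval)"
    "\<And>n. f2 (\<lambda>j. int (Poly_Mapping.lookup n j)) = of_nat (card {a. (a, n) \<in> K2})"
    using quasi_alg_card_fibre[OF fg(2), of c] by (auto simp: K2_def)
  have F: "of_nat (F n) = f1 (\<lambda>j. int (n j)) - f2 (\<lambda>j. int (n j))" for n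
  proof -
    have box: "{a. (a, pm n) \<in> bounded_monoid c} \<subseteq> {a :: 'v \<Rightarrow>\<^sub>0 nat. \<forall>i. Poly_Mapping.lookup a i < Suc (c * total_degree (pm n))}"
      by (auto simp: bounded_monoid_def less_Suc_eq_le)
    have fin1: "finite {a. (a, pm n) \<in> K1}"
      by (rule finite_subset[OF subset_trans[OF _ box] finite_box]) (auto simp: K1_def)
    have sub: "{a. (a, pm n) \<in> K2} \<subseteq> {a. (a, pm n) \<in> K1}" using S21 by (auto simp: K1_def K2_def)
    \<comment> \<open>The cut by \<open>bounded_monoid c\<close> changes both fibres but not their
      difference, because every element of \<open>S1 - S2\<close> satisfies the bound. Finiteness of
      the cut fibres turns the difference of sets into one of cardinalities.\<close>
    have "D (pm n) = {a. (a, pm n) \<in> K1} - {a. (a, pm n) \<in> K2}"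
      using bound[of _ "pm n"] by (auto simp: D_def K1_def K2_def bounded_monoid_def less_imp_le)
    then have "F n = card {a. (a, pm n) \<in> K1} - card {a. (a, pm n) \<in> K2}"
      using card_Diff_subset[OF finite_subset[OF sub fin1] sub] by (simp add: F_def)
    then show ?thesis using card_mono[OF fin1 sub] f1(2)[of "pm n"] f2(2)[of "pm n"]
      by (simp add: pm of_nat_diff)
  qed
  have pq: "piecewise_quasi_poly (\<lambda>n. of_nat (F n))"
    unfolding F using piecewise_quasi_poly_quasi_alg[OF quasi_alg_diff[OF f1(1) f2(1)]] .
  obtain cf where cf: "\<And>x :: 'r \<Rightarrow> int. poly_eval CARD('v) cf x = (of_nat c * (\<Sum>j\<in>UNIV. of_int (x j))) ^ CARD('v)"
    using poly_eval_linear_power[where D = "CARD('v)" and c = c] by auto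
  \<comment> \<open>A power of an integral linear form takes integer values at integer points, so no
    binomial basis is called for.\<close>
  have num: "numerical_poly CARD('v) cf"
    unfolding numerical_poly_def cf by (auto intro!: Ints_power Ints_mult Ints_sum)
  have le: "of_nat (F n) \<le> poly_eval CARD('v) cf (\<lambda>j. int (n j))" for n
  proof -
    have "F n \<le> (c * total_degree (pm n)) ^ CARD('v)" unfolding F_def
      using card_mono[OF finite_box D_box] card_box_le order_trans by blast
    then have "of_nat (F n) \<le> (of_nat ((c * total_degree (pm n)) ^ CARD('v)) :: rat)" by (simp only: of_nat_le_iff)
    also have "\<dots> = poly_eval CARD('v) cf (\<lambda>j. int (n j))" unfolding cf by (simp add: total_degree_def pm)
    finally show ?thesis .
  qed
  have noeth: "noetherian_subring (symb_multi_rees J I)"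
    unfolding rees by (intro noetherian_monoid_algebra fg_sat_monoid finT)
  show ?thesis
  proof (intro conjI allI ballI)
    show "\<exists>F :: ('r \<Rightarrow> nat) \<Rightarrow> nat. piecewise_quasi_poly (\<lambda>n. of_nat (F n)) \<and>
        (\<exists>N. \<forall>n. (\<forall>j. n j \<ge> N) \<longrightarrow> H0_length (ideal_multipow I n) = enat (F n))"
      using pq len by (intro exI[of _ F]) (simp add: F_def)
    show "\<exists>c N. numerical_poly CARD('v) c \<and>
           (\<forall>n. (\<forall>j. n j \<ge> N) \<longrightarrow>
              (\<exists>k. H0_length (ideal_multipow I n) = enat k \<and>
                   of_nat k \<le> poly_eval CARD('v) c (\<lambda>j. int (n j))))"
      \<comment> \<open>Both the length formula and the bound were shown for all \<open>n\<close>,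
        so the threshold 0 is admissible.\<close>
      using num le len by (intro exI[of _ cf] exI[of _ 0]) (simp add: F_def)
  qed (use noeth grade0 graded in auto)
qed

end
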